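(* Let $1\le D_1<D_2$ and $L=\log(D_2/D_1)$. For $i\in\{1,2\}$, let $h_i:\mathbb{R}\to\mathbb{R}$ be an absolutely continuous function with $h_i(x)=0$ for $x\le 0$ and $h_i(x)=h_i(1)$ for $x\ge 1$, and such that $V(h_i')<\infty$. Let $\rho_i(t)=h_i\!\left(\frac{\log(D_2/t)}{\log(D_2/D_1)}\right)$ for $t>0$. Then $$\sum_{d_1,d_2\ge 1}\frac{\mu(d_1)\mu(d_2)}{[d_1,d_2]}\rho_1(d_1)\rho_2(d_2)=\frac{\int_{-\infty}^{\infty}h_1'(x)h_2'(x)\,\mathrm{d}x}{L}+O\!\left(\frac{V(h_1')V(h_2')}{L^2}\right),$$ with an absolute implied constant.
   Context: $\mu$ is the Möbius function and $[d_1,d_2]$ the least common multiple. For a function $f$ defined almost everywhere on $\mathbb{R}$, $V(f)$ denotes the infimum of the total variation $|g|_{\mathrm{TV}}$ over all functions $g:\mathbb{R}\to\mathbb{R}$ equal to $f$ almost everywhere. It is not assumed that $h_i(1)=1$. *)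

theory Defs
  imports "HOL-Analysis.Analysis" "HOL-Computational_Algebra.Squarefree"
begin

text \<open>Moebius function (mu 0 = 0 by convention; only n >= 1 is used).\<close>
definition mu :: "nat \<Rightarrow> int" where
  "mu n = (if n = 0 \<or> \<not> squarefree n then 0 else (-1) ^ card (prime_factors n))"

definition abs_continuous_real :: "(real \<Rightarrow> real) \<Rightarrow> bool" where
  "abs_continuous_real f \<longleftrightarrow>
     (\<forall>\<epsilon>>0. \<exists>\<delta>>0. \<forall>(n::nat) (a::nat \<Rightarrow> real) (b::nat \<Rightarrow> real).
        (\<forall>k<n. a k \<le> b k) \<and>
        (\<forall>k<n. \<forall>j<n. k \<noteq> j \<longrightarrow> {a k<..<b k} \<inter> {a j<..<b j} = {}) \<and>
        (\<Sum>k<n. b k - a k) < \<delta>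
        \<longrightarrow> (\<Sum>k<n. \<bar>f (b k) - f (a k)\<bar>) < \<epsilon>)"

definition total_variation :: "(real \<Rightarrow> real) \<Rightarrow> ereal" where
  "total_variation g =
     (SUP xs \<in> {xs :: real list. sorted xs}.
        ereal (\<Sum>k < length xs - 1. \<bar>g (xs ! Suc k) - g (xs ! k)\<bar>))"

definition V :: "(real \<Rightarrow> real) \<Rightarrow> ereal" where
  "V f = (INF g \<in> {g :: real \<Rightarrow> real. AE x in lborel. g x = f x}. total_variation g)"

end

theory Submission
  imports Defs "HOL-Probability.Probability" "HOL-Complex_Analysis.Complex_Analysis"
    "HOL-Number_Theory.Totient"
begin

text \<open>
  Writing \<open>h\<^sub>i\<close> as an integral of its derivative and using that a function of bounded variation
  integrates against \<open>\<Phi>\<close> to at most a constant times its variation times the supremum of the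
  primitives of \<open>\<Phi>\<close> (second mean value theorem), one may test the bilinear error term on
  indicator functions of intervals \<open>[0,y]\<close>. It then suffices to show
  \<open>G(X\<^sub>1,X\<^sub>2) = \<Sum> \<mu>(d\<^sub>1)\<mu>(d\<^sub>2)/[d\<^sub>1,d\<^sub>2] log\<^sup>+(X\<^sub>1/d\<^sub>1) log\<^sup>+(X\<^sub>2/d\<^sub>2) = log min(X\<^sub>1,X\<^sub>2) + O(1)\<close>.

  Since the gcd is a divisor sum of \<open>\<phi>\<close>, \<open>G\<close> is a sum over squarefree \<open>r\<close> of
  \<open>F\<^sub>r(X\<^sub>1/r) F\<^sub>r(X\<^sub>2/r) \<phi>(r)/r\<^sup>2\<close>, where \<open>F\<^sub>r(y)\<close> is the sum of \<open>\<mu>(m)/m log(y/m)\<close> over \<open>m \<le> y\<close>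
  coprime to \<open>r\<close>. With \<open>F\<^sub>r = r/\<phi>(r) + e\<^sub>r\<close> the main terms combine by the exact identity
  \<open>\<Sum> \<mu>\<^sup>2(r)/r F\<^sub>r(X/r) = log X\<close>, and the rest is bounded once \<open>e\<^sub>r(y)\<close> decays like
  \<open>1/log\<^sup>2 y\<close>; the case \<open>r = 1\<close> propagates to all \<open>r\<close> one prime at a time.

  The decay of \<open>e\<^sub>1\<close> is a form of the prime number theorem. The Laplace transform of \<open>e\<^sub>1(exp u)\<close>
  is \<open>1/(s\<^sup>2 \<zeta>(1+s)) - 1/s\<close>; its second differences along vertical lines are integrable,
  uniformly up to the imaginary axis, by the 3-4-1 inequality, and a Fourier inversion inequality
  turns this into the pointwise bound.
\<close>

section \<open>Functions of bounded variation\<close>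

text \<open>The error may depend on D_1, D_2 only through L, so the bound for G must be an absolute
  O(1). This dictates the rate needed for e_r: the remainder is essentially a sum of e(X/r)/r over r
  \<le> X, which stays bounded if e decays like 1/log^2, while a bound 1/log would leave log log X.
  No contour is moved across the imaginary axis. For each u the transform is evaluated on Re s =
  1/u, and its second difference is taken with the same step 1/u; the region left of the axis enters
  only through Cauchy's inequality for derivatives. In the variable v, the second difference
  multiplies by 2 - 2 cos(v/u), a positive constant at v = u, while the squared step provides the
  decay 1/u^2. A separate obstacle is that h_i' is meaningful only up to null sets, while h_i is
  absolutely continuous in the epsilon-delta sense. Its representation as an integral is therefore
  built from the variation function, Radon-Nikodym and Lebesgue differentiation, for any version of
  h_i' of bounded variation.\<close>

definition lvar :: "(real \<Rightarrow> real) \<Rightarrow> real list \<Rightarrow> real" where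
  "lvar g xs = (\<Sum>k < length xs - 1. \<bar>g (xs ! Suc k) - g (xs ! k)\<bar>)"

text \<open>Both \<open>tvar g\<close> and \<open>tvar g - g\<close> are nondecreasing, a Jordan
  decomposition of \<open>g\<close>. Measurability, the second mean value theorem and Radon-Nikodym
  are each applied to these two functions.\<close>

definition tvar :: "(real \<Rightarrow> real) \<Rightarrow> real \<Rightarrow> real" where
  "tvar g x = (SUP xs \<in> {xs. sorted xs \<and> set xs \<subseteq> {..x}}. lvar g xs)"

lemma lvar_Nil [simp]: "lvar g [] = 0"
  by (simp add: lvar_def)

lemma lvar_nonneg: "0 \<le> lvar g xs"
  by (auto simp: lvar_def intro: sum_nonneg)

lemma lvar_snoc:
  assumes "xs \<noteq> []"
  shows "lvar g (xs @ [y]) = lvar g xs + \<bar>g y - g (last xs)\<bar>"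
proof -
  obtain n where n: "length xs = Suc n"
    using assms by (cases xs) auto
  have "(\<Sum>k<n. \<bar>g ((xs @ [y]) ! Suc k) - g ((xs @ [y]) ! k)\<bar>)
      = (\<Sum>k<n. \<bar>g (xs ! Suc k) - g (xs ! k)\<bar>)"
    by (rule sum.cong) (auto simp: nth_append n)
  moreover have "last xs = xs ! n"
    using assms n by (simp add: last_conv_nth)
  ultimately show ?thesis
    by (simp add: lvar_def n nth_append)
qed

lemma lvar_le_append2:
  assumes "sorted xs" "set xs \<subseteq> {..x}" "x \<le> y"
  shows "lvar g xs + \<bar>g y - g x\<bar> \<le> lvar g (xs @ [x, y])"
proof -
  have "lvar g (xs @ [x, y]) = lvar g ((xs @ [x]) @ [y])" by simp
  also have "\<dots> = lvar g (xs @ [x]) + \<bar>g y - g x\<bar>"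
    by (subst lvar_snoc) auto
  finally have "lvar g (xs @ [x, y]) = lvar g (xs @ [x]) + \<bar>g y - g x\<bar>" .
  moreover have "lvar g (xs @ [x]) \<ge> lvar g xs"
    by (cases "xs = []") (auto simp: lvar_snoc lvar_nonneg)
  ultimately show ?thesis by linarith
qed

text \<open>Triangle inequality through the value \<open>g c\<close>: an increment across
  \<open>c\<close> is cut there, and an increment on one side of \<open>c\<close> survives in one
  clamped list and becomes 0 in the other.\<close>

lemma lvar_clamp_split: "lvar g xs \<le> lvar g (map (min c) xs) + lvar g (map (max c) xs)"
proof -
  have "\<bar>g b - g a\<bar> \<le> \<bar>g (min c b) - g (min c a)\<bar> + \<bar>g (max c b) - g (max c a)\<bar>" for a b
    by (cases "a \<le> c"; cases "b \<le> c") (auto simp: min_def max_def)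
  then have "lvar g xs \<le> (\<Sum>k < length xs - 1. \<bar>g (min c (xs ! Suc k)) - g (min c (xs ! k))\<bar>
       + \<bar>g (max c (xs ! Suc k)) - g (max c (xs ! k))\<bar>)"
    unfolding lvar_def by (intro sum_mono) auto
  also have "\<dots> = lvar g (map (min c) xs) + lvar g (map (max c) xs)"
    unfolding lvar_def by (simp add: sum.distrib)
  finally show ?thesis .
qed

lemma sorted_map_min: "sorted (xs :: real list) \<Longrightarrow> sorted (map (min c) xs)"
  and sorted_map_max: "sorted xs \<Longrightarrow> sorted (map (max c) xs)"
  by (induction xs) (auto simp: min_def max_def)

context
  fixes g :: "real \<Rightarrow> real" and B :: real
  assumes bnd: "\<And>xs. sorted xs \<Longrightarrow> lvar g xs \<le> B"
begin

lemma bdd_lvar: "bdd_above (lvar g ` {xs. sorted xs \<and> P xs})"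
  using bnd by (auto intro!: bdd_aboveI2)

lemma lvar_le_tvar: "sorted xs \<Longrightarrow> set xs \<subseteq> {..x} \<Longrightarrow> lvar g xs \<le> tvar g x"
  unfolding tvar_def by (intro cSUP_upper bdd_lvar) auto

lemma tvar_leI: "(\<And>xs. sorted xs \<Longrightarrow> set xs \<subseteq> {..x} \<Longrightarrow> lvar g xs \<le> K) \<Longrightarrow> tvar g x \<le> K"
  unfolding tvar_def by (intro cSUP_least) (auto intro: exI[of _ "[]"])

lemma tvar_nonneg: "0 \<le> tvar g x"
  using lvar_le_tvar[of "[]" x] by simp

lemma tvar_le: "tvar g x \<le> B"
  by (rule tvar_leI) (rule bnd)

lemma tvar_step: "x \<le> y \<Longrightarrow> tvar g x + \<bar>g y - g x\<bar> \<le> tvar g y"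
proof -
  assume xy: "x \<le> y"
  have "tvar g x \<le> tvar g y - \<bar>g y - g x\<bar>"
  proof (rule tvar_leI)
    fix xs :: "real list" assume xs: "sorted xs" "set xs \<subseteq> {..x}"
    have "lvar g xs + \<bar>g y - g x\<bar> \<le> lvar g (xs @ [x, y])"
      using xs xy by (rule lvar_le_append2)
    also have "\<dots> \<le> tvar g y"
      using xs xy by (intro lvar_le_tvar) (auto simp: sorted_append)
    finally show "lvar g xs \<le> tvar g y - \<bar>g y - g x\<bar>" by simp
  qed
  then show ?thesis by simp
qed

lemma tvar_mono: "x \<le> y \<Longrightarrow> tvar g x \<le> tvar g y"
  using tvar_step[of x y] by linarith

lemma tvar_diff_mono: "x \<le> y \<Longrightarrow> tvar g x - g x \<le> tvar g y - g y"
  using tvar_step[of x y] by linarith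

text \<open>A list below \<open>b\<close> is cut at \<open>a\<close> by
  \<open>lvar_clamp_split\<close>. This is the half of the additivity of variation that controls
  increments of \<open>tvar\<close> from above.\<close>

lemma tvar_diff_le:
  assumes K: "\<And>xs. sorted xs \<Longrightarrow> set xs \<subseteq> {a..b} \<Longrightarrow> lvar g xs \<le> K" and ab: "a \<le> b"
  shows "tvar g b - tvar g a \<le> K"
proof -
  have "tvar g b \<le> K + tvar g a"
  proof (rule tvar_leI)
    fix xs :: "real list" assume xs: "sorted xs" "set xs \<subseteq> {..b}"
    have "lvar g xs \<le> lvar g (map (min a) xs) + lvar g (map (max a) xs)"
      by (rule lvar_clamp_split)
    also have "lvar g (map (min a) xs) \<le> tvar g a"
      using xs by (intro lvar_le_tvar sorted_map_min) auto
    also have "lvar g (map (max a) xs) \<le> K"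
      using xs ab by (intro K sorted_map_max) auto
    finally show "lvar g xs \<le> K + tvar g a" by simp
  qed
  then show ?thesis by simp
qed

lemma bounded_variation_diff_le: "\<bar>g y - g x\<bar> \<le> B"
proof -
  have "\<bar>g y - g x\<bar> \<le> B" if "x \<le> y" for x y
    using tvar_step[OF that] tvar_le[of y] tvar_nonneg[of x] by linarith
  from this[of x y] this[of y x] show ?thesis
    by (cases "x \<le> y") (auto simp: abs_minus_commute)
qed

lemma bounded_variation_borel: "g \<in> borel_measurable borel"
proof -
  have "(\<lambda>x. tvar g x - (tvar g x - g x)) \<in> borel_measurable borel"
    by (intro borel_measurable_diff borel_measurable_mono monoI tvar_mono tvar_diff_mono) auto
  then show ?thesis by simp
qed

end

text \<open>By the second mean value theorem the integral is \<open>f 0\<close> times the integral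
  over \<open>{0..c}\<close> plus \<open>f 1\<close> times the integral over \<open>{c..1}\<close>.
  The latter is a difference of two primitives and costs \<open>2 * K\<close>, hence the factor
  3.\<close>

lemma mono_mult_integral_bound:
  fixes f \<Phi> :: "real \<Rightarrow> real"
  assumes \<Phi>: "\<Phi> integrable_on {0..1}" and f: "\<And>x y. x \<le> y \<Longrightarrow> f x \<le> f y"
    and fb: "\<And>x. \<bar>f x\<bar> \<le> b" and K: "\<And>y. y \<in> {0..1} \<Longrightarrow> \<bar>integral {0..y} \<Phi>\<bar> \<le> K"
  shows "(\<lambda>x. f x * \<Phi> x) integrable_on {0..1}" "\<bar>integral {0..1} (\<lambda>x. f x * \<Phi> x)\<bar> \<le> 3 * b * K"
proof -
  obtain c where c: "c \<in> {0..1}"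
    and hi: "((\<lambda>x. f x * \<Phi> x) has_integral (f 0 * integral {0..c} \<Phi> + f 1 * integral {c..1} \<Phi>)) {0..1}"
    using second_mean_value_theorem_full[OF \<Phi>, of f] f by auto
  have K0: "0 \<le> K" using K[of 0] by simp
  have b0: "0 \<le> b" using fb[of 0] by linarith
  have "integral {0..c} \<Phi> + integral {c..1} \<Phi> = integral {0..1} \<Phi>"
    using c \<Phi> by (intro Henstock_Kurzweil_Integration.integral_combine) auto
  then have "\<bar>integral {c..1} \<Phi>\<bar> \<le> 2 * K"
    using K[of c] K[of 1] c by auto
  then have "\<bar>f 1 * integral {c..1} \<Phi>\<bar> \<le> b * (2 * K)"
    unfolding abs_mult by (intro mult_mono fb) (use b0 in auto)
  moreover have "\<bar>f 0 * integral {0..c} \<Phi>\<bar> \<le> b * K"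
    unfolding abs_mult by (intro mult_mono fb K) (use b0 c in auto)
  moreover have "integral {0..1} (\<lambda>x. f x * \<Phi> x) = f 0 * integral {0..c} \<Phi> + f 1 * integral {c..1} \<Phi>"
    using hi by (rule integral_unique)
  ultimately show "\<bar>integral {0..1} (\<lambda>x. f x * \<Phi> x)\<bar> \<le> 3 * b * K"
    by (simp add: algebra_simps)
  show "(\<lambda>x. f x * \<Phi> x) integrable_on {0..1}"
    using hi by blast
qed

text \<open>The Jordan parts \<open>tvar g\<close> and \<open>tvar g - g\<close> are bounded by
  \<open>B\<close> and \<open>2 * B\<close>, so 9 = 3 + 6. The zero \<open>z\<close> is what turns a
  bound on the variation into a bound on \<open>g\<close> itself.\<close>

lemma bounded_variation_integral_bound:
  fixes g \<Phi> :: "real \<Rightarrow> real"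
  assumes bnd: "\<And>xs. sorted xs \<Longrightarrow> lvar g xs \<le> B" and z: "g z = 0"
    and \<Phi>: "\<Phi> integrable_on {0..1}"
    and K: "\<And>y. y \<in> {0..1} \<Longrightarrow> \<bar>integral {0..y} \<Phi>\<bar> \<le> K"
  shows "(\<lambda>x. g x * \<Phi> x) integrable_on {0..1}" "\<bar>integral {0..1} (\<lambda>x. g x * \<Phi> x)\<bar> \<le> 9 * B * K"
proof -
  let ?T = "tvar g" and ?U = "\<lambda>x. tvar g x - g x"
  have g: "\<bar>g x\<bar> \<le> B" for x
    using bounded_variation_diff_le[of g B x z] bnd z by simp
  have T: "0 \<le> ?T x" "?T x \<le> B" for x
    using tvar_nonneg[of g B] tvar_le[of g B] bnd by auto
  have m: "x \<le> y \<Longrightarrow> ?T x \<le> ?T y" "x \<le> y \<Longrightarrow> ?U x \<le> ?U y" for x y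
    using tvar_mono[of g B] tvar_diff_mono[of g B] bnd by auto
  have "\<bar>?T x\<bar> \<le> B" for x
    using T[of x] by simp
  note 1 = mono_mult_integral_bound[where f = ?T, OF \<Phi> m(1) this K]
  have "\<bar>?U x\<bar> \<le> 2 * B" for x
    using T[of x] g[of x] by linarith
  note 2 = mono_mult_integral_bound[where f = ?U, OF \<Phi> m(2) this K]
  have eq: "(\<lambda>x. g x * \<Phi> x) = (\<lambda>x. ?T x * \<Phi> x - ?U x * \<Phi> x)"
    by (auto simp: algebra_simps)
  show "(\<lambda>x. g x * \<Phi> x) integrable_on {0..1}"
    unfolding eq by (intro integrable_diff 1 2) auto
  have "integral {0..1} (\<lambda>x. g x * \<Phi> x) = integral {0..1} (\<lambda>x. ?T x * \<Phi> x) - integral {0..1} (\<lambda>x. ?U x * \<Phi> x)"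
    unfolding eq by (intro Henstock_Kurzweil_Integration.integral_diff 1 2) auto
  then show "\<bar>integral {0..1} (\<lambda>x. g x * \<Phi> x)\<bar> \<le> 9 * B * K"
    using 1(2) 2(2) by linarith
qed


section \<open>Absolute continuity, bounded variation and the variation function\<close>

definition ac_modulus :: "(real \<Rightarrow> real) \<Rightarrow> real \<Rightarrow> real \<Rightarrow> bool" where
  "ac_modulus f \<epsilon> \<delta> \<longleftrightarrow> (\<forall>(n::nat) (a::nat \<Rightarrow> real) (b::nat \<Rightarrow> real).
     (\<forall>k<n. a k \<le> b k) \<and>
     (\<forall>k<n. \<forall>j<n. k \<noteq> j \<longrightarrow> {a k<..<b k} \<inter> {a j<..<b j} = {}) \<and>
     (\<Sum>k<n. b k - a k) < \<delta>
     \<longrightarrow> (\<Sum>k<n. \<bar>f (b k) - f (a k)\<bar>) < \<epsilon>)"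

lemma abs_continuous_real_iff: "abs_continuous_real f \<longleftrightarrow> (\<forall>\<epsilon>>0. \<exists>\<delta>>0. ac_modulus f \<epsilon> \<delta>)"
  by (simp only: abs_continuous_real_def ac_modulus_def)

lemma ac_modulusD:
  fixes a b :: "nat \<Rightarrow> real"
  assumes "ac_modulus f \<epsilon> \<delta>" "\<And>k. k < n \<Longrightarrow> a k \<le> b k"
    "\<And>k j. k < n \<Longrightarrow> j < n \<Longrightarrow> k \<noteq> j \<Longrightarrow> {a k<..<b k} \<inter> {a j<..<b j} = {}"
    "(\<Sum>k<n. b k - a k) < \<delta>"
  shows "(\<Sum>k<n. \<bar>f (b k) - f (a k)\<bar>) < \<epsilon>"
  using assms(1)[unfolded ac_modulus_def, THEN spec, THEN spec, THEN spec, of n a b] assms(2-) by blast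

lemma ac_modulusI:
  assumes "\<And>(n::nat) a b. (\<And>k. k < n \<Longrightarrow> a k \<le> b k) \<Longrightarrow>
    (\<And>k j. k < n \<Longrightarrow> j < n \<Longrightarrow> k \<noteq> j \<Longrightarrow> {a k<..<b k} \<inter> {a j<..<b j} = {}) \<Longrightarrow>
    (\<Sum>k<n. b k - a k) < \<delta> \<Longrightarrow> (\<Sum>k<n. \<bar>f (b k) - f (a k)\<bar>) < \<epsilon>"
  shows "ac_modulus f \<epsilon> \<delta>"
  unfolding ac_modulus_def by (intro allI impI, elim conjE) (rule assms, blast+)

text \<open>Later families of intervals are indexed by pairs (interval, position in a list) or by
  the intervals themselves, so the initial segment of the naturals is replaced by an arbitrary
  finite index set.\<close>

lemma abs_continuous_real_finite:
  fixes a b :: "'i \<Rightarrow> real"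
  assumes \<delta>: "ac_modulus f \<epsilon> \<delta>"
    and I: "finite I" "\<And>k. k \<in> I \<Longrightarrow> a k \<le> b k"
      "\<And>k j. k \<in> I \<Longrightarrow> j \<in> I \<Longrightarrow> k \<noteq> j \<Longrightarrow> {a k<..<b k} \<inter> {a j<..<b j} = {}"
      "(\<Sum>k\<in>I. b k - a k) < \<delta>"
  shows "(\<Sum>k\<in>I. \<bar>f (b k) - f (a k)\<bar>) < \<epsilon>"
proof -
  obtain \<pi> where \<pi>: "bij_betw \<pi> {..<card I} I"
    using ex_bij_betw_nat_finite[OF I(1)] by (auto simp: atLeast0LessThan)
  have in_I: "\<pi> k \<in> I" if "k < card I" for k
    using \<pi> that by (auto simp: bij_betw_def)
  have "(\<Sum>k<card I. b (\<pi> k) - a (\<pi> k)) = (\<Sum>k\<in>I. b k - a k)"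
    by (rule sum.reindex_bij_betw[OF \<pi>])
  moreover have "(\<Sum>k<card I. \<bar>f (b (\<pi> k)) - f (a (\<pi> k))\<bar>) = (\<Sum>k\<in>I. \<bar>f (b k) - f (a k)\<bar>)"
    by (rule sum.reindex_bij_betw[OF \<pi>])
  moreover have "{a (\<pi> k)<..<b (\<pi> k)} \<inter> {a (\<pi> j)<..<b (\<pi> j)} = {}"
    if "k < card I" "j < card I" "k \<noteq> j" for k j
    using that \<pi> by (intro I(3) in_I) (auto simp: bij_betw_def inj_on_def)
  ultimately show ?thesis
    using ac_modulusD[OF \<delta>, of "card I" "\<lambda>k. a (\<pi> k)" "\<lambda>k. b (\<pi> k)"] I(2,4) in_I by simp
qed

lemma sorted_nth_disjoint:
  assumes "sorted (xs :: real list)" "k < length xs - 1" "j < length xs - 1" "k \<noteq> j"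
  shows "{xs ! k<..<xs ! Suc k} \<inter> {xs ! j<..<xs ! Suc j} = {}"
proof -
  have "{xs ! k<..<xs ! Suc k} \<inter> {xs ! j<..<xs ! Suc j} = {}"
    if "k < j" "j < length xs - 1" for k j
  proof -
    have "xs ! Suc k \<le> xs ! j"
      using that assms(1) by (intro sorted_nth_mono) auto
    then show ?thesis by auto
  qed
  from this[of k j] this[of j k] show ?thesis
    using assms by (cases "k < j") auto
qed

lemma sorted_sum_gaps_le:
  assumes "sorted (xs :: real list)" "set xs \<subseteq> {a..b}" "a \<le> b"
  shows "(\<Sum>k < length xs - 1. xs ! Suc k - xs ! k) \<le> b - a"
proof (cases xs)
  case (Cons y ys)
  have "(\<Sum>k < length xs - 1. xs ! Suc k - xs ! k) = xs ! (length xs - 1) - xs ! 0"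
    by (rule sum_lessThan_telescope)
  moreover have "xs ! (length xs - 1) \<in> {a..b}" "xs ! 0 \<in> {a..b}"
    using assms(2) Cons nth_mem[of "length xs - 1" xs] nth_mem[of 0 xs] by auto
  ultimately show ?thesis by auto
qed (use assms in auto)

text \<open>Outside [0,1] the function is constant. Inside, \<open>Suc N\<close> pieces shorter than
  the \<open>\<delta>\<close> belonging to epsilon = 1 each have variation at most 1.\<close>

lemma abs_continuous_real_bounded_variation:
  assumes ac: "abs_continuous_real h" and h: "\<forall>x\<le>0. h x = 0" "\<forall>x\<ge>1. h x = h 1"
  obtains B where "\<And>xs. sorted xs \<Longrightarrow> lvar h xs \<le> B"
proof -
  obtain \<delta> where \<delta>: "\<delta> > 0" and *: "ac_modulus h 1 \<delta>"
    using ac unfolding abs_continuous_real_iff by (meson zero_less_one)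
  have short: "lvar h xs \<le> 1" if "sorted xs" "set xs \<subseteq> {a..b}" "a \<le> b" "b - a < \<delta>" for xs a b
  proof -
    have "lvar h xs < 1"
      unfolding lvar_def
    proof (rule ac_modulusD[OF *])
      show "xs ! k \<le> xs ! Suc k" if "k < length xs - 1" for k
        using \<open>sorted xs\<close> that by (intro sorted_nth_mono) auto
      show "{xs ! k<..<xs ! Suc k} \<inter> {xs ! j<..<xs ! Suc j} = {}"
        if "k < length xs - 1" "j < length xs - 1" "k \<noteq> j" for k j
        using \<open>sorted xs\<close> that by (intro sorted_nth_disjoint) auto
      show "(\<Sum>k < length xs - 1. xs ! Suc k - xs ! k) < \<delta>"
        using sorted_sum_gaps_le[of xs a b] that by linarith
    qed
    then show ?thesis by simp
  qed
  obtain N :: nat where N: "inverse (real (Suc N)) < \<delta>"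
    using \<delta> reals_Archimedean by blast
  define q where "q i = real i / real (Suc N)" for i
  have "q (Suc i) = q i + inverse (real (Suc N))" for i
    by (simp add: q_def divide_simps)
  then have q: "q (Suc i) - q i < \<delta>" "q i \<le> q (Suc i)" for i
    using N by auto
  have steps: "lvar h (map (min (q i)) xs) \<le> real i" if "sorted xs" for i xs
  proof (induction i)
    case 0
    have "lvar h (map (min 0) xs) = 0"
      unfolding lvar_def using h(1) by (intro sum.neutral) auto
    then show ?case by (simp add: q_def)
  next
    case (Suc i)
    let ?ys = "map (min (q (Suc i))) xs"
    have "lvar h ?ys \<le> lvar h (map (min (q i)) ?ys) + lvar h (map (max (q i)) ?ys)"
      by (rule lvar_clamp_split)
    also have "map (min (q i)) ?ys = map (min (q i)) xs"
      using q(2)[of i] by (auto simp: min_def)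
    also have "lvar h (map (max (q i)) ?ys) \<le> 1"
      using that q[of i] by (intro short[of _ "q i" "q (Suc i)"] sorted_map_max sorted_map_min) auto
    finally show ?case using Suc by simp
  qed
  show ?thesis
  proof (rule that)
    fix xs :: "real list" assume xs: "sorted xs"
    have "lvar h xs \<le> lvar h (map (min 1) xs) + lvar h (map (max 1) xs)"
      by (rule lvar_clamp_split)
    also have "lvar h (map (max 1) xs) = 0"
    proof -
      have "h (max 1 x) = h 1" for x
        using h(2) max.cobounded1 by blast
      then show ?thesis
        unfolding lvar_def by (intro sum.neutral) auto
    qed
    also have "lvar h (map (min 1) xs) \<le> real (Suc N)"
      using steps[OF xs, of "Suc N"] by (simp add: q_def)
    finally show "lvar h xs \<le> real (Suc N)" by simp
  qed
qed

text \<open>Choose in each interval a list whose variation is optimal up to \<open>\<eta>\<close>.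
  The gaps of all these lists form one disjoint family of total length below
  \<open>\<delta>\<close>, so their increments sum to less than \<open>\<epsilon> / 2\<close>; the
  deficits \<open>\<eta>\<close>, one per interval, sum to at most
  \<open>\<epsilon> / 2\<close>.\<close>

lemma abs_continuous_real_tvar:
  assumes ac: "abs_continuous_real h" and bnd: "\<And>xs. sorted xs \<Longrightarrow> lvar h xs \<le> B"
  shows "abs_continuous_real (tvar h)"
  unfolding abs_continuous_real_iff
proof (intro allI impI)
  fix \<epsilon> :: real assume \<epsilon>: "\<epsilon> > 0"
  obtain \<delta> where \<delta>: "\<delta> > 0" and *: "ac_modulus h (\<epsilon> / 2) \<delta>"
    using ac \<epsilon> unfolding abs_continuous_real_iff by (meson half_gt_zero)
  have "ac_modulus (tvar h) \<epsilon> \<delta>"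
  proof (rule ac_modulusI)
    fix n and a b :: "nat \<Rightarrow> real"
    assume ab: "\<And>k. k < n \<Longrightarrow> a k \<le> b k"
      and dj: "\<And>k j. k < n \<Longrightarrow> j < n \<Longrightarrow> k \<noteq> j \<Longrightarrow> {a k<..<b k} \<inter> {a j<..<b j} = {}"
      and len: "(\<Sum>k<n. b k - a k) < \<delta>"
    define \<eta> where "\<eta> = \<epsilon> / 2 / (real n + 1)"
    have \<eta>: "\<eta> > 0" using \<epsilon> by (simp add: \<eta>_def)
    have "\<exists>xs. sorted xs \<and> set xs \<subseteq> {a k..b k} \<and> tvar h (b k) - tvar h (a k) - \<eta> < lvar h xs" if "k < n" for k
    proof (rule ccontr)
      assume "\<not> ?thesis"
      then have "tvar h (b k) - tvar h (a k) \<le> tvar h (b k) - tvar h (a k) - \<eta>"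
        using ab[OF that] by (intro tvar_diff_le[of h B] bnd) (auto simp: not_less)
      then show False using \<eta> by simp
    qed
    then obtain X where X: "\<And>k. k < n \<Longrightarrow> sorted (X k)" "\<And>k. k < n \<Longrightarrow> set (X k) \<subseteq> {a k..b k}"
      "\<And>k. k < n \<Longrightarrow> tvar h (b k) - tvar h (a k) - \<eta> < lvar h (X k)"
      by metis
    define I where "I = (SIGMA k:{..<n}. {..<length (X k) - 1})"
    define \<alpha> where "\<alpha> = (\<lambda>(k, j). X k ! j)"
    define \<beta> where "\<beta> = (\<lambda>(k, j). X k ! Suc j)"
    have "(\<Sum>p\<in>I. \<bar>h (\<beta> p) - h (\<alpha> p)\<bar>) < \<epsilon> / 2"
    proof (rule abs_continuous_real_finite[OF *])
      show "finite I" by (simp add: I_def)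
      show "\<alpha> p \<le> \<beta> p" if "p \<in> I" for p
        using that X(1) by (auto simp: I_def \<alpha>_def \<beta>_def intro!: sorted_nth_mono)
      have "(\<Sum>p\<in>I. \<beta> p - \<alpha> p) = (\<Sum>k<n. \<Sum>j<length (X k) - 1. X k ! Suc j - X k ! j)"
        unfolding I_def by (subst sum.Sigma) (auto simp: \<alpha>_def \<beta>_def intro!: sum.cong)
      also have "\<dots> \<le> (\<Sum>k<n. b k - a k)"
        using X ab by (intro sum_mono sorted_sum_gaps_le) auto
      finally show "(\<Sum>p\<in>I. \<beta> p - \<alpha> p) < \<delta>" using len by simp
      show "{\<alpha> p<..<\<beta> p} \<inter> {\<alpha> q<..<\<beta> q} = {}" if pq: "p \<in> I" "q \<in> I" "p \<noteq> q" for p q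
      proof -
        obtain k j k' j' where p: "p = (k, j)" and q: "q = (k', j')" by (cases p; cases q)
        have I: "k < n" "k' < n" "j < length (X k) - 1" "j' < length (X k') - 1"
          using pq by (auto simp: I_def p q)
        show ?thesis
        proof (cases "k = k'")
          case True
          then show ?thesis
            using pq I X(1)[of k] sorted_nth_disjoint[of "X k" j j'] by (auto simp: \<alpha>_def \<beta>_def p q)
        next
          case False
          have "X k ! j \<in> set (X k)" "X k ! Suc j \<in> set (X k)"
            "X k' ! j' \<in> set (X k')" "X k' ! Suc j' \<in> set (X k')"
            using I by auto
          then have "X k ! j \<ge> a k" "X k ! Suc j \<le> b k" "X k' ! j' \<ge> a k'" "X k' ! Suc j' \<le> b k'"
            using X(2)[OF I(1)] X(2)[OF I(2)] by (auto simp: subset_iff)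
          then have "{\<alpha> p<..<\<beta> p} \<subseteq> {a k<..<b k}" "{\<alpha> q<..<\<beta> q} \<subseteq> {a k'<..<b k'}"
            by (auto simp: \<alpha>_def \<beta>_def p q)
          then show ?thesis using dj[OF I(1,2) False] by blast
        qed
      qed
    qed
    also have "(\<Sum>p\<in>I. \<bar>h (\<beta> p) - h (\<alpha> p)\<bar>) = (\<Sum>k<n. lvar h (X k))"
      unfolding I_def lvar_def by (subst sum.Sigma) (auto simp: \<alpha>_def \<beta>_def intro!: sum.cong)
    finally have 1: "(\<Sum>k<n. lvar h (X k)) < \<epsilon> / 2" .
    have "(\<Sum>k<n. \<bar>tvar h (b k) - tvar h (a k)\<bar>) \<le> (\<Sum>k<n. lvar h (X k) + \<eta>)"
    proof (rule sum_mono)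
      fix k assume "k \<in> {..<n}"
      then show "\<bar>tvar h (b k) - tvar h (a k)\<bar> \<le> lvar h (X k) + \<eta>"
        using X(3)[of k] tvar_mono[of h B "a k" "b k", OF bnd] ab[of k] by auto
    qed
    also have "\<dots> = (\<Sum>k<n. lvar h (X k)) + n * \<eta>"
      by (simp add: sum.distrib)
    also have "n * \<eta> \<le> \<epsilon> / 2"
      using \<epsilon> by (simp add: \<eta>_def field_simps)
    finally show "(\<Sum>k<n. \<bar>tvar h (b k) - tvar h (a k)\<bar>) < \<epsilon>" using 1 by simp
  qed
  then show "\<exists>\<delta>>0. ac_modulus (tvar h) \<epsilon> \<delta>"
    using \<delta> by blast
qed

lemma abs_continuous_real_diff:
  assumes "abs_continuous_real f" "abs_continuous_real g"
  shows "abs_continuous_real (\<lambda>x. f x - g x)"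
  unfolding abs_continuous_real_iff
proof (intro allI impI)
  fix \<epsilon> :: real assume \<epsilon>: "\<epsilon> > 0"
  obtain \<delta>1 where d1: "\<delta>1 > 0" "ac_modulus f (\<epsilon> / 2) \<delta>1"
    using assms(1) \<epsilon> unfolding abs_continuous_real_iff by (meson half_gt_zero)
  obtain \<delta>2 where d2: "\<delta>2 > 0" "ac_modulus g (\<epsilon> / 2) \<delta>2"
    using assms(2) \<epsilon> unfolding abs_continuous_real_iff by (meson half_gt_zero)
  have "ac_modulus (\<lambda>x. f x - g x) \<epsilon> (min \<delta>1 \<delta>2)"
  proof (rule ac_modulusI)
    fix n and a b :: "nat \<Rightarrow> real"
    assume ab: "\<And>k. k < n \<Longrightarrow> a k \<le> b k"
      "\<And>k j. k < n \<Longrightarrow> j < n \<Longrightarrow> k \<noteq> j \<Longrightarrow> {a k<..<b k} \<inter> {a j<..<b j} = {}"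
      "(\<Sum>k<n. b k - a k) < min \<delta>1 \<delta>2"
    have "(\<Sum>k<n. \<bar>f (b k) - f (a k)\<bar>) < \<epsilon> / 2"
      by (rule ac_modulusD[OF d1(2)]) (use ab in auto)
    moreover have "(\<Sum>k<n. \<bar>g (b k) - g (a k)\<bar>) < \<epsilon> / 2"
      by (rule ac_modulusD[OF d2(2)]) (use ab in auto)
    moreover have "(\<Sum>k<n. \<bar>(f (b k) - g (b k)) - (f (a k) - g (a k))\<bar>)
        \<le> (\<Sum>k<n. \<bar>f (b k) - f (a k)\<bar> + \<bar>g (b k) - g (a k)\<bar>)"
      by (rule sum_mono) linarith
    ultimately show "(\<Sum>k<n. \<bar>(f (b k) - g (b k)) - (f (a k) - g (a k))\<bar>) < \<epsilon>"
      by (simp add: sum.distrib)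
  qed
  then show "\<exists>\<delta>>0. ac_modulus (\<lambda>x. f x - g x) \<epsilon> \<delta>"
    using d1 d2 by (intro exI[of _ "min \<delta>1 \<delta>2"]) auto
qed

section \<open>Absolutely continuous functions\<close>

lemma abs_continuous_real_continuous:
  assumes "abs_continuous_real f"
  shows "continuous_on UNIV f"
  unfolding continuous_on_iff
proof (intro ballI allI impI)
  fix x \<epsilon> :: real assume "\<epsilon> > 0"
  then obtain \<delta> where \<delta>: "\<delta> > 0" "ac_modulus f \<epsilon> \<delta>"
    using assms unfolding abs_continuous_real_iff by blast
  have "dist (f y) (f x) < \<epsilon>" if "dist y x < \<delta>" for y
  proof -
    have "(\<Sum>k<(1::nat). \<bar>f (max x y) - f (min x y)\<bar>) < \<epsilon>"
      by (rule ac_modulusD[OF \<delta>(2)]) (use that in \<open>auto simp: dist_real_def\<close>)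
    then show ?thesis
      by (auto simp: dist_real_def max_def min_def split: if_splits)
  qed
  then show "\<exists>d>0. \<forall>x'\<in>UNIV. dist x' x < d \<longrightarrow> dist (f x') (f x) < \<epsilon>"
    using \<delta> by blast
qed

text \<open>Elements of the ring generated by a semiring are finite disjoint unions of its members;
  this is how overlapping half-open intervals are made disjoint below.\<close>

lemma semiring_of_sets_Ioc: "semiring_of_sets UNIV (range (\<lambda>(a, b). {a<..b::real}))"
proof
  show "{} \<in> range (\<lambda>(a, b). {a<..b::real})"
    by (auto intro!: image_eqI[of _ _ "(0, 0)"])
  fix A B :: "real set"
  assume "A \<in> range (\<lambda>(a, b). {a<..b})" "B \<in> range (\<lambda>(a, b). {a<..b})"
  then obtain a b c d where A: "A = {a<..b}" and B: "B = {c<..d}"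
    by auto
  show "A \<inter> B \<in> range (\<lambda>(a, b). {a<..b})"
    by (auto simp: A B intro!: image_eqI[of _ _ "(max a c, min b d)"])
  show "\<exists>C\<subseteq>range (\<lambda>(a, b). {a<..b}). finite C \<and> disjoint C \<and> A - B = \<Union> C"
  proof (cases "d \<le> c")
    case True
    then show ?thesis
      by (intro exI[of _ "{A}"]) (auto simp: A B)
  next
    case False
    then have "disjoint {{a<..min b c}, {max a d<..b}}"
      by (auto simp: disjoint_def)
    moreover have "A - B = {a<..min b c} \<union> {max a d<..b}"
      using False by (auto simp: A B)
    ultimately show ?thesis
      by (intro exI[of _ "{{a<..min b c}, {max a d<..b}}"]) auto
  qed
qed auto

section \<open>The Stieltjes measure of a monotone absolutely continuous function\<close>

context
  fixes F :: "real \<Rightarrow> real" and B :: real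
  assumes mono: "\<And>x y. x \<le> y \<Longrightarrow> F x \<le> F y" and ac: "abs_continuous_real F"
begin

lemma interval_measure_Ioc: "a \<le> b \<Longrightarrow> emeasure (interval_measure F) {a<..b} = ennreal (F b - F a)"
  using abs_continuous_real_continuous[OF ac]
  by (intro emeasure_interval_measure_Ioc mono)
     (auto intro: continuous_within_subset simp: continuous_on_eq_continuous_within)

text \<open>After rewriting the union as a disjoint union of half-open intervals, its Lebesgue
  measure is a sum of lengths and its Stieltjes measure a sum of increments: exactly the two
  quantities that \<open>ac_modulus\<close> compares.\<close>

lemma interval_measure_finite_Union_Ioc:
  assumes D: "finite \<D>" "\<D> \<subseteq> range (\<lambda>(a, b). {a<..b})"
    and small: "emeasure lborel (\<Union>\<D>) < ennreal \<delta>" "\<delta> > 0" and m: "ac_modulus F \<epsilon> \<delta>"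
  shows "emeasure (interval_measure F) (\<Union>\<D>) \<le> ennreal \<epsilon>"
proof -
  interpret S: semiring_of_sets UNIV "range (\<lambda>(a, b). {a<..b::real})"
    by (rule semiring_of_sets_Ioc)
  interpret R: ring_of_sets UNIV S.generated_ring
    by (rule S.generating_ring)
  have "\<Union>\<D> \<in> S.generated_ring"
    using D by (intro R.finite_Union) (auto intro: S.generated_ringI_Basic)
  then obtain C where C: "finite C" "disjoint C" "C \<subseteq> range (\<lambda>(a, b). {a<..b})" "\<Union>\<D> = \<Union>C"
    by (rule S.generated_ringE)
  have "\<exists>l r. l \<le> r \<and> c = {l<..r}" if c: "c \<in> C" for c
  proof -
    obtain a b where "c = {a<..b}" using C(3) c by auto
    then show ?thesis
      by (cases "a \<le> b") (auto simp: intro: exI[of _ a])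
  qed
  then obtain l r where lr: "\<And>c. c \<in> C \<Longrightarrow> l c \<le> r c" "\<And>c. c \<in> C \<Longrightarrow> c = {l c<..r c}"
    by metis
  have C_sets: "C \<subseteq> sets borel"
    using lr(2) by (metis greaterThanAtMost_borel subsetI)
  have df: "disjoint_family_on (\<lambda>c. c) C"
    using C(2) by (auto simp: disjoint_family_on_def disjoint_def)
  have "ennreal (\<Sum>c\<in>C. r c - l c) = (\<Sum>c\<in>C. emeasure lborel c)"
  proof -
    have "emeasure lborel c = ennreal (r c - l c)" if "c \<in> C" for c
      using lr(1)[OF that] by (subst lr(2)[OF that]) simp
    then show ?thesis
      using lr(1) by (subst sum_ennreal[symmetric]) (auto intro!: sum.cong)
  qed
  also have "\<dots> = emeasure lborel (\<Union>C)"
    using sum_emeasure[of "\<lambda>c. c" C lborel] C_sets df C(1) by auto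
  finally have "ennreal (\<Sum>c\<in>C. r c - l c) < ennreal \<delta>"
    using small C(4) by simp
  then have len: "(\<Sum>c\<in>C. r c - l c) < \<delta>"
    using small(2) by (simp add: ennreal_less_iff sum_nonneg lr)
  have "(\<Sum>c\<in>C. \<bar>F (r c) - F (l c)\<bar>) < \<epsilon>"
  proof (rule abs_continuous_real_finite[OF m C(1) lr(1) _ len])
    fix c d assume cd: "c \<in> C" "d \<in> C" "c \<noteq> d"
    have "{l c<..<r c} \<subseteq> c" "{l d<..<r d} \<subseteq> d"
      using lr(2) cd by force+
    then show "{l c<..<r c} \<inter> {l d<..<r d} = {}"
      using disjointD[OF C(2) cd] by (meson disjoint_iff subset_iff)
  qed
  moreover have "emeasure (interval_measure F) (\<Union>C) = ennreal (\<Sum>c\<in>C. \<bar>F (r c) - F (l c)\<bar>)"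
  proof -
    have "emeasure (interval_measure F) c = ennreal \<bar>F (r c) - F (l c)\<bar>" if "c \<in> C" for c
      using lr(1)[OF that] mono[OF lr(1)[OF that]]
      by (subst lr(2)[OF that]) (simp add: interval_measure_Ioc)
    moreover have "emeasure (interval_measure F) (\<Union>C) = (\<Sum>c\<in>C. emeasure (interval_measure F) c)"
      using sum_emeasure[of "\<lambda>c. c" C "interval_measure F"] C_sets df C(1) by auto
    ultimately show ?thesis
      by (subst sum_ennreal[symmetric]) (auto intro!: sum.cong)
  qed
  ultimately show ?thesis
    using C(4) by (auto intro: ennreal_leI)
qed

text \<open>A null set lies in an open set of measure below \<open>\<delta>\<close>, which is
  exhausted by finite unions of open intervals. The bound \<open>\<epsilon>\<close> holds for each
  finite union and passes to the supremum.\<close>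

lemma absolutely_continuous_interval_measure: "absolutely_continuous lborel (interval_measure F)"
  unfolding absolutely_continuous_def
proof
  fix N :: "real set" assume N: "N \<in> null_sets lborel"
  then have Nb: "N \<in> sets borel" by auto
  have "emeasure (interval_measure F) N \<le> ennreal \<epsilon>" if "\<epsilon> > 0" for \<epsilon>
  proof -
    obtain \<delta> where \<delta>: "\<delta> > 0" "ac_modulus F \<epsilon> \<delta>"
      using ac \<open>\<epsilon> > 0\<close> unfolding abs_continuous_real_iff by blast
    obtain U where U: "open U" "N \<subseteq> U" "emeasure lborel (U - N) < ennreal \<delta>"
      using outer_regular_lborel[OF Nb \<delta>(1)] by blast
    have Us: "U \<in> sets borel" using U(1) by simp
    have "emeasure lborel U = emeasure lborel (U - N)"
      using N Us by (simp add: emeasure_Diff_null_set)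
    with U have Um: "emeasure lborel U < ennreal \<delta>" by simp
    obtain \<D> where D: "countable \<D>" "\<And>X. X \<in> \<D> \<Longrightarrow> \<exists>a b. X = box a b" "\<Union>\<D> = U"
      using open_countable_Union_open_box[OF U(1)] by metis
    \<comment> \<open>The empty set is inserted so that \<open>from_nat_into\<close> always returns
      a member, even if \<open>\<D>\<close> is empty.\<close>
    define W where "W n = (\<Union>i<n. from_nat_into (insert {} \<D>) i)" for n :: nat
    have W_el: "from_nat_into (insert {} \<D>) i \<in> insert {} \<D>" for i
      by (rule from_nat_into) simp
    have box: "\<exists>a b :: real. from_nat_into (insert {} \<D>) i = {a<..<b}" for i
    proof (cases "from_nat_into (insert {} \<D>) i = {}")
      case True
      then show ?thesis by (intro exI[of _ 0]) simp
    next
      case False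
      then have "from_nat_into (insert {} \<D>) i \<in> \<D>" using W_el[of i] by blast
      from D(2)[OF this] show ?thesis by (simp only: box_real)
    qed
    then obtain a b where ab: "\<And>i. from_nat_into (insert {} \<D>) i = {a i<..<b i}"
      by metis
    have WU: "(\<Union>n. W n) = U"
    proof -
      have "(\<Union>n. W n) = (\<Union>i. from_nat_into (insert {} \<D>) i)"
        unfolding W_def by blast
      also have "\<dots> = \<Union>(insert {} \<D>)"
        using D(1) by (metis UN_extend_simps(10) countable_insert insert_not_empty range_from_nat_into)
      finally show ?thesis using D(3) by simp
    qed
    have "emeasure (interval_measure F) (W n) \<le> ennreal \<epsilon>" for n
    proof -
      let ?E = "(\<lambda>i. {a i<..b i}) ` {..<n}"
      \<comment> \<open>Closing the intervals on the right adds only finitely many points, a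
        Lebesgue null set, and makes the lemma on half-open intervals applicable.\<close>
      have sub: "\<Union>?E \<subseteq> W n \<union> b ` {..<n}"
      proof
        fix x assume "x \<in> \<Union>?E"
        then obtain i where "i < n" "a i < x" "x \<le> b i" by (auto simp only: UN_iff lessThan_iff greaterThanAtMost_iff)
        then show "x \<in> W n \<union> b ` {..<n}"
          unfolding W_def ab by (cases "x = b i") (auto intro: UN_I[of i])
      qed
      have fin: "b ` {..<n} \<in> null_sets lborel"
        by (intro finite_imp_null_set_lborel) simp
      have Wm: "W n \<in> sets borel"
        unfolding W_def ab by auto
      have "emeasure lborel (\<Union>?E) \<le> emeasure lborel (W n \<union> b ` {..<n})"
        using sub Wm fin by (intro emeasure_mono) auto
      also have "\<dots> = emeasure lborel (W n)"
        using Wm fin by (intro emeasure_Un_null_set) auto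
      also have "\<dots> \<le> emeasure lborel U"
        using WU Us by (intro emeasure_mono) auto
      also note Um
      finally have "emeasure (interval_measure F) (\<Union>?E) \<le> ennreal \<epsilon>"
        by (intro interval_measure_finite_Union_Ioc[OF _ _ _ \<delta>]) auto
      moreover have "emeasure (interval_measure F) (W n) \<le> emeasure (interval_measure F) (\<Union>?E)"
      proof (rule emeasure_mono)
        show "W n \<subseteq> \<Union>?E"
          unfolding W_def ab by (rule UN_mono[OF order_refl])
            (simp add: greaterThanLessThan_subseteq_greaterThanAtMost_iff)
        show "\<Union>?E \<in> sets (interval_measure F)"
          by (subst sets_interval_measure) auto
      qed
      ultimately show ?thesis by (rule order_trans[rotated])
    qed
    moreover have "emeasure (interval_measure F) U = (SUP n. emeasure (interval_measure F) (W n))"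
    proof -
      have sub: "W m \<subseteq> W n" if "m \<le> n" for m n
      proof -
        have "{..<m} \<subseteq> {..<n}" using that by simp
        then show ?thesis unfolding W_def by (rule UN_mono[OF _ order_refl])
      qed
      have inc: "incseq W" unfolding incseq_def using sub by blast
      have "W n \<in> sets borel" for n
        unfolding W_def ab by (intro sets.finite_UN) simp_all
      then have rng: "range W \<subseteq> sets (interval_measure F)"
        unfolding sets_interval_measure by (rule image_subsetI)
      show ?thesis
        using SUP_emeasure_incseq[OF rng inc] unfolding WU by (rule sym)
    qed
    ultimately have "emeasure (interval_measure F) U \<le> ennreal \<epsilon>"
      by (metis SUP_least)
    moreover have "emeasure (interval_measure F) N \<le> emeasure (interval_measure F) U"
      using U(2) Us by (intro emeasure_mono) auto
    ultimately show ?thesis by (rule order_trans[rotated])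
  qed
  then have "emeasure (interval_measure F) N \<le> 0 + ennreal \<epsilon>" if "\<epsilon> > 0" for \<epsilon>
    using that by simp
  then have "emeasure (interval_measure F) N \<le> 0"
    by (rule ennreal_le_epsilon)
  then show "N \<in> null_sets (interval_measure F)"
    using Nb by auto
qed

text \<open>The Radon-Nikodym density of the Stieltjes measure with respect to Lebesgue measure.
  Since \<open>F\<close> is bounded the total mass is at most \<open>2 * B\<close>, so the density
  is finite almost everywhere and integrable.\<close>

lemma mono_abs_continuous_density:
  assumes B: "\<And>x. \<bar>F x\<bar> \<le> B"
  obtains f where "integrable lborel f" "\<And>a b. a \<le> b \<Longrightarrow> (f has_integral F b - F a) {a..b}"
proof -
  have "sets (interval_measure F) = sets lborel" by simp
  from sigma_finite_measure.Radon_Nikodym[OF sigma_finite_lborel absolutely_continuous_interval_measure this]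
  obtain f where f[measurable]: "f \<in> borel_measurable lborel" and dens: "density lborel f = interval_measure F"
    by (rule bexE)
  have nn: "(\<integral>\<^sup>+x\<in>A. f x \<partial>lborel) = emeasure (interval_measure F) A" if "A \<in> sets borel" for A
  proof -
    have "emeasure (density lborel f) A = (\<integral>\<^sup>+x\<in>A. f x \<partial>lborel)"
      using that by (intro emeasure_density f) simp
    then show ?thesis by (simp only: dens)
  qed
  have "emeasure (interval_measure F) UNIV \<le> ennreal (2 * B)"
  proof -
    have un: "(\<Union>n::nat. {- real n<..real n}) = UNIV"
    proof -
      have "x \<in> (\<Union>n::nat. {- real n<..real n})" for x :: real
      proof -
        obtain n :: nat where "\<bar>x\<bar> < real n" using reals_Archimedean2 by blast
        then show ?thesis by (intro UN_I[of n]) auto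
      qed
      then show ?thesis by blast
    qed
    have "emeasure (interval_measure F) UNIV = (SUP n::nat. emeasure (interval_measure F) {- real n<..real n})"
      unfolding un[symmetric] by (rule SUP_emeasure_incseq[symmetric]) (auto simp: incseq_def)
    also have "\<dots> \<le> ennreal (2 * B)"
    proof (rule SUP_least)
      fix n :: nat
      show "emeasure (interval_measure F) {- real n<..real n} \<le> ennreal (2 * B)"
        using B[of n] B[of "- n"] by (subst interval_measure_Ioc) (auto intro!: ennreal_leI)
    qed
    finally show ?thesis .
  qed
  then have "(\<integral>\<^sup>+x. f x \<partial>lborel) \<le> ennreal (2 * B)"
    using nn[of UNIV] by simp
  then have fin: "(\<integral>\<^sup>+x. f x \<partial>lborel) < \<infinity>"
    by (rule order.strict_trans1) simp
  then have AE: "AE x in lborel. f x \<noteq> \<infinity>"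
    by (intro nn_integral_PInf_AE) auto
  define g where "g x = enn2real (f x)" for x
  have g_f: "AE x in lborel. ennreal (g x) = f x"
    using AE by eventually_elim (simp add: g_def less_top)
  have g_int: "integrable lborel g"
  proof (rule integrableI_nonneg)
    show "g \<in> borel_measurable lborel" unfolding g_def by measurable
    show "AE x in lborel. 0 \<le> g x" by (simp add: g_def)
    have "(\<integral>\<^sup>+x. ennreal (g x) \<partial>lborel) = (\<integral>\<^sup>+x. f x \<partial>lborel)"
      using g_f by (intro nn_integral_cong_AE)
    then show "(\<integral>\<^sup>+x. ennreal (g x) \<partial>lborel) < \<infinity>" using fin by simp
  qed
  show thesis
  proof (rule that[of g, OF g_int])
    fix a b :: real assume ab: "a \<le> b"
    have gs: "set_integrable lborel {a..b} g"
      unfolding set_integrable_def using g_int by (intro integrable_mult_indicator) auto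
    have "ennreal (LINT x:{a..b}|lborel. g x) = (\<integral>\<^sup>+x. ennreal (indicator {a..b} x * g x) \<partial>lborel)"
      unfolding set_lebesgue_integral_def using gs
      by (subst nn_integral_eq_integral) (auto simp: set_integrable_def g_def)
    also have "\<dots> = (\<integral>\<^sup>+x\<in>{a<..b}. f x \<partial>lborel)"
    proof (rule nn_integral_cong_AE)
      have "AE x in lborel. x \<noteq> a" by (rule AE_lborel_singleton)
      with g_f show "AE x in lborel. ennreal (indicator {a..b} x * g x) = f x * indicator {a<..b} x"
        by eventually_elim (auto split: split_indicator)
    qed
    also have "\<dots> = ennreal (F b - F a)"
      by (simp add: nn interval_measure_Ioc ab)
    finally have "ennreal (LINT x:{a..b}|lborel. g x) = ennreal (F b - F a)" .
    moreover have "0 \<le> (LINT x:{a..b}|lborel. g x)"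
      unfolding set_lebesgue_integral_def by (intro Bochner_Integration.integral_nonneg) (simp add: g_def)
    moreover have "0 \<le> F b - F a"
      using mono[OF ab] by simp
    ultimately have eq: "(LINT x:{a..b}|lborel. g x) = F b - F a"
      by (simp only: ennreal_inj)
    have "(g has_integral integral {a..b} g) {a..b}"
      by (rule integrable_integral) (rule set_borel_integral_eq_integral(1)[OF gs])
    then show "(g has_integral F b - F a) {a..b}"
      by (simp only: eq set_borel_integral_eq_integral(2)[OF gs, symmetric])
  qed
qed

end


section \<open>Lebesgue differentiation of an indefinite integral\<close>

lemma integral_right_derivative:
  fixes f h :: "real \<Rightarrow> real"
  assumes fh: "\<And>a b. a \<le> b \<Longrightarrow> (f has_integral h b - h a) {a..b}"
  obtains N where "negligible N" "\<And>x. x \<notin> N \<Longrightarrow> ((\<lambda>t. (h (x + t) - h x) / t) \<longlongrightarrow> f x) (at_right 0)"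
proof -
  have "f integrable_on cbox a b" for a b
    using fh[of a b] by (cases "a \<le> b") auto
  then obtain N where N: "negligible N" "\<And>x e. x \<notin> N \<Longrightarrow> 0 < e \<Longrightarrow>
      \<exists>d>0. \<forall>t. 0 < t \<and> t < d \<longrightarrow> norm (integral (cbox x (x + t *\<^sub>R One)) f /\<^sub>R t ^ DIM(real) - f x) < e"
    using integrable_ccontinuous_explicit by blast
  show thesis
  proof (rule that[OF N(1)])
    fix x assume x: "x \<notin> N"
    show "((\<lambda>t. (h (x + t) - h x) / t) \<longlongrightarrow> f x) (at_right 0)"
    proof (rule tendstoI)
      fix e :: real assume "e > 0"
      then have "\<exists>d>0. \<forall>t. 0 < t \<and> t < d \<longrightarrow>
          norm (integral (cbox x (x + t *\<^sub>R One)) f /\<^sub>R t ^ DIM(real) - f x) < e"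
        by (rule N(2)[OF x])
      then obtain d where d: "d > 0" "\<forall>t. 0 < t \<and> t < d \<longrightarrow>
          norm (integral (cbox x (x + t *\<^sub>R One)) f /\<^sub>R t ^ DIM(real) - f x) < e"
        by (elim exE conjE)
      have "dist ((h (x + t) - h x) / t) (f x) < e" if "0 < t" "t < d" for t
      proof -
        have "integral {x..x + t} f = h (x + t) - h x"
          using fh[of x "x + t"] that by (intro integral_unique) auto
        then show ?thesis
          using d(2)[rule_format, of t] that by (simp add: dist_real_def divide_inverse mult.commute)
      qed
      then show "\<forall>\<^sub>F t in at_right 0. dist ((h (x + t) - h x) / t) (f x) < e"
        using d(1) unfolding eventually_at_right_field by (intro exI[of _ d]) auto
    qed
  qed
qed

text \<open>\<open>integral_right_derivative\<close> averages over intervals to the right of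
  \<open>x\<close> only. Applied to the reflected function it yields the left derivative, outside
  the reflected exceptional set.\<close>

lemma integral_has_derivative_AE:
  fixes f h :: "real \<Rightarrow> real"
  assumes fh: "\<And>a b. a \<le> b \<Longrightarrow> (f has_integral h b - h a) {a..b}"
  shows "AE x in lborel. (h has_real_derivative f x) (at x)"
proof -
  obtain N where N: "negligible N" "\<And>x. x \<notin> N \<Longrightarrow> ((\<lambda>t. (h (x + t) - h x) / t) \<longlongrightarrow> f x) (at_right 0)"
    using integral_right_derivative[OF fh] by blast
  have refl: "((\<lambda>x. f (- x)) has_integral (- h (- b)) - (- h (- a))) {a..b}" if "a \<le> b" for a b
    using has_integral_reflect_real[of f "h (- a) - h (- b)" "-a" "-b"] fh[of "-b" "-a"] that by simp
  obtain N' where N': "negligible N'"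
    "\<And>x. x \<notin> N' \<Longrightarrow> ((\<lambda>t. (- h (- (x + t)) - (- h (- x))) / t) \<longlongrightarrow> f (- x)) (at_right 0)"
    using integral_right_derivative[where f = "\<lambda>x. f (- x)" and h = "\<lambda>x. - h (- x)", OF refl] by blast
  have neg: "negligible (uminus ` N')"
  proof (rule negligible_differentiable_image_negligible[OF order_refl N'(1)])
    have "(\<lambda>x::real. - x) differentiable (at x within N')" for x
      by (rule differentiable_minus[OF differentiable_ident])
    then show "uminus differentiable_on N'" by (simp only: differentiable_on_def) blast
  qed
  have der: "(h has_real_derivative f x) (at x)" if x: "x \<notin> N" "x \<notin> uminus ` N'" for x
  proof -
    have "- x \<notin> N'" using x(2) by force
    from N'(2)[OF this] have "((\<lambda>t. (- h (x - t) + h x) / t) \<longlongrightarrow> f x) (at_right 0)"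
      by (simp add: algebra_simps)
    then have "((\<lambda>t. (h (x + t) - h x) / t) \<longlongrightarrow> f x) (at_left 0)"
      by (subst filterlim_at_left_to_right) (simp add: divide_simps add.commute minus_divide_left)
    with N(2)[OF x(1)] have "((\<lambda>t. (h (x + t) - h x) / t) \<longlongrightarrow> f x) (at 0)"
      by (simp add: filterlim_split_at)
    then show ?thesis by (simp add: DERIV_def)
  qed
  have "AE x in lebesgue. x \<notin> N \<union> uminus ` N'"
    using negligible_Un[OF N(1) neg] by (intro AE_not_in) (simp add: negligible_iff_null_sets)
  then have "AE x in lborel. x \<notin> N \<union> uminus ` N'"
    by (simp only: AE_completion_iff)
  then show ?thesis
    by eventually_elim (use der in auto)
qed

text \<open>The two Jordan parts of \<open>h\<close> have densities \<open>f1\<close> and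
  \<open>f2\<close>. Their difference integrates to \<open>h\<close>, hence is the derivative of
  \<open>h\<close> almost everywhere, hence agrees almost everywhere with \<open>g\<close>.\<close>

lemma abs_continuous_real_FTC:
  assumes ac: "abs_continuous_real h" and h: "\<forall>x\<le>0. h x = 0" "\<forall>x\<ge>1. h x = h 1"
    and g: "AE x in lborel. g x = deriv h x" and gm: "g \<in> borel_measurable borel"
    and gb: "\<And>x. \<bar>g x\<bar> \<le> K"
  shows "\<And>a b. a \<le> b \<Longrightarrow> (g has_integral h b - h a) {a..b}"
proof -
  obtain B where bnd: "\<And>xs. sorted xs \<Longrightarrow> lvar h xs \<le> B"
    using abs_continuous_real_bounded_variation[OF ac h] by blast
  let ?T = "tvar h" and ?U = "\<lambda>x. tvar h x - h x"
  have acT: "abs_continuous_real ?T"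
    using ac bnd by (rule abs_continuous_real_tvar)
  have acU: "abs_continuous_real ?U"
    using acT ac by (rule abs_continuous_real_diff)
  have T: "0 \<le> ?T x" "?T x \<le> B" for x
    using tvar_nonneg[of h B] tvar_le[of h B] bnd by auto
  have m: "x \<le> y \<Longrightarrow> ?T x \<le> ?T y" "x \<le> y \<Longrightarrow> ?U x \<le> ?U y" for x y
    using tvar_mono[of h B] tvar_diff_mono[of h B] bnd by auto
  have hb: "\<bar>h x\<bar> \<le> B" for x
    using bounded_variation_diff_le[of h B x 0] bnd h(1) by simp
  have "\<bar>?T x\<bar> \<le> B" for x
    using T[of x] by simp
  from mono_abs_continuous_density[of ?T B, OF m(1) acT this]
  obtain f1 where f1: "\<And>a b. a \<le> b \<Longrightarrow> (f1 has_integral ?T b - ?T a) {a..b}" by metis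
  have "\<bar>?U x\<bar> \<le> 2 * B" for x
    using T[of x] hb[of x] by linarith
  from mono_abs_continuous_density[of ?U "2 * B", OF m(2) acU this]
  obtain f2 where f2: "\<And>a b. a \<le> b \<Longrightarrow> (f2 has_integral ?U b - ?U a) {a..b}" by metis
  have f: "((\<lambda>x. f1 x - f2 x) has_integral h b - h a) {a..b}" if "a \<le> b" for a b
    using has_integral_diff[OF f1[OF that] f2[OF that]] by simp
  fix a b :: real assume ab: "a \<le> b"
  have "AE x in lborel. g x = f1 x - f2 x"
    using integral_has_derivative_AE[where f = "\<lambda>x. f1 x - f2 x" and h = h, OF f, simplified] g
    by eventually_elim (auto dest: DERIV_imp_deriv)
  then have "AE x in lebesgue. g x = f1 x - f2 x"
    by (simp only: AE_completion_iff)
  then obtain N where N: "\<And>x. x \<in> space lebesgue - N \<Longrightarrow> g x = f1 x - f2 x" "N \<in> null_sets lebesgue"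
    by (rule AE_E3) blast
  show "(g has_integral h b - h a) {a..b}"
  proof (rule has_integral_spike[OF _ _ f[OF ab]])
    show "negligible N" using N(2) by (simp only: negligible_iff_null_sets)
    show "g x = f1 x - f2 x" if "x \<in> {a..b} - N" for x
      using N(1)[of x] that by simp
  qed
qed

section \<open>Logarithmic sums of the Moebius function over integers coprime to r\<close>

lemma mu_0 [simp]: "mu 0 = 0"
  by (simp add: mu_def)

lemma mu_1 [simp]: "mu 1 = 1" "mu (Suc 0) = 1"
  by (simp_all add: mu_def)

lemma mu_not_squarefree: "\<not> squarefree n \<Longrightarrow> mu n = 0"
  by (simp add: mu_def)

lemma squarefree_if_mu_nonzero: "mu n \<noteq> 0 \<Longrightarrow> squarefree n"
  by (meson mu_not_squarefree)

lemma abs_mu_le: "\<bar>mu n\<bar> \<le> 1"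
  by (simp add: mu_def)

lemma mu_squared: "squarefree n \<Longrightarrow> mu n * mu n = 1"
  by (cases "n = 0") (auto simp: mu_def power_mult_distrib[symmetric])

lemma mu_mult_coprime:
  assumes "coprime a b"
  shows "mu (a * b) = mu a * mu b"
proof (cases "squarefree a \<and> squarefree b")
  case True
  then have nz: "a \<noteq> 0" "b \<noteq> 0"
    by (metis not_squarefree_0)+
  have "squarefree (a * b)"
    using True assms by (simp add: squarefree_mult_coprime)
  moreover have "prime_factors (a * b) = prime_factors a \<union> prime_factors b"
    using nz by (rule prime_factors_product)
  moreover have "prime_factors a \<inter> prime_factors b = {}"
    using assms by (meson coprime_common_divisor disjoint_iff in_prime_factors_imp_dvd in_prime_factors_imp_prime not_prime_unit)
  ultimately show ?thesis
    using True nz by (simp add: mu_def card_Un_disjoint power_add)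
next
  case False
  then have "\<not> squarefree (a * b)"
    using squarefree_multD by blast
  then show ?thesis using False by (auto simp: mu_not_squarefree)
qed

lemma mu_prime: "prime p \<Longrightarrow> mu p = -1"
  using prime_prime_factors[of p] by (auto simp: mu_def squarefree_prime prime_gt_0_nat)

lemma mu_prime_mult:
  assumes "prime p"
  shows "mu (p * m) = (if p dvd m then 0 else - mu m)"
proof (cases "p dvd m")
  case True
  then have "p ^ 2 dvd p * m" by (auto simp: power2_eq_square)
  then have "\<not> squarefree (p * m)"
    using assms not_prime_unit not_squarefreeI by blast
  then show ?thesis using True by (simp add: mu_not_squarefree)
next
  case False
  then have "coprime p m" using assms by (simp add: prime_imp_coprime)
  then show ?thesis using False assms by (simp add: mu_mult_coprime mu_prime)
qed

text \<open>For a prime \<open>p\<close> dividing \<open>n\<close>, the divisors \<open>d\<close>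
  prime to \<open>p\<close> cancel against \<open>p * d\<close>; divisors containing the square of
  \<open>p\<close> contribute 0.\<close>

lemma sum_mu_divisors:
  assumes "n > 0"
  shows "(\<Sum>d | d dvd n. mu d) = (if n = 1 then 1 else 0)"
proof (cases "n = 1")
  case False
  then obtain p where p: "prime p" "p dvd n" using prime_factor_nat by blast
  have fin: "finite {d. d dvd n}" using assms by simp
  have "(\<Sum>d | d dvd n. mu d) = (\<Sum>d | d dvd n \<and> \<not> p dvd d. mu d) + (\<Sum>d | d dvd n \<and> p dvd d. mu d)"
    using fin by (subst sum.union_disjoint[symmetric]) (auto intro!: sum.cong)
  also have "(\<Sum>d | d dvd n \<and> p dvd d. mu d) = (\<Sum>d \<in> (\<lambda>d. p * d) ` {d. d dvd n \<and> \<not> p dvd d}. mu d)"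
  proof (rule sum.mono_neutral_right)
    show "finite {d. d dvd n \<and> p dvd d}" using fin by auto
    show "(\<lambda>d. p * d) ` {d. d dvd n \<and> \<not> p dvd d} \<subseteq> {d. d dvd n \<and> p dvd d}"
      using p by (auto intro!: divides_mult prime_imp_coprime)
    show "\<forall>d\<in>{d. d dvd n \<and> p dvd d} - (\<lambda>d. p * d) ` {d. d dvd n \<and> \<not> p dvd d}. mu d = 0"
    proof
      fix d assume d: "d \<in> {d. d dvd n \<and> p dvd d} - (\<lambda>d. p * d) ` {d. d dvd n \<and> \<not> p dvd d}"
      then obtain e where e: "d = p * e" by auto
      have "e dvd n" using d e by (auto intro: dvd_mult_right)
      then have "p dvd e" using d e by auto
      then show "mu d = 0" using p(1) by (simp add: e mu_prime_mult)
    qed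
  qed
  also have "\<dots> = (\<Sum>d | d dvd n \<and> \<not> p dvd d. mu (p * d))"
    using p(1) by (subst sum.reindex) (auto simp: inj_on_def prime_gt_0_nat)
  also have "\<dots> = - (\<Sum>d | d dvd n \<and> \<not> p dvd d. mu d)"
    using p(1) by (simp add: mu_prime_mult sum_negf)
  finally show ?thesis using False by simp
qed simp

text \<open>This is F_r(y) of the overview.\<close>

definition mlog :: "nat \<Rightarrow> real \<Rightarrow> real" where
  "mlog r y = (\<Sum>m | 1 \<le> m \<and> real m \<le> y \<and> coprime m r. real_of_int (mu m) / real m * ln (y / real m))"

lemma finite_nat_le_real [simp]: "finite {m::nat. 1 \<le> m \<and> real m \<le> y \<and> P m}"
  "finite {m::nat. Suc 0 \<le> m \<and> real m \<le> y \<and> P m}"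
proof -
  show "finite {m::nat. 1 \<le> m \<and> real m \<le> y \<and> P m}"
  proof (rule finite_subset)
    show "{m::nat. 1 \<le> m \<and> real m \<le> y \<and> P m} \<subseteq> {..nat \<lfloor>y\<rfloor>}"
      by (auto simp: le_nat_floor)
  qed simp
  then show "finite {m::nat. Suc 0 \<le> m \<and> real m \<le> y \<and> P m}" by simp
qed

lemma mlog_less_1: "y < 1 \<Longrightarrow> mlog r y = 0"
  unfolding mlog_def by (intro sum.neutral) auto

text \<open>The terms with \<open>p dvd m\<close> are those with \<open>m = p * e\<close>, and
  \<open>mu\<close> kills them unless \<open>e\<close> is prime to \<open>p\<close>; so they
  reproduce the sum for \<open>p * r\<close> at \<open>y / p\<close>. Read backwards, level
  \<open>p * r\<close> is obtained from level \<open>r\<close> and from itself at a smaller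
  argument.\<close>

lemma mlog_prime_mult:
  assumes p: "prime p" "\<not> p dvd r"
  shows "mlog r y = mlog (p * r) y - mlog (p * r) (y / real p) / real p"
proof -
  have p0: "p > 0" using p(1) by (simp add: prime_gt_0_nat)
  let ?f = "\<lambda>m. real_of_int (mu m) / real m * ln (y / real m)"
  let ?g = "\<lambda>m. real_of_int (mu m) / real m * ln (y / real p / real m)"
  let ?A = "{m. 1 \<le> m \<and> real m \<le> y \<and> coprime m r}"
  have cop: "coprime m p \<longleftrightarrow> \<not> p dvd m" for m
    using p(1) prime_imp_coprime[of p m] not_prime_unit[of p] coprime_absorb_left[of p m]
    by (auto simp: coprime_commute[of m p])
  have "mlog r y = (\<Sum>m\<in>{m\<in>?A. \<not> p dvd m}. ?f m) + (\<Sum>m\<in>{m\<in>?A. p dvd m}. ?f m)"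
    unfolding mlog_def by (subst sum.union_disjoint[symmetric]) (auto intro!: sum.cong)
  also have "{m\<in>?A. \<not> p dvd m} = {m. 1 \<le> m \<and> real m \<le> y \<and> coprime m (p * r)}"
    by (auto simp: cop)
  also have "(\<Sum>m\<in>{m\<in>?A. p dvd m}. ?f m)
      = (\<Sum>m\<in>(\<lambda>m. p * m) ` {m. 1 \<le> m \<and> real m \<le> y / real p \<and> coprime m (p * r)}. ?f m)"
  proof (rule sum.mono_neutral_right)
    show "finite {m\<in>?A. p dvd m}" by simp
    show "(\<lambda>m. p * m) ` {m. 1 \<le> m \<and> real m \<le> y / real p \<and> coprime m (p * r)} \<subseteq> {m\<in>?A. p dvd m}"
      using p0 p by (auto simp: cop field_simps coprime_mult_left_iff coprime_commute[of p] prime_imp_coprime)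
    show "\<forall>m\<in>{m\<in>?A. p dvd m} - (\<lambda>m. p * m) ` {m. 1 \<le> m \<and> real m \<le> y / real p \<and> coprime m (p * r)}. ?f m = 0"
    proof
      fix m assume m: "m \<in> {m\<in>?A. p dvd m} - (\<lambda>m. p * m) ` {m. 1 \<le> m \<and> real m \<le> y / real p \<and> coprime m (p * r)}"
      then obtain e where e: "m = p * e" by auto
      have "1 \<le> e" "real e \<le> y / real p" "coprime e r"
        using m p0 by (auto simp: e field_simps)
      then have "p dvd e" using m e by (auto simp: cop)
      then show "?f m = 0" using p(1) by (simp add: e mu_prime_mult)
    qed
  qed
  also have "\<dots> = (\<Sum>m | 1 \<le> m \<and> real m \<le> y / real p \<and> coprime m (p * r). ?f (p * m))"
    using p0 by (subst sum.reindex) (auto simp: inj_on_def)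
  also have "\<dots> = (\<Sum>m | 1 \<le> m \<and> real m \<le> y / real p \<and> coprime m (p * r). - (?g m / real p))"
  proof (intro sum.cong refl)
    fix m assume "m \<in> {m. 1 \<le> m \<and> real m \<le> y / real p \<and> coprime m (p * r)}"
    then have "mu (p * m) = - mu m" using p(1) by (auto simp: cop mu_prime_mult)
    then show "?f (p * m) = - (?g m / real p)" by (simp add: mult_ac)
  qed
  also have "\<dots> = - mlog (p * r) (y / real p) / real p"
    by (simp add: mlog_def sum_negf sum_divide_distrib)
  finally show ?thesis by (simp add: mlog_def)
qed

section \<open>The error weight, Euler factors and the error bound for all squarefree r\<close>

definition shifted_log :: "real \<Rightarrow> real" where
  "shifted_log y = 8 + ln (max 1 y)"

text \<open>The shift by 8 makes \<open>(1 + log q/8)\<^sup>2 \<le> q\<^bsup>1/4\<^esup>\<close>, so that dividing the argument by \<open>q\<close>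
  costs only a factor \<open>q\<^bsup>1/4\<^esup>\<close>.\<close>

definition log_weight :: "real \<Rightarrow> real" where
  "log_weight y = 1 / (shifted_log y) ^ 2"

lemma shifted_log_ge_8: "shifted_log y \<ge> 8"
  by (simp add: shifted_log_def)

lemma shifted_log_pos: "shifted_log y > 0"
  using shifted_log_ge_8[of y] by linarith

lemma shifted_log_mono: "x \<le> y \<Longrightarrow> shifted_log x \<le> shifted_log y"
  unfolding shifted_log_def by (intro add_left_mono, subst ln_le_cancel_iff) auto

lemma log_weight_pos: "log_weight y > 0"
  using shifted_log_pos[of y] by (simp add: log_weight_def)

lemma log_weight_antimono: "x \<le> y \<Longrightarrow> log_weight y \<le> log_weight x"
  unfolding log_weight_def using shifted_log_pos[of x] shifted_log_pos[of y] shifted_log_mono[of x y]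
  by (intro divide_left_mono power_mono mult_pos_pos zero_less_power) auto

lemma log_weight_less_1: "y \<le> 1 \<Longrightarrow> log_weight y = 1 / 64"
  by (simp add: log_weight_def shifted_log_def max_def)

lemma log_weight_le: "log_weight y \<le> 1 / 64"
  using log_weight_antimono[of "min 1 y" y] by (simp add: log_weight_less_1)

lemma log_weight_divide:
  assumes q: "q \<ge> 1" and y: "y > 0"
  shows "log_weight (y / q) \<le> q powr (1/4) * log_weight y"
proof -
  define a where "a = shifted_log (y / q)"
  define l where "l = ln q"
  have a: "a \<ge> 8" unfolding a_def by (rule shifted_log_ge_8)
  have l: "l \<ge> 0" unfolding l_def using q by simp
  have "max 1 y \<le> max 1 (y / q) * q"
    using q y by (auto simp: max_def field_simps)
  then have "ln (max 1 y) \<le> ln (max 1 (y / q) * q)"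
    using q by (subst ln_le_cancel_iff) auto
  also have "\<dots> = ln (max 1 (y / q)) + l"
    unfolding l_def using q by (subst ln_mult) auto
  finally have 1: "shifted_log y \<le> a + l" by (simp add: a_def shifted_log_def)
  have "8 * l \<le> a * l" using a l by (intro mult_right_mono) auto
  then have "a + l \<le> a * (1 + l / 8)"
    by (simp add: algebra_simps)
  also have "\<dots> \<le> a * exp (l / 8)"
    using a by (intro mult_left_mono exp_ge_add_one_self) auto
  finally have "(shifted_log y) ^ 2 \<le> (a * exp (l / 8)) ^ 2"
    using shifted_log_pos[of y] 1 by (intro power_mono) auto
  also have "\<dots> = a\<^sup>2 * q powr (1/4)"
    using q by (simp add: power_mult_distrib exp_double[symmetric] powr_def l_def)
  finally have *: "(shifted_log y) ^ 2 \<le> a\<^sup>2 * q powr (1/4)" .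
  have "1 / a\<^sup>2 \<le> q powr (1/4) / (shifted_log y)\<^sup>2"
    using * a shifted_log_pos[of y] by (subst divide_le_eq) (auto simp: field_simps)
  then show ?thesis
    unfolding log_weight_def a_def[symmetric] by simp
qed

text \<open>For \<open>r > 0\<close> this is r/phi(r), the main term of
  \<open>mlog r y\<close>.\<close>

definition totient_factor :: "nat \<Rightarrow> real" where
  "totient_factor r = (\<Prod>p\<in>prime_factors r. 1 / (1 - 1 / real p))"

text \<open>The exponent is -3/4 = 1/4 - 1: each use of \<open>mlog_prime_mult\<close> gains 1/p but
  loses \<open>p powr (1/4)\<close> by \<open>log_weight_divide\<close>, and the resulting geometric
  series gives one such factor per prime.\<close>

definition kappa_factor :: "nat \<Rightarrow> real" where
  "kappa_factor r = (\<Prod>p\<in>prime_factors r. 1 / (1 - real p powr (-3/4)))"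

lemma prime_powr_bounds:
  assumes "prime (p::nat)"
  shows "1 / real p \<le> real p powr (-3/4)" "real p powr (-3/4) \<le> 2 / 3" "0 < real p powr (-3/4)"
proof -
  have p: "real p \<ge> 2" using prime_ge_2_nat[OF assms] by simp
  have "real p powr (-1) \<le> real p powr (-3/4)"
    using p by (intro powr_mono) auto
  then show "1 / real p \<le> real p powr (-3/4)"
    using p powr_neg_one[of "real p"] by simp
  \<comment> \<open>Fourth powers: 81/16 is at most 8.\<close>
  have "3/2 \<le> 2 powr (3/4 :: real)"
  proof (rule power_le_imp_le_base)
    have "(2 powr (3/4 :: real)) ^ Suc 3 = 2 powr (3 :: real)"
      by (subst powr_power) simp_all
    then show "(3/2) ^ Suc 3 \<le> (2 powr (3/4 :: real)) ^ Suc 3"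
      by (simp add: power_divide)
  qed simp
  also have "\<dots> \<le> real p powr (3/4)"
    using p by (intro powr_mono2) auto
  finally show "real p powr (-3/4) \<le> 2 / 3"
    using p by (simp add: powr_minus field_simps)
  show "0 < real p powr (-3/4)" using p by simp
qed

lemma prime_factors_prime_mult:
  assumes "prime (p::nat)" "r > 0"
  shows "prime_factors (p * r) = insert p (prime_factors r)"
  using assms prime_factors_product[of p r] prime_prime_factors[of p] by auto

lemma totient_factor_prime_mult: "prime p \<Longrightarrow> \<not> p dvd r \<Longrightarrow> r > 0 \<Longrightarrow> totient_factor (p * r) = totient_factor r / (1 - 1 / real p)"
  unfolding totient_factor_def by (subst prime_factors_prime_mult, simp, simp, subst prod.insert) auto

lemma kappa_factor_prime_mult: "prime p \<Longrightarrow> \<not> p dvd r \<Longrightarrow> r > 0 \<Longrightarrow> kappa_factor (p * r) = kappa_factor r / (1 - real p powr (-3/4))"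
  unfolding kappa_factor_def by (subst prime_factors_prime_mult, simp, simp, subst prod.insert) auto

lemma totient_factor_ge_1: "1 \<le> totient_factor r"
  unfolding totient_factor_def by (intro prod_ge_1) (auto dest!: in_prime_factors_imp_prime prime_gt_1_nat simp: field_simps)

lemma totient_factor_le_kap: "totient_factor r \<le> kappa_factor r"
  unfolding totient_factor_def kappa_factor_def
proof (intro prod_mono conjI)
  fix p assume "p \<in> prime_factors r"
  then have p: "prime p" by auto
  then have "real p > 1" using prime_gt_1_nat by simp
  then show "0 \<le> 1 / (1 - 1 / real p)" by (simp add: field_simps)
  show "1 / (1 - 1 / real p) \<le> 1 / (1 - real p powr (-3/4))"
    using prime_powr_bounds[OF p] \<open>real p > 1\<close> by (intro divide_left_mono mult_pos_pos) auto
qed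

lemma kappa_factor_ge_1: "1 \<le> kappa_factor r"
  using totient_factor_ge_1 totient_factor_le_kap order_trans by blast

text \<open>Write e_r for the difference and \<open>r = p * s\<close>. Then e_r(y) = e_s(y) +
  e_r(y/p)/p, which calls for an outer induction on \<open>r\<close> and an inner one on
  \<open>n\<close> with \<open>y < p ^ n\<close>. The two contributions add up exactly because
  \<open>kappa_factor s = kappa_factor r * (1 - p powr (-3/4))\<close>. For \<open>y < 1\<close> the
  sum is empty and the weight is 1/64, whence \<open>C \<ge> 64\<close>.\<close>

lemma mlog_bound:
  assumes star: "\<And>y. y \<ge> 1 \<Longrightarrow> \<bar>mlog 1 y - 1\<bar> \<le> C * log_weight y" and C: "C \<ge> 64"
    and r: "squarefree r" and y: "y > 0"
  shows "\<bar>mlog r y - totient_factor r\<bar> \<le> C * kappa_factor r * log_weight y"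
  using r y
proof (induction r arbitrary: y rule: less_induct)
  case (less r y)
  have small: "\<bar>mlog r y - totient_factor r\<bar> \<le> C * kappa_factor r * log_weight y" if "y < 1" for y
  proof -
    have "totient_factor r * 1 \<le> kappa_factor r * (C * log_weight y)"
      using that C kappa_factor_ge_1[of r] by (intro mult_mono totient_factor_le_kap) (auto simp: log_weight_less_1)
    then show ?thesis using that totient_factor_ge_1[of r] by (simp add: mlog_less_1 mult_ac)
  qed
  show ?case
  proof (cases "r = 1")
    case True
    then have "totient_factor r = 1" "kappa_factor r = 1" by (simp_all add: totient_factor_def kappa_factor_def)
    then show ?thesis using star[of y] small[of y] True by (cases "y < 1") auto
  next
    case False
    then obtain p where p: "prime p" "p dvd r" using prime_factor_nat by blast
    then obtain s where s: "r = p * s" by auto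
    have sq: "squarefree s" using less.prems(1) unfolding s by (rule squarefree_multD(2))
    have s0: "s > 0" using sq by (cases s) auto
    have ps: "\<not> p dvd s"
    proof
      assume "p dvd s"
      then have "p ^ 2 dvd r" unfolding s power2_eq_square by (intro mult_dvd_mono dvd_refl)
      then show False using squarefreeD[OF less.prems(1)] p(1) not_prime_unit by blast
    qed
    have "s < r" using s s0 prime_gt_1_nat[OF p(1)] by simp
    note IH = less.IH[OF this sq]
    have p1: "real p > 1" using prime_gt_1_nat[OF p(1)] by simp
    note pb = prime_powr_bounds[OF p(1)]
    have "y < real p ^ n \<Longrightarrow> y > 0 \<Longrightarrow> \<bar>mlog r y - totient_factor r\<bar> \<le> C * kappa_factor r * log_weight y" for n y
    proof (induction n arbitrary: y)
      case 0
      then show ?case by (intro small) auto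
    next
      case (Suc n)
      have "mlog r y - totient_factor r = (mlog s y - totient_factor s) + (mlog r (y / p) - totient_factor r) / p"
        using mlog_prime_mult[OF p(1) ps, of y] totient_factor_prime_mult[OF p(1) ps s0] p1
        unfolding s[symmetric] by (simp add: divide_simps) (simp add: algebra_simps)
      then have "\<bar>mlog r y - totient_factor r\<bar> \<le> \<bar>mlog s y - totient_factor s\<bar> + \<bar>mlog r (y / p) - totient_factor r\<bar> / p"
        using abs_triangle_ineq[of "mlog s y - totient_factor s" "(mlog r (y / p) - totient_factor r) / p"] by simp
      also have "\<bar>mlog s y - totient_factor s\<bar> \<le> C * kappa_factor s * log_weight y"
        using Suc.prems by (intro IH)
      also have "\<bar>mlog r (y / p) - totient_factor r\<bar> / p \<le> C * kappa_factor r * log_weight (y / p) / p"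
        using Suc.prems p1 by (intro divide_right_mono Suc.IH) (auto simp: field_simps)
      also have "\<dots> \<le> C * kappa_factor r * (real p powr (1/4) * log_weight y) / p"
        using Suc.prems p1 C kappa_factor_ge_1[of r]
        by (intro divide_right_mono mult_left_mono log_weight_divide) auto
      also have "\<dots> = C * kappa_factor r * log_weight y * real p powr (-3/4)"
      proof -
        have "real p powr (1/4) / p = real p powr (1/4 - 1)"
          using p1 by (subst powr_diff) auto
        then have "real p powr (1/4) / p = real p powr (-3/4)" by simp
        then show ?thesis by (metis (no_types, lifting) mult.assoc mult.commute times_divide_eq_right)
      qed
      also have "C * kappa_factor s * log_weight y + \<dots> = C * kappa_factor r * log_weight y"
      proof -
        have ks: "kappa_factor s = kappa_factor r * (1 - real p powr (-3/4))"
          using kappa_factor_prime_mult[OF p(1) ps s0] pb(2) unfolding s[symmetric] by simp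
        show ?thesis unfolding ks by (simp add: algebra_simps)
      qed
      finally show ?case by simp
    qed
    moreover obtain n where "y < real p ^ n"
      using p1 real_arch_pow by blast
    ultimately show ?thesis using less.prems(2) by blast
  qed
qed

section \<open>Diagonalisation of the quadratic form\<close>

text \<open>A discrete version of integrating 1/(x (8 + log(Y/x))^2), whose antiderivative is 1/(8 +
  log(Y/x)). In the induction step \<open>l\<close> is the increment of the logarithm; 1/(N+1) \<le>
  l and l \<le> 1 \<le> a make twice the antiderivative a majorant. The square in the weight is what
  makes the bound independent of \<open>Y\<close>.\<close>

lemma sum_wt_le:
  assumes Y: "Y > 0"
  shows "(\<Sum>m | 1 \<le> m \<and> real m \<le> Y. 1 / real m * log_weight (Y / real m)) \<le> 2"
proof -
  have main: "(\<Sum>m=1..N. 1 / real m * log_weight (Y / real m)) \<le> 1 + 2 / (8 + ln (Y / N))"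
    if "N \<ge> 1" "real N \<le> Y" for N
    using that
  proof (induction N rule: nat_induct_at_least)
    case base
    then have "2 / (8 + ln (Y / real 1)) \<ge> 0" by (intro divide_nonneg_nonneg) auto
    then have "1 / real 1 * log_weight (Y / real 1) \<le> 1 + 2 / (8 + ln (Y / real 1))"
      using log_weight_le[of "Y / real 1"] by linarith
    then show ?case by simp
  next
    case (Suc N)
    define a where "a = 8 + ln (Y / Suc N)"
    define l where "l = ln (real (Suc N) / real N)"
    have N: "real N \<ge> 1" using Suc.hyps by simp
    have a: "a \<ge> 8" unfolding a_def using Suc.prems N by (simp add: field_simps)
    have "l = - ln (real N / real (Suc N))"
      unfolding l_def using N by (simp add: ln_div)
    also have "\<dots> \<ge> 1 - real N / real (Suc N)"
      using ln_le_minus_one[of "real N / real (Suc N)"] N by simp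
    finally have l: "l \<ge> 1 / real (Suc N)"
      using N by (simp add: field_simps)
    have "l \<le> real (Suc N) / real N - 1"
      unfolding l_def using N by (intro ln_le_minus_one) auto
    also have "\<dots> \<le> 1" using N by (simp add: field_simps)
    finally have l1: "l \<le> 1" .
    have eq: "8 + ln (Y / N) = a + l"
      unfolding a_def l_def using N Y by (simp add: ln_div)
    have l0: "l > 0" using l N by (smt (verit) divide_pos_pos of_nat_0_less_iff zero_less_Suc)
    have "1 / real (Suc N) * (1 / a\<^sup>2) \<le> l * (1 / a\<^sup>2)"
      using l by (intro mult_right_mono) auto
    also have "\<dots> \<le> 2 * (l / (a * (a + l)))"
    proof -
      have "a * (a + l) \<le> 2 * a\<^sup>2"
        using a l1 by (simp add: power2_eq_square)
      then have "1 / (2 * a\<^sup>2) \<le> 1 / (a * (a + l))"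
        using a l0 by (intro divide_left_mono mult_pos_pos) auto
      then have "2 * l * (1 / (2 * a\<^sup>2)) \<le> 2 * l * (1 / (a * (a + l)))"
        using l0 by (intro mult_left_mono) auto
      then show ?thesis by simp
    qed
    also have "\<dots> = 2 / a - 2 / (a + l)"
      using a l0 by (simp add: field_simps)
    finally have step: "1 / real (Suc N) * (1 / a\<^sup>2) \<le> 2 / a - 2 / (a + l)" .
    have wteq: "log_weight (Y / real (Suc N)) = 1 / a\<^sup>2"
      using Suc.prems N unfolding log_weight_def shifted_log_def a_def by (simp add: max_def field_simps)
    have ih: "(\<Sum>m=1..N. 1 / real m * log_weight (Y / real m)) \<le> 1 + 2 / (a + l)"
      using Suc.IH Suc.prems unfolding eq by simp
    have "(\<Sum>m=1..Suc N. 1 / real m * log_weight (Y / real m))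
        = (\<Sum>m=1..N. 1 / real m * log_weight (Y / real m)) + 1 / real (Suc N) * (1 / a\<^sup>2)"
      by (simp only: wteq[symmetric]) simp
    then show ?case using step ih unfolding a_def[symmetric] by linarith
  qed
  show ?thesis
  proof (cases "Y < 1")
    case True
    then have empty: "{m::nat. 1 \<le> m \<and> real m \<le> Y} = {}" by auto
    show ?thesis unfolding empty by simp
  next
    case False
    define N where "N = nat \<lfloor>Y\<rfloor>"
    have N: "N \<ge> 1" "real N \<le> Y" using False by (auto simp: N_def le_nat_floor)
    have "{m. 1 \<le> m \<and> real m \<le> Y} = {1..N}"
      using False by (auto simp: N_def le_nat_floor) linarith
    moreover have "2 / (8 + ln (Y / N)) \<le> 2 / 8"
    proof -
      have "Y / N \<ge> 1" using N by simp
      then have "8 \<le> 8 + ln (Y / N)" using ln_ge_zero[of "Y / N"] by linarith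
      then show ?thesis by (rule frac_le[OF _ order_refl, rotated 2]) simp_all
    qed
    ultimately show ?thesis using main[OF N] by simp
  qed
qed

definition sqf_upto :: "real \<Rightarrow> nat set" where
  "sqf_upto X = {r. 1 \<le> r \<and> real r \<le> X \<and> squarefree r}"

lemma finite_sqf_upto [simp]: "finite (sqf_upto X)"
  by (simp add: sqf_upto_def)

lemma prod_primes_dvd:
  assumes "finite A" "A \<subseteq> prime_factors (n::nat)"
  shows "\<Prod>A dvd n"
  using assms
proof (induction A arbitrary: n rule: finite_induct)
  case (insert p A)
  have "coprime p (\<Prod>A)"
    using insert by (intro prod_coprime_right) (auto intro!: primes_coprime)
  then show ?case using insert by (auto intro!: divides_mult)
qed simp

text \<open>The square of \<open>kappa_factor r\<close> is expanded over sets \<open>A\<close> of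
  primes dividing \<open>r\<close>. The multiples of the product of \<open>A\<close> contribute at
  most 2 over that product by \<open>sum_wt_le\<close>, and summing over \<open>A\<close> gives an
  Euler product that converges because 3/4 + 1 exceeds 1.\<close>

lemma sum_kap_wt_bound:
  obtains K where "K \<ge> 0" "\<And>X. X \<ge> 1 \<Longrightarrow> (\<Sum>r\<in>sqf_upto X. (kappa_factor r)\<^sup>2 / real r * log_weight (X / real r)) \<le> K"
proof -
  define z where "z = (\<Sum>n. real n powr (-7/4))"
  have summ: "summable (\<lambda>n. real n powr (-7/4))"
    by (subst summable_real_powr_iff) simp
  \<comment> \<open>\<open>1 + g p\<close> is the squared factor of \<open>kappa_factor\<close> at
    \<open>p\<close>. As \<open>p powr (-3/4)\<close> is at most 2/3, the denominator in
    \<open>g p\<close> is at least 1/9, which gives 18 = 2 * 9.\<close>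
  define g where "g p = (1 / (1 - real p powr (-3/4)))\<^sup>2 - 1" for p :: nat
  have g: "0 \<le> g p" "g p \<le> 18 * real p powr (-3/4)" if "prime p" for p
  proof -
    define x where "x = real p powr (-3/4)"
    have x: "0 < x" "x \<le> 2/3" using prime_powr_bounds[OF that] by (auto simp: x_def)
    have "1 \<le> (1 / (1 - x))\<^sup>2"
      using x by (intro one_le_power) (auto simp: field_simps)
    then show "0 \<le> g p" by (simp add: g_def x_def)
    have "g p = (2 * x - x\<^sup>2) / (1 - x)\<^sup>2"
      unfolding g_def x_def[symmetric] using x by (simp add: divide_simps) (simp add: power2_eq_square algebra_simps)
    also have "\<dots> \<le> (2 * x) / (1/3)\<^sup>2"
      using x by (intro frac_le power_mono) auto
    finally show "g p \<le> 18 * real p powr (-3/4)" by (simp add: x_def power2_eq_square)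
  qed
  show thesis
  proof (rule that)
    show "2 * exp (18 * z) \<ge> 0" by simp
    fix X :: real assume X: "X \<ge> 1"
    define P where "P = {p::nat. 1 \<le> p \<and> real p \<le> X \<and> prime p}"
    have P: "finite P" "\<And>p. p \<in> P \<Longrightarrow> prime p" by (auto simp: P_def)
    have pfP: "prime_factors r \<subseteq> P" if "r \<in> sqf_upto X" for r
    proof
      fix p assume p: "p \<in> prime_factors r"
      then have "p dvd r" "prime p" by auto
      moreover have "r > 0" "real r \<le> X" using that by (auto simp: sqf_upto_def)
      ultimately have "p \<le> r" "real r \<le> X" using dvd_imp_le by auto
      then show "p \<in> P" using \<open>prime p\<close> prime_gt_0_nat[of p] by (auto simp: P_def)
    qed
    define t where "t r = 1 / real r * log_weight (X / real r)" for r :: nat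
    have t: "t r \<ge> 0" for r using log_weight_pos[of "X / real r"] by (simp add: t_def)
    have kap2: "(kappa_factor r)\<^sup>2 = (\<Sum>A\<in>Pow P. if A \<subseteq> prime_factors r then \<Prod>p\<in>A. g p else 0)"
      if r: "r \<in> sqf_upto X" for r
    proof -
      have "(kappa_factor r)\<^sup>2 = (\<Prod>p\<in>prime_factors r. g p + 1)"
        by (simp add: kappa_factor_def g_def prod_power_distrib)
      also have "\<dots> = (\<Sum>A\<in>Pow (prime_factors r). \<Prod>p\<in>A. g p)"
        by (subst prod_add) auto
      also have "\<dots> = (\<Sum>A\<in>Pow P. if A \<subseteq> prime_factors r then \<Prod>p\<in>A. g p else 0)"
        using P(1) pfP[OF r] by (intro sum.mono_neutral_cong_left) auto
      finally show ?thesis .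
    qed
    have inner: "(\<Sum>r | r \<in> sqf_upto X \<and> A \<subseteq> prime_factors r. t r) \<le> 2 / real (\<Prod>A)"
      if A: "A \<subseteq> P" for A
    proof -
      define a where "a = \<Prod>A"
      have finA: "finite A" using A P(1) finite_subset by blast
      have "a > 0" unfolding a_def using A P(2) by (intro prod_pos) (auto simp: prime_gt_0_nat)
      have "(\<Sum>r | r \<in> sqf_upto X \<and> A \<subseteq> prime_factors r. t r)
          \<le> (\<Sum>r\<in>(\<lambda>m. a * m) ` {m. 1 \<le> m \<and> real m \<le> X / real a}. t r)"
      proof (rule sum_mono2)
        show "finite ((\<lambda>m. a * m) ` {m. 1 \<le> m \<and> real m \<le> X / real a})"
          using finite_nat_le_real(1)[of "X / real a" "\<lambda>_. True"] by simp
        show "{r. r \<in> sqf_upto X \<and> A \<subseteq> prime_factors r} \<subseteq> (\<lambda>m. a * m) ` {m. 1 \<le> m \<and> real m \<le> X / real a}"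
        proof
          fix r assume r: "r \<in> {r. r \<in> sqf_upto X \<and> A \<subseteq> prime_factors r}"
          then have "a dvd r" unfolding a_def using finA by (intro prod_primes_dvd) auto
          then obtain m where "r = a * m" by auto
          then show "r \<in> (\<lambda>m. a * m) ` {m. 1 \<le> m \<and> real m \<le> X / real a}"
            using r \<open>a > 0\<close> by (auto simp: sqf_upto_def field_simps)
        qed
      qed (use t in auto)
      also have "\<dots> = (\<Sum>m | 1 \<le> m \<and> real m \<le> X / real a. t (a * m))"
        using \<open>a > 0\<close> by (subst sum.reindex) (auto simp: inj_on_def)
      also have "\<dots> = (\<Sum>m | 1 \<le> m \<and> real m \<le> X / real a. 1 / real m * log_weight (X / real a / real m)) / real a"
        by (simp add: t_def sum_divide_distrib mult_ac)
      also have "\<dots> \<le> 2 / real a"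
        using X \<open>a > 0\<close> by (intro divide_right_mono sum_wt_le) auto
      finally show ?thesis by (simp add: a_def)
    qed
    have "(\<Sum>r\<in>sqf_upto X. (kappa_factor r)\<^sup>2 / real r * log_weight (X / real r)) = (\<Sum>r\<in>sqf_upto X. (kappa_factor r)\<^sup>2 * t r)"
      by (simp add: t_def)
    also have "\<dots> = (\<Sum>r\<in>sqf_upto X. \<Sum>A\<in>Pow P. (if A \<subseteq> prime_factors r then (\<Prod>p\<in>A. g p) * t r else 0))"
      by (intro sum.cong refl) (auto simp: kap2 sum_distrib_right intro!: sum.cong)
    also have "\<dots> = (\<Sum>A\<in>Pow P. \<Sum>r\<in>sqf_upto X. (if A \<subseteq> prime_factors r then (\<Prod>p\<in>A. g p) * t r else 0))"
      by (rule sum.swap)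
    also have "\<dots> = (\<Sum>A\<in>Pow P. (\<Prod>p\<in>A. g p) * (\<Sum>r | r \<in> sqf_upto X \<and> A \<subseteq> prime_factors r. t r))"
      by (intro sum.cong refl) (auto simp: sum_distrib_left sum.If_cases Int_def)
    also have "\<dots> \<le> (\<Sum>A\<in>Pow P. (\<Prod>p\<in>A. g p) * (2 / real (\<Prod>A)))"
      using g(1) P(2) by (intro sum_mono mult_left_mono inner prod_nonneg) auto
    also have "\<dots> = 2 * (\<Sum>A\<in>Pow P. \<Prod>p\<in>A. g p / real p)"
      by (simp add: sum_distrib_left prod_dividef mult.commute)
    also have "(\<Sum>A\<in>Pow P. \<Prod>p\<in>A. g p / real p) = (\<Prod>p\<in>P. g p / real p + 1)"
      using P(1) by (subst prod_add) auto
    also have "\<dots> \<le> (\<Prod>p\<in>P. exp (18 * real p powr (-7/4)))"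
    proof (intro prod_mono conjI)
      fix p assume "p \<in> P"
      then have p: "prime p" "real p > 0" using P(2) prime_gt_0_nat by auto
      then show "0 \<le> g p / real p + 1" using g(1)[OF p(1)] by simp
      have "g p / real p \<le> 18 * real p powr (-3/4) / real p"
        using g(2)[OF p(1)] p(2) by (intro divide_right_mono) auto
      also have "\<dots> = 18 * real p powr (-3/4 - 1)"
        using p(2) by (subst powr_diff) auto
      finally have "g p / real p + 1 \<le> 1 + 18 * real p powr (-7/4)" by simp
      also have "\<dots> \<le> exp (18 * real p powr (-7/4))" by (rule exp_ge_add_one_self)
      finally show "g p / real p + 1 \<le> exp (18 * real p powr (-7/4))" .
    qed
    also have "\<dots> = exp (18 * (\<Sum>p\<in>P. real p powr (-7/4)))"
      using P(1) by (simp add: exp_sum sum_distrib_left)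
    also have "\<dots> \<le> exp (18 * z)"
      unfolding z_def using P(1) summ by (auto intro!: sum_le_suminf)
    finally show "(\<Sum>r\<in>sqf_upto X. (kappa_factor r)\<^sup>2 / real r * log_weight (X / real r)) \<le> 2 * exp (18 * z)" by simp
  qed
qed

text \<open>After opening \<open>mlog\<close> put \<open>n = r * m\<close>: each squarefree
  \<open>n\<close> occurs once for every divisor \<open>m\<close>, with a weight depending only on
  \<open>n\<close>, so the divisor sum of \<open>mu\<close> leaves only
  \<open>n = 1\<close>.\<close>

lemma sum_mlog_eq_ln:
  assumes X: "X \<ge> 1"
  shows "(\<Sum>r\<in>sqf_upto X. mlog r (X / real r) / real r) = ln X"
proof -
  define h where "h n = ln (X / real n) / real n" for n :: nat
  have "(\<Sum>r\<in>sqf_upto X. mlog r (X / real r) / real r)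
      = (\<Sum>r\<in>sqf_upto X. \<Sum>m | 1 \<le> m \<and> real m \<le> X / real r \<and> coprime m r. real_of_int (mu m) * h (r * m))"
    by (intro sum.cong refl) (simp add: mlog_def h_def sum_divide_distrib field_simps)
  also have "\<dots> = (\<Sum>(r, m)\<in>(SIGMA r:sqf_upto X. {m. 1 \<le> m \<and> real m \<le> X / real r \<and> coprime m r}).
      real_of_int (mu m) * h (r * m))"
    by (subst sum.Sigma) auto
  also have "\<dots> = (\<Sum>(r, m)\<in>(SIGMA r:sqf_upto X. {m. 1 \<le> m \<and> real m \<le> X / real r \<and> coprime m r \<and> squarefree m}).
      real_of_int (mu m) * h (r * m))"
    by (intro sum.mono_neutral_right) (auto simp: squarefree_if_mu_nonzero)
  also have "\<dots> = (\<Sum>(n, m)\<in>(SIGMA n:sqf_upto X. {m. m dvd n}). real_of_int (mu m) * h n)"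
  proof (rule sum.reindex_bij_witness[of _ "\<lambda>(n, m). (n div m, m)" "\<lambda>(r, m). (r * m, m)"])
    fix x assume "x \<in> (SIGMA r:sqf_upto X. {m. 1 \<le> m \<and> real m \<le> X / real r \<and> coprime m r \<and> squarefree m})"
    then obtain r m where x: "x = (r, m)" and r: "r \<in> sqf_upto X"
      and m: "1 \<le> m" "real m \<le> X / real r" "coprime m r" "squarefree m" by auto
    show "(case case x of (r, m) \<Rightarrow> (r * m, m) of (n, m) \<Rightarrow> (n div m, m)) = x"
      using m by (simp add: x)
    show "(case case x of (r, m) \<Rightarrow> (r * m, m) of (n, m) \<Rightarrow> real_of_int (mu m) * h n)
        = (case x of (r, m) \<Rightarrow> real_of_int (mu m) * h (r * m))"
      by (simp add: x)
    have "squarefree (r * m)"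
      using r m by (intro squarefree_mult_coprime) (auto simp: sqf_upto_def coprime_commute)
    then show "(case x of (r, m) \<Rightarrow> (r * m, m)) \<in> (SIGMA n:sqf_upto X. {m. m dvd n})"
      using r m by (auto simp: x sqf_upto_def field_simps)
  next
    fix y assume "y \<in> (SIGMA n:sqf_upto X. {m. m dvd n})"
    then obtain n m where y: "y = (n, m)" and n: "n \<in> sqf_upto X" and "m dvd n" by auto
    then obtain r where r: "n = m * r" by auto
    have nz: "m > 0" "r > 0" using n r by (auto simp: sqf_upto_def intro!: Nat.gr0I)
    have sq: "squarefree m" "squarefree r" using n squarefree_multD[of m r] by (auto simp: sqf_upto_def r)
    show "(case case y of (n, m) \<Rightarrow> (n div m, m) of (r, m) \<Rightarrow> (r * m, m)) = y"
      using \<open>m dvd n\<close> by (simp add: y)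
    have cop: "coprime m r"
    proof (rule coprimeI)
      fix d assume "d dvd m" "d dvd r"
      then have "d ^ 2 dvd n" unfolding r power2_eq_square by (rule mult_dvd_mono)
      moreover have "squarefree n" using n by (simp add: sqf_upto_def)
      ultimately show "d dvd 1" using squarefreeD by blast
    qed
    have "r \<le> m * r" using nz by simp
    then have "real r \<le> real (m * r)" by (rule of_nat_mono)
    moreover have "real (m * r) \<le> X" using n unfolding sqf_upto_def r by blast
    ultimately have "real r \<le> X" by linarith
    moreover have "real m \<le> X / real r" using n nz by (auto simp: sqf_upto_def r field_simps)
    ultimately show "(case y of (n, m) \<Rightarrow> (n div m, m)) \<in>
        (SIGMA r:sqf_upto X. {m. 1 \<le> m \<and> real m \<le> X / real r \<and> coprime m r \<and> squarefree m})"
      using nz sq cop by (simp add: y sqf_upto_def r)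
  qed
  also have "\<dots> = (\<Sum>n\<in>sqf_upto X. \<Sum>m | m dvd n. real_of_int (mu m) * h n)"
    by (subst sum.Sigma) (auto simp: sqf_upto_def)
  also have "\<dots> = (\<Sum>n\<in>sqf_upto X. if n = 1 then h n else 0)"
  proof (intro sum.cong refl)
    fix n assume "n \<in> sqf_upto X"
    then have "n > 0" by (simp add: sqf_upto_def)
    have "(\<Sum>m | m dvd n. real_of_int (mu m) * h n) = real_of_int (\<Sum>m | m dvd n. mu m) * h n"
      by (simp add: sum_distrib_right)
    then show "(\<Sum>m | m dvd n. real_of_int (mu m) * h n) = (if n = 1 then h n else 0)"
      using \<open>n > 0\<close> by (simp add: sum_mu_divisors)
  qed
  also have "\<dots> = h 1"
    using X by (subst sum.delta) (auto simp: sqf_upto_def)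
  finally show ?thesis by (simp add: h_def)
qed


section \<open>The quadratic form evaluated at log_plus\<close>

definition log_plus :: "real \<Rightarrow> nat \<Rightarrow> real" where
  "log_plus X d = max 0 (ln (X / real d))"

lemma inverse_lcm_eq:
  assumes "d1 \<in> {1..N}" "d2 \<in> {1..N}"
  shows "1 / real (lcm d1 d2) = (\<Sum>r\<in>{1..N}. if r dvd d1 \<and> r dvd d2 then real (totient r) else 0) / (real d1 * real d2)"
proof -
  have pos: "d1 > 0" "d2 > 0" using assms by auto
  have "{r. r dvd gcd d1 d2} = {r\<in>{1..N}. r dvd d1 \<and> r dvd d2}"
    using assms pos by (auto dest: dvd_imp_le intro!: Suc_leI Nat.gr0I)
  then have "gcd d1 d2 = (\<Sum>r\<in>{r\<in>{1..N}. r dvd d1 \<and> r dvd d2}. totient r)"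
    using totient_divisor_sum[of "gcd d1 d2"] by simp
  also have "\<dots> = (\<Sum>r\<in>{1..N}. if r dvd d1 \<and> r dvd d2 then totient r else 0)"
    by (rule sum.inter_filter) simp
  finally have "real (gcd d1 d2) = (\<Sum>r\<in>{1..N}. if r dvd d1 \<and> r dvd d2 then real (totient r) else 0)"
    by (simp add: if_distrib cong: if_cong)
  moreover have "real (lcm d1 d2) * real (gcd d1 d2) = real d1 * real d2"
    by (metis of_nat_mult prod_gcd_lcm_nat mult.commute)
  ultimately show ?thesis
    using pos by (auto simp: field_simps)
qed

text \<open>Put \<open>d = r * m\<close>. If \<open>m\<close> and \<open>r\<close> share a factor
  then \<open>d\<close> is not squarefree, and beyond \<open>X\<close> the factor
  \<open>log_plus X d\<close> vanishes; what is left is \<open>mlog\<close>.\<close>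

lemma sum_multiples_mu_lplus:
  assumes X: "0 < X" "X \<le> real N" and r: "r > 0"
  shows "(\<Sum>d\<in>{1..N}. if r dvd d then real_of_int (mu d) / real d * log_plus X d else 0)
    = real_of_int (mu r) / real r * mlog r (X / real r)"
proof -
  let ?f = "\<lambda>d. real_of_int (mu d) / real d * log_plus X d"
  let ?B = "{m. 1 \<le> m \<and> real m \<le> X / real r \<and> coprime m r}"
  have "(\<Sum>d\<in>{1..N}. if r dvd d then ?f d else 0) = (\<Sum>d\<in>{d\<in>{1..N}. r dvd d}. ?f d)"
    by (rule sum.inter_filter[symmetric]) simp
  also have "\<dots> = (\<Sum>d\<in>(\<lambda>m. r * m) ` ?B. ?f d)"
  proof (rule sum.mono_neutral_right)
    show "(\<lambda>m. r * m) ` ?B \<subseteq> {d\<in>{1..N}. r dvd d}"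
    proof (clarify, intro conjI)
      fix m assume m: "1 \<le> m" "real m \<le> X / real r"
      then have "real (r * m) \<le> real N" using X r by (simp add: field_simps)
      then have "r * m \<le> N" by (simp only: of_nat_le_iff)
      then show "r * m \<in> {1..N}" using m r by simp
    qed simp
    show "\<forall>d\<in>{d\<in>{1..N}. r dvd d} - (\<lambda>m. r * m) ` ?B. ?f d = 0"
    proof
      fix d assume d: "d \<in> {d\<in>{1..N}. r dvd d} - (\<lambda>m. r * m) ` ?B"
      then obtain m where m: "d = r * m" by auto
      have m1: "1 \<le> m" using d m by (cases m) auto
      show "?f d = 0"
      proof (cases "squarefree d")
        case True
        have "coprime m r"
        proof (rule coprimeI)
          fix e assume "e dvd m" "e dvd r"
          then have "e ^ 2 dvd d" unfolding m power2_eq_square by (intro mult_dvd_mono)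
          then show "e dvd 1" using True squarefreeD by blast
        qed
        then have "\<not> real m \<le> X / real r" using d m m1 by auto
        then have "X < real d" using r by (simp add: m field_simps)
        then have "ln (X / real d) \<le> 0" using X(1) by simp
        then show ?thesis by (simp add: log_plus_def)
      qed (simp add: mu_not_squarefree)
    qed
  qed simp
  also have "\<dots> = (\<Sum>m\<in>?B. ?f (r * m))"
    using r by (subst sum.reindex) (auto simp: inj_on_def)
  also have "\<dots> = (\<Sum>m\<in>?B. real_of_int (mu r) / real r * (real_of_int (mu m) / real m * ln (X / real r / real m)))"
  proof (intro sum.cong refl)
    fix m assume m: "m \<in> ?B"
    then have "mu (r * m) = mu r * mu m" by (intro mu_mult_coprime) (simp add: coprime_commute)
    moreover have "log_plus X (r * m) = ln (X / real r / real m)"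
    proof -
      have "X / real (r * m) \<ge> 1" using m r by (simp add: field_simps)
      then have "ln (X / real (r * m)) \<ge> 0" by simp
      then show ?thesis by (simp add: log_plus_def max_def)
    qed
    ultimately show "?f (r * m) = real_of_int (mu r) / real r * (real_of_int (mu m) / real m * ln (X / real r / real m))"
      by simp
  qed
  finally show ?thesis by (simp add: mlog_def sum_distrib_left)
qed

text \<open>By \<open>inverse_lcm_eq\<close> the variables \<open>d1\<close> and \<open>d2\<close>
  separate for each fixed \<open>r\<close>. The diagonal weight phi(r) mu(r)^2/r^2 is 1/(r *
  \<open>totient_factor r\<close>) on squarefree \<open>r\<close>, and \<open>mlog\<close> vanishes
  below 1, so \<open>r\<close> stops at the smaller bound.\<close>

lemma quadratic_sum_eq:
  assumes X: "0 < X1" "X1 \<le> X2" "X2 \<le> real N"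
  shows "(\<Sum>d1\<in>{1..N}. \<Sum>d2\<in>{1..N}. real_of_int (mu d1 * mu d2) / real (lcm d1 d2) * log_plus X1 d1 * log_plus X2 d2)
    = (\<Sum>r\<in>sqf_upto X1. mlog r (X1 / real r) * mlog r (X2 / real r) / totient_factor r / real r)"
proof -
  let ?f = "\<lambda>X r d. if r dvd d then real_of_int (mu d) / real d * log_plus X d else 0"
  have "(\<Sum>d1\<in>{1..N}. \<Sum>d2\<in>{1..N}. real_of_int (mu d1 * mu d2) / real (lcm d1 d2) * log_plus X1 d1 * log_plus X2 d2)
      = (\<Sum>d1\<in>{1..N}. \<Sum>d2\<in>{1..N}. \<Sum>r\<in>{1..N}. real (totient r) * (?f X1 r d1 * ?f X2 r d2))"
  proof (intro sum.cong refl)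
    fix d1 d2 assume d: "d1 \<in> {1..N}" "d2 \<in> {1..N}"
    have "real_of_int (mu d1 * mu d2) / real (lcm d1 d2) * log_plus X1 d1 * log_plus X2 d2
        = 1 / real (lcm d1 d2) * (real_of_int (mu d1) * real_of_int (mu d2) * log_plus X1 d1 * log_plus X2 d2)"
      by simp
    also have "\<dots> = (\<Sum>r\<in>{1..N}. (if r dvd d1 \<and> r dvd d2 then real (totient r) else 0) *
        (real_of_int (mu d1) * real_of_int (mu d2) * log_plus X1 d1 * log_plus X2 d2) / (real d1 * real d2))"
      unfolding inverse_lcm_eq[OF d] by (simp add: sum_divide_distrib sum_distrib_right)
    also have "\<dots> = (\<Sum>r\<in>{1..N}. real (totient r) * (?f X1 r d1 * ?f X2 r d2))"
      by (intro sum.cong refl) auto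
    finally show "real_of_int (mu d1 * mu d2) / real (lcm d1 d2) * log_plus X1 d1 * log_plus X2 d2
        = (\<Sum>r\<in>{1..N}. real (totient r) * (?f X1 r d1 * ?f X2 r d2))" .
  qed
  also have "\<dots> = (\<Sum>d1\<in>{1..N}. \<Sum>r\<in>{1..N}. \<Sum>d2\<in>{1..N}. real (totient r) * (?f X1 r d1 * ?f X2 r d2))"
    by (intro sum.cong refl sum.swap)
  also have "\<dots> = (\<Sum>r\<in>{1..N}. \<Sum>d1\<in>{1..N}. \<Sum>d2\<in>{1..N}. real (totient r) * (?f X1 r d1 * ?f X2 r d2))"
    by (rule sum.swap)
  also have "\<dots> = (\<Sum>r\<in>{1..N}. real (totient r) * ((\<Sum>d1\<in>{1..N}. ?f X1 r d1) * (\<Sum>d2\<in>{1..N}. ?f X2 r d2)))"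
    by (intro sum.cong refl) (simp only: sum_product, simp only: sum_distrib_left)
  also have "\<dots> = (\<Sum>r\<in>{1..N}. real (totient r) * ((real_of_int (mu r) / real r * mlog r (X1 / real r)) *
      (real_of_int (mu r) / real r * mlog r (X2 / real r))))"
    using X by (intro sum.cong refl arg_cong2[where f = "(*)"] sum_multiples_mu_lplus) auto
  also have "\<dots> = (\<Sum>r\<in>sqf_upto X1. real (totient r) * ((real_of_int (mu r) / real r * mlog r (X1 / real r)) *
      (real_of_int (mu r) / real r * mlog r (X2 / real r))))"
  proof (rule sum.mono_neutral_right)
    show "sqf_upto X1 \<subseteq> {1..N}"
    proof
      fix r assume "r \<in> sqf_upto X1"
      then have "1 \<le> r" "real r \<le> real N" using X by (auto simp: sqf_upto_def)
      then show "r \<in> {1..N}" by simp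
    qed
    show "\<forall>r\<in>{1..N} - sqf_upto X1. real (totient r) * ((real_of_int (mu r) / real r * mlog r (X1 / real r)) *
      (real_of_int (mu r) / real r * mlog r (X2 / real r))) = 0"
    proof
      fix r assume r: "r \<in> {1..N} - sqf_upto X1"
      show "real (totient r) * ((real_of_int (mu r) / real r * mlog r (X1 / real r)) *
        (real_of_int (mu r) / real r * mlog r (X2 / real r))) = 0"
      proof (cases "squarefree r")
        case True
        then have "X1 / real r < 1" using r by (auto simp: sqf_upto_def field_simps)
        then show ?thesis by (simp add: mlog_less_1)
      qed (simp add: mu_not_squarefree)
    qed
  qed simp
  also have "\<dots> = (\<Sum>r\<in>sqf_upto X1. mlog r (X1 / real r) * mlog r (X2 / real r) / totient_factor r / real r)"
  proof (intro sum.cong refl)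
    fix r assume "r \<in> sqf_upto X1"
    then have r: "squarefree r" "r > 0" by (auto simp: sqf_upto_def)
    have m: "real_of_int (mu r) * real_of_int (mu r) = 1"
      using mu_squared[OF r(1)] by (metis of_int_1 of_int_mult)
    have "real (totient r) = real r / totient_factor r"
      unfolding totient_formula2 totient_factor_def by (simp add: prod_dividef)
    then have "real (totient r) * ((real_of_int (mu r) / real r * mlog r (X1 / real r)) *
      (real_of_int (mu r) / real r * mlog r (X2 / real r)))
      = (real_of_int (mu r) * real_of_int (mu r)) * (real r / real r) *
        (mlog r (X1 / real r) * mlog r (X2 / real r) / totient_factor r / real r)"
      by simp
    then show "real (totient r) * ((real_of_int (mu r) / real r * mlog r (X1 / real r)) *
      (real_of_int (mu r) / real r * mlog r (X2 / real r)))
      = mlog r (X1 / real r) * mlog r (X2 / real r) / totient_factor r / real r"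
      using m r(2) by simp
  qed
  finally show ?thesis .
qed

text \<open>Let X1 \<le> X2, let c be \<open>totient_factor r\<close> and c + e_i the value of
  \<open>mlog r\<close> at X_i/r. Then (c + e_1)(c + e_2)/c = (c + e_1) + e_2 + e_1 e_2/c. The first
  summand gives exactly \<open>ln X1\<close> by \<open>sum_mlog_eq_ln\<close>; only the other two
  need decay, and both are estimated with the weight at the smaller argument.\<close>

lemma quadratic_sum_bound:
  assumes star: "\<forall>y\<ge>1. \<bar>mlog 1 y - 1\<bar> \<le> C0 * log_weight y"
  shows "\<exists>K\<ge>0. \<forall>X1 X2 N. 1 \<le> X1 \<longrightarrow> 1 \<le> X2 \<longrightarrow> X1 \<le> real N \<longrightarrow> X2 \<le> real N \<longrightarrow>
    \<bar>(\<Sum>d1\<in>{1..N}. \<Sum>d2\<in>{1..N}. real_of_int (mu d1 * mu d2) / real (lcm d1 d2) * log_plus X1 d1 * log_plus X2 d2)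
      - ln (min X1 X2)\<bar> \<le> K"
proof -
  define C where "C = max 64 C0"
  have C: "C \<ge> 64" by (simp add: C_def)
  have star': "\<bar>mlog 1 y - 1\<bar> \<le> C * log_weight y" if "y \<ge> 1" for y
  proof -
    have "C0 * log_weight y \<le> C * log_weight y" using log_weight_pos[of y] by (intro mult_right_mono) (auto simp: C_def)
    then show ?thesis using star[rule_format, OF that] by simp
  qed
  obtain K where K: "K \<ge> 0" "\<And>X. X \<ge> 1 \<Longrightarrow> (\<Sum>r\<in>sqf_upto X. (kappa_factor r)\<^sup>2 / real r * log_weight (X / real r)) \<le> K"
    using sum_kap_wt_bound by blast
  have ordered: "\<bar>(\<Sum>d1\<in>{1..N}. \<Sum>d2\<in>{1..N}. real_of_int (mu d1 * mu d2) / real (lcm d1 d2) * log_plus X1 d1 * log_plus X2 d2)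
      - ln X1\<bar> \<le> (C + C\<^sup>2) * K" if X: "1 \<le> X1" "X1 \<le> X2" "X2 \<le> real N" for X1 X2 N
  proof -
    define e where "e X r = mlog r (X / real r) - totient_factor r" for X r
    have eb: "\<bar>e X r\<bar> \<le> C * kappa_factor r * log_weight (X1 / real r)" if "X \<ge> X1" "r \<in> sqf_upto X1" for X r
    proof -
      have r: "squarefree r" "r > 0" using that by (auto simp: sqf_upto_def)
      have "\<bar>e X r\<bar> \<le> C * kappa_factor r * log_weight (X / real r)"
        unfolding e_def using that X r by (intro mlog_bound star' C) auto
      also have "\<dots> \<le> C * kappa_factor r * log_weight (X1 / real r)"
        using that C kappa_factor_ge_1[of r] r by (intro mult_left_mono log_weight_antimono divide_right_mono) auto
      finally show ?thesis .
    qed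
    have "(\<Sum>r\<in>sqf_upto X1. mlog r (X1 / real r) * mlog r (X2 / real r) / totient_factor r / real r) - ln X1
        = (\<Sum>r\<in>sqf_upto X1. (e X2 r + e X1 r * e X2 r / totient_factor r) / real r)"
    proof -
      have "(\<Sum>r\<in>sqf_upto X1. mlog r (X1 / real r) * mlog r (X2 / real r) / totient_factor r / real r) - ln X1
        = (\<Sum>r\<in>sqf_upto X1. mlog r (X1 / real r) * mlog r (X2 / real r) / totient_factor r / real r
            - mlog r (X1 / real r) / real r)"
        using sum_mlog_eq_ln[OF X(1)] by (simp add: sum_subtractf)
      also have "\<dots> = (\<Sum>r\<in>sqf_upto X1. (e X2 r + e X1 r * e X2 r / totient_factor r) / real r)"
      proof (intro sum.cong refl)
        fix r assume "r \<in> sqf_upto X1"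
        have c: "totient_factor r > 0" using totient_factor_ge_1[of r] by simp
        have m: "mlog r (X / real r) = totient_factor r + e X r" for X by (simp add: e_def)
        have "(totient_factor r + e X1 r) * (totient_factor r + e X2 r) / totient_factor r - (totient_factor r + e X1 r)
            = e X2 r + e X1 r * e X2 r / totient_factor r"
          using c by (simp add: divide_simps) (simp add: algebra_simps)
        then show "mlog r (X1 / real r) * mlog r (X2 / real r) / totient_factor r / real r
            - mlog r (X1 / real r) / real r = (e X2 r + e X1 r * e X2 r / totient_factor r) / real r"
          by (simp only: m diff_divide_distrib[symmetric])
      qed
      finally show ?thesis .
    qed
    also have "\<bar>\<dots>\<bar> \<le> (\<Sum>r\<in>sqf_upto X1. (C + C\<^sup>2) * ((kappa_factor r)\<^sup>2 / real r * log_weight (X1 / real r)))"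
    proof (rule order_trans[OF sum_abs], rule sum_mono)
      fix r assume r: "r \<in> sqf_upto X1"
      define w where "w = log_weight (X1 / real r)"
      have w: "0 < w" "w \<le> 1" using log_weight_pos[of "X1 / real r"] log_weight_le[of "X1 / real r"] by (auto simp: w_def)
      define k where "k = kappa_factor r"
      have k: "k \<ge> 1" "k \<le> k\<^sup>2" using kappa_factor_ge_1[of r] by (auto simp: k_def power2_eq_square)
      have e1: "\<bar>e X1 r\<bar> \<le> C * k * w" and e2: "\<bar>e X2 r\<bar> \<le> C * k * w"
        using eb[OF _ r, of X1] eb[OF _ r, of X2] X by (auto simp: k_def w_def)
      have "\<bar>e X1 r * e X2 r / totient_factor r\<bar> \<le> \<bar>e X1 r * e X2 r\<bar> / 1"
        unfolding abs_divide using totient_factor_ge_1[of r] by (intro divide_left_mono) auto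
      also have "\<dots> \<le> (C * k * w) * (C * k * w)"
        unfolding abs_mult div_by_1 using e1 e2 by (intro mult_mono) auto
      also have "\<dots> = C\<^sup>2 * k\<^sup>2 * w * w" by (simp add: power2_eq_square)
      also have "\<dots> \<le> C\<^sup>2 * k\<^sup>2 * w * 1" using w by (intro mult_left_mono) auto
      finally have 1: "\<bar>e X1 r * e X2 r / totient_factor r\<bar> \<le> C\<^sup>2 * k\<^sup>2 * w" by simp
      have "C * k * w \<le> C * k\<^sup>2 * w"
        using k w C by (intro mult_right_mono mult_left_mono) auto
      with 1 e2 have "\<bar>e X2 r + e X1 r * e X2 r / totient_factor r\<bar> \<le> C * k\<^sup>2 * w + C\<^sup>2 * k\<^sup>2 * w"
        by linarith
      then have "\<bar>e X2 r + e X1 r * e X2 r / totient_factor r\<bar> \<le> (C + C\<^sup>2) * (k\<^sup>2 * w)"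
        by (simp only: distrib_right mult.assoc)
      then have "\<bar>e X2 r + e X1 r * e X2 r / totient_factor r\<bar> / real r \<le> (C + C\<^sup>2) * (k\<^sup>2 * w) / real r"
        by (intro divide_right_mono) auto
      then show "\<bar>(e X2 r + e X1 r * e X2 r / totient_factor r) / real r\<bar> \<le> (C + C\<^sup>2) * ((kappa_factor r)\<^sup>2 / real r * log_weight (X1 / real r))"
        by (simp add: abs_divide k_def w_def)
    qed
    also have "\<dots> \<le> (C + C\<^sup>2) * K"
      unfolding sum_distrib_left[symmetric] using C K(2)[OF X(1)] by (intro mult_left_mono) auto
    finally show ?thesis
      using X by (subst quadratic_sum_eq) auto
  qed
  show ?thesis
  proof (intro exI[of _ "(C + C\<^sup>2) * K"] conjI allI impI)
    show "(C + C\<^sup>2) * K \<ge> 0" using C K(1) by auto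
    fix X1 X2 N assume X: "1 \<le> X1" "1 \<le> X2" "X1 \<le> real N" "X2 \<le> real N"
    show "\<bar>(\<Sum>d1\<in>{1..N}. \<Sum>d2\<in>{1..N}. real_of_int (mu d1 * mu d2) / real (lcm d1 d2) * log_plus X1 d1 * log_plus X2 d2)
      - ln (min X1 X2)\<bar> \<le> (C + C\<^sup>2) * K"
    proof (cases "X1 \<le> X2")
      case True
      then show ?thesis using ordered[of X1 X2 N] X by (simp add: min_def)
    next
      case False
      have "(\<Sum>d1\<in>{1..N}. \<Sum>d2\<in>{1..N}. real_of_int (mu d1 * mu d2) / real (lcm d1 d2) * log_plus X1 d1 * log_plus X2 d2)
        = (\<Sum>d1\<in>{1..N}. \<Sum>d2\<in>{1..N}. real_of_int (mu d1 * mu d2) / real (lcm d1 d2) * log_plus X2 d1 * log_plus X1 d2)"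
        by (subst sum.swap) (simp add: lcm.commute mult_ac)
      then show ?thesis using ordered[of X2 X1 N] X False by (simp add: min_def)
    qed
  qed
qed

section \<open>Euler products\<close>

context
  fixes f :: "nat \<Rightarrow> complex"
  assumes f0: "f 0 = 0" and f1: "f 1 = 1" and fmult: "\<And>a b. f (a * b) = f a * f b"
    and fsum: "summable (\<lambda>n. norm (f n))"
begin

lemma fsum_on: "f summable_on A"
proof -
  have "f summable_on UNIV" by (rule norm_summable_imp_summable_on[OF fsum])
  then show ?thesis by (rule summable_on_subset_banach) simp
qed

lemma muf_summable: "summable (\<lambda>n. norm (of_int (mu n) * f n))"
proof (rule summable_comparison_test'[OF fsum])
  fix n :: nat
  have "norm (of_int (mu n) :: complex) \<le> 1"
    using abs_mu_le[of n] by (simp add: norm_of_int flip: of_int_abs)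
  then have "norm (of_int (mu n) :: complex) * norm (f n) \<le> 1 * norm (f n)"
    by (rule mult_right_mono) simp
  then show "norm (norm (of_int (mu n) * f n)) \<le> norm (f n)" by (simp add: norm_mult)
qed

lemma muf_sum_on: "(\<lambda>n. of_int (mu n) * f n) summable_on A"
proof -
  have "(\<lambda>n. of_int (mu n) * f n) summable_on UNIV" by (rule norm_summable_imp_summable_on[OF muf_summable])
  then show ?thesis by (rule summable_on_subset_banach) simp
qed

lemma coprime_split:
  fixes p r :: nat
  assumes "prime p" "\<not> p dvd r"
  shows "{n. coprime n r} = {n. coprime n (p * r)} \<union> (\<lambda>m. p * m) ` {m. coprime m r}"
    "{n. coprime n (p * r)} \<inter> (\<lambda>m. p * m) ` {m. coprime m r} = {}"
proof -
  have cop: "coprime m p \<longleftrightarrow> \<not> p dvd m" for m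
    using assms(1) prime_imp_coprime[of p m] not_prime_unit[of p] coprime_absorb_left[of p m]
    by (auto simp: coprime_commute[of m p])
  have pr: "coprime p r" using assms by (simp add: prime_imp_coprime)
  show "{n. coprime n r} = {n. coprime n (p * r)} \<union> (\<lambda>m. p * m) ` {m. coprime m r}"
    using pr by (auto simp: cop coprime_mult_left_iff elim!: dvdE)
  show "{n. coprime n (p * r)} \<inter> (\<lambda>m. p * m) ` {m. coprime m r} = {}"
    by (auto simp: cop)
qed

lemma infsum_coprime_step:
  assumes p: "prime p" "\<not> p dvd r"
  shows "(1 - f p) * infsum f {n. coprime n r} = infsum f {n. coprime n (p * r)}"
proof -
  have p0: "p > 0" using p(1) by (simp add: prime_gt_0_nat)
  have "infsum f {n. coprime n r} = infsum f {n. coprime n (p * r)} + infsum f ((\<lambda>m. p * m) ` {m. coprime m r})"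
    using infsum_Un_disjoint[OF fsum_on fsum_on coprime_split(2)[OF p]]
    by (simp only: coprime_split(1)[OF p, symmetric])
  also have "infsum f ((\<lambda>m. p * m) ` {m. coprime m r}) = infsum (f \<circ> (\<lambda>m. p * m)) {m. coprime m r}"
    using p0 by (intro infsum_reindex) (auto simp: inj_on_def)
  also have "\<dots> = infsum (\<lambda>m. f p * f m) {m. coprime m r}"
    by (simp add: o_def fmult)
  also have "\<dots> = f p * infsum f {m. coprime m r}"
    by (rule infsum_cmult_right) (rule fsum_on)
  finally have eq: "infsum f {n. coprime n r} = infsum f {n. coprime n (p * r)} + f p * infsum f {n. coprime n r}" .
  show ?thesis
    by (subst left_diff_distrib, subst mult_1, subst diff_eq_eq, rule eq)
qed

text \<open>Here the multiples of \<open>p\<close> that survive are \<open>p * m\<close> with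
  \<open>m\<close> prime to \<open>p\<close>, because \<open>mu\<close> kills the others; so the
  factor \<open>1 - f p\<close> appears on the opposite side from
  \<open>infsum_coprime_step\<close>.\<close>

lemma infsum_mu_coprime_step:
  assumes p: "prime p" "\<not> p dvd r"
  shows "infsum (\<lambda>n. of_int (mu n) * f n) {n. coprime n r}
    = (1 - f p) * infsum (\<lambda>n. of_int (mu n) * f n) {n. coprime n (p * r)}"
proof -
  let ?g = "\<lambda>n. of_int (mu n) * f n"
  have cop: "coprime m p \<longleftrightarrow> \<not> p dvd m" for m
    using p(1) prime_imp_coprime[of p m] not_prime_unit[of p] coprime_absorb_left[of p m]
    by (auto simp: coprime_commute[of m p])
  have p0: "p > 0" using p(1) by (simp add: prime_gt_0_nat)
  have "infsum ?g {n. coprime n r} = infsum ?g {n. coprime n (p * r)} + infsum ?g ((\<lambda>m. p * m) ` {m. coprime m r})"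
    using infsum_Un_disjoint[OF muf_sum_on muf_sum_on coprime_split(2)[OF p]]
    by (simp only: coprime_split(1)[OF p, symmetric])
  also have "infsum ?g ((\<lambda>m. p * m) ` {m. coprime m r}) = infsum (?g \<circ> (\<lambda>m. p * m)) {m. coprime m r}"
    using p0 by (intro infsum_reindex) (auto simp: inj_on_def)
  also have "\<dots> = infsum (\<lambda>m. - f p * ?g m) {m. coprime m (p * r)}"
    using p(1) by (intro infsum_cong_neutral) (auto simp: cop mu_prime_mult fmult)
  also have "\<dots> = - f p * infsum ?g {m. coprime m (p * r)}"
    by (rule infsum_cmult_right) (rule muf_sum_on)
  finally show ?thesis by (simp add: algebra_simps)
qed

text \<open>Removing one prime multiplies the first sum by \<open>1 - f p\<close> and divides the second by it, so
  their product never changes.\<close>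

lemma infsum_coprime_primes:
  assumes "finite P" "\<And>p. p \<in> P \<Longrightarrow> prime p"
  shows "infsum f {n. coprime n (\<Prod>P)} = (\<Prod>p\<in>P. 1 - f p) * infsum f UNIV
    \<and> infsum f {n. coprime n (\<Prod>P)} * infsum (\<lambda>n. of_int (mu n) * f n) {n. coprime n (\<Prod>P)}
      = infsum f UNIV * infsum (\<lambda>n. of_int (mu n) * f n) UNIV"
  using assms
proof (induction P rule: finite_induct)
  case (insert p P)
  have p: "prime p" using insert by auto
  have ndvd: "\<not> p dvd \<Prod>P"
  proof
    assume "p dvd \<Prod>P"
    then obtain q where "q \<in> P" "p dvd q" using insert.hyps(1) p by (auto simp: prime_dvd_prod_iff)
    then show False using insert primes_dvd_imp_eq[OF p, of q] by auto
  qed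
  note 1 = infsum_coprime_step[OF p ndvd] and 2 = infsum_mu_coprime_step[OF p ndvd]
  have e1: "\<Prod>(insert p P) = p * \<Prod>P" using insert.hyps by simp
  have e2: "(\<Prod>p\<in>insert p P. 1 - f p) = (1 - f p) * (\<Prod>p\<in>P. 1 - f p)" using insert.hyps by simp
  have IH: "infsum f {n. coprime n (\<Prod>P)} = (\<Prod>p\<in>P. 1 - f p) * infsum f UNIV"
    "infsum f {n. coprime n (\<Prod>P)} * infsum (\<lambda>n. of_int (mu n) * f n) {n. coprime n (\<Prod>P)}
      = infsum f UNIV * infsum (\<lambda>n. of_int (mu n) * f n) UNIV"
    using insert.IH insert.prems by auto
  show ?case
    unfolding e1 e2 1[symmetric]
  proof
    show "(1 - f p) * infsum f {n. coprime n (\<Prod>P)} = (1 - f p) * (\<Prod>p\<in>P. 1 - f p) * infsum f UNIV"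
      by (simp only: IH(1) mult.assoc)
    show "(1 - f p) * infsum f {n. coprime n (\<Prod>P)} * infsum (\<lambda>n. of_int (mu n) * f n) {n. coprime n (p * \<Prod>P)}
        = infsum f UNIV * infsum (\<lambda>n. of_int (mu n) * f n) UNIV"
      unfolding IH(2)[symmetric] 2 by (simp only: mult_ac)
  qed
qed simp

text \<open>An \<open>n\<close> other than 1 without prime factors up to \<open>N\<close> exceeds
  \<open>N\<close>, so everything except \<open>g 1\<close> is dominated by a tail of the convergent
  sum of norms.\<close>

lemma infsum_rough_tendsto:
  assumes g1: "g 1 = 1" and g: "\<And>n. norm (g n) \<le> norm (f n)"
  shows "(\<lambda>N. infsum g {n. coprime n (\<Prod>{p. prime p \<and> p \<le> N})}) \<longlonglongrightarrow> (1::complex)"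
proof -
  have gsum: "g summable_on A" for A
  proof -
    have "summable (\<lambda>n. norm (g n))"
      by (rule summable_comparison_test'[OF fsum]) (simp add: g)
    then have "g summable_on UNIV" by (rule norm_summable_imp_summable_on)
    then show ?thesis by (rule summable_on_subset_banach) simp
  qed
  have nsum: "(\<lambda>n. norm (f n)) summable_on A" for A
  proof -
    have "(\<lambda>n. norm (f n)) summable_on UNIV" by (rule norm_summable_imp_summable_on) (use fsum in simp)
    then show ?thesis by (rule summable_on_subset_banach) simp
  qed
  have bound: "norm (infsum g {n. coprime n (\<Prod>{p. prime p \<and> p \<le> N})} - 1) \<le> infsum (\<lambda>n. norm (f n)) {N<..}"
    if N: "N \<ge> 2" for N
  proof -
    define r where "r = \<Prod>{p. prime p \<and> p \<le> N}"
    have dvd: "p dvd r" if "prime p" "p \<le> N" for p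
      unfolding r_def using that by (intro dvd_prodI) auto
    \<comment> \<open>The integer 0 is coprime to \<open>r\<close> only if \<open>r\<close> is 1,
      which \<open>N \<ge> 2\<close> excludes.\<close>
    have "\<not> coprime 0 r" using dvd[of 2] N by auto
    have big: "n > N" if co: "coprime n r" and n1: "n \<noteq> 1" for n
    proof (rule ccontr)
      assume "\<not> n > N"
      obtain p where p: "prime p" "p dvd n" using n1 prime_factor_nat by blast
      have "n > 0" using co \<open>\<not> coprime 0 r\<close> by (cases n) auto
      then have "p \<le> N" using p(2) \<open>\<not> n > N\<close> dvd_imp_le[of p n] by simp
      then have "p dvd r" using dvd p(1) by blast
      then show False using co p not_prime_unit coprime_common_divisor by blast
    qed
    have "{n. coprime n r} = {1} \<union> {n. coprime n r \<and> n \<noteq> 1}" by auto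
    then have "infsum g {n. coprime n r} = infsum g {1} + infsum g {n. coprime n r \<and> n \<noteq> 1}"
      using infsum_Un_disjoint[OF gsum gsum, of "{1}" "{n. coprime n r \<and> n \<noteq> 1}"] by simp
    then have "norm (infsum g {n. coprime n r} - 1) = norm (infsum g {n. coprime n r \<and> n \<noteq> 1})"
      using g1 by simp
    also have "\<dots> \<le> infsum (\<lambda>n. norm (f n)) {n. coprime n r \<and> n \<noteq> 1}"
      by (rule norm_infsum_le) (auto intro!: has_sum_infsum gsum nsum g)
    also have "\<dots> \<le> infsum (\<lambda>n. norm (f n)) {N<..}"
      by (rule infsum_mono2) (auto intro!: nsum big)
    finally show ?thesis by (simp add: r_def)
  qed
  have tail: "(\<lambda>N. infsum (\<lambda>n. norm (f n)) {N<..}) \<longlonglongrightarrow> 0"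
  proof -
    have eq: "infsum (\<lambda>n. norm (f n)) {N<..} = infsum (\<lambda>n. norm (f n)) UNIV - (\<Sum>n<Suc N. norm (f n))" for N
    proof -
      have "(UNIV :: nat set) = {..<Suc N} \<union> {N<..}" by auto
      then have "infsum (\<lambda>n. norm (f n)) UNIV = infsum (\<lambda>n. norm (f n)) {..<Suc N} + infsum (\<lambda>n. norm (f n)) {N<..}"
        using infsum_Un_disjoint[OF nsum nsum, of "{..<Suc N}" "{N<..}"] by (simp only:) force
      then show ?thesis by simp
    qed
    have "(\<lambda>n. norm (f n)) sums infsum (\<lambda>n. norm (f n)) UNIV"
      by (rule has_sum_imp_sums) (rule has_sum_infsum[OF nsum])
    then have "(\<lambda>N. \<Sum>n<N. norm (f n)) \<longlonglongrightarrow> infsum (\<lambda>n. norm (f n)) UNIV" by (simp add: sums_def)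
    then have lim: "(\<lambda>N. \<Sum>n<Suc N. norm (f n)) \<longlonglongrightarrow> infsum (\<lambda>n. norm (f n)) UNIV" by (rule LIMSEQ_Suc)
    have "(\<lambda>N. infsum (\<lambda>n. norm (f n)) UNIV - (\<Sum>n<Suc N. norm (f n))) \<longlonglongrightarrow> 0"
      using tendsto_diff[OF tendsto_const[of "infsum (\<lambda>n. norm (f n)) UNIV"] lim] by (simp only: diff_self)
    then show ?thesis by (simp only: eq)
  qed
  have "(\<lambda>N. infsum g {n. coprime n (\<Prod>{p. prime p \<and> p \<le> N})} - 1) \<longlonglongrightarrow> 0"
    by (rule Lim_null_comparison[OF _ tail]) (use bound in \<open>auto intro!: eventually_sequentiallyI[of 2]\<close>)
  then show ?thesis by (simp only: LIM_zero_iff)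
qed

text \<open>The product of the two sums restricted to integers without prime factors up to
  \<open>N\<close> is the same for all \<open>N\<close>, and both factors tend to 1.\<close>

lemma infsum_mult_infsum_mu: "infsum f UNIV * infsum (\<lambda>n. of_int (mu n) * f n) UNIV = 1"
proof -
  let ?A = "\<lambda>N. {n. coprime n (\<Prod>{p. prime p \<and> p \<le> N})}"
  have "norm (of_int (mu n) * f n) \<le> norm (f n)" for n
  proof -
    have "norm (of_int (mu n) :: complex) \<le> 1"
      using abs_mu_le[of n] by (simp add: norm_of_int flip: of_int_abs)
    then have "norm (of_int (mu n) :: complex) * norm (f n) \<le> 1 * norm (f n)"
      by (rule mult_right_mono) simp
    then show ?thesis by (simp add: norm_mult)
  qed
  then have "(\<lambda>N. infsum (\<lambda>n. of_int (mu n) * f n) (?A N)) \<longlonglongrightarrow> 1"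
    using f1 by (intro infsum_rough_tendsto) auto
  moreover have "(\<lambda>N. infsum f (?A N)) \<longlonglongrightarrow> 1"
    using f1 by (intro infsum_rough_tendsto) auto
  ultimately have "(\<lambda>N. infsum f (?A N) * infsum (\<lambda>n. of_int (mu n) * f n) (?A N)) \<longlonglongrightarrow> 1 * 1"
    by (intro tendsto_mult)
  moreover have "infsum f (?A N) * infsum (\<lambda>n. of_int (mu n) * f n) (?A N)
      = infsum f UNIV * infsum (\<lambda>n. of_int (mu n) * f n) UNIV" for N :: nat
    by (rule infsum_coprime_primes[THEN conjunct2]) auto
  ultimately show ?thesis
    using LIMSEQ_unique[OF tendsto_const] by simp
qed

lemma euler_product_tendsto:
  "(\<lambda>N. (\<Prod>p | prime p \<and> p \<le> N. 1 - f p) * infsum f UNIV) \<longlonglongrightarrow> 1"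
proof -
  have "(\<lambda>N. infsum f {n. coprime n (\<Prod>{p. prime p \<and> p \<le> N})}) \<longlonglongrightarrow> 1"
    using f1 by (intro infsum_rough_tendsto) auto
  moreover have "infsum f {n. coprime n (\<Prod>{p. prime p \<and> p \<le> N})} = (\<Prod>p | prime p \<and> p \<le> N. 1 - f p) * infsum f UNIV" for N :: nat
    by (rule infsum_coprime_primes[THEN conjunct1]) auto
  ultimately show ?thesis by simp
qed

end

text \<open>Taking logarithms and expanding in powers, the n-th term is -a^n/n times 3 + 4c + (2c^2
  - 1) = 2(1 + c)^2 with c = Re(w^n). The term with n = 0 is 0 by division by zero.\<close>

lemma three_four_one:
  fixes a :: real and w :: complex
  assumes a: "0 < a" "a < 1" and w: "norm w = 1"
  shows "norm (1 - of_real a :: complex) ^ 3 * norm (1 - of_real a * w) ^ 4 * norm (1 - of_real a * w\<^sup>2) \<le> (1::real)"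
proof -
  have sm: "(\<lambda>n. - Re (z ^ n) / real n) sums ln (norm (1 - z))" if "norm z < 1" for z :: complex
  proof -
    have "1 - z \<noteq> 0" using that by auto
    have "(\<lambda>n. - ((- (- z)) ^ n) / of_nat n) sums ln (1 + (- z))"
      using that by (intro Ln_series') simp
    then have "(\<lambda>n. Re (- ((- (- z)) ^ n) / of_nat n)) sums Re (ln (1 + (- z)))"
      by (rule sums_Re)
    then show ?thesis
      using \<open>1 - z \<noteq> 0\<close> by (simp add: Re_divide_of_nat)
  qed
  have n1: "norm (of_real a :: complex) < 1" and n2: "norm (of_real a * w) < 1" and n3: "norm (of_real a * w\<^sup>2) < 1"
    using a w by (auto simp: norm_mult norm_power)
  have "(\<lambda>n. 3 * (- Re (of_real a ^ n) / real n) + 4 * (- Re ((of_real a * w) ^ n) / real n)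
      + (- Re ((of_real a * w\<^sup>2) ^ n) / real n))
    sums (3 * ln (norm (1 - of_real a :: complex)) + 4 * ln (norm (1 - of_real a * w)) + ln (norm (1 - of_real a * w\<^sup>2)))"
    by (intro sums_add sums_mult sm n1 n2 n3)
  then have "3 * ln (norm (1 - of_real a :: complex)) + 4 * ln (norm (1 - of_real a * w)) + ln (norm (1 - of_real a * w\<^sup>2)) \<le> 0"
  proof (rule sums_le[OF _ _ sums_zero, rotated])
    fix n :: nat
    define c where "c = Re (w ^ n)"
    have "(cmod (w ^ n))\<^sup>2 = 1" using w by (simp add: norm_power)
    then have "(Im (w ^ n))\<^sup>2 = 1 - c\<^sup>2" by (simp add: cmod_power2 c_def)
    moreover have "(w\<^sup>2) ^ n = (w ^ n)\<^sup>2"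
      by (simp only: power_mult[symmetric] mult.commute)
    ultimately have c2: "Re ((w\<^sup>2) ^ n) = 2 * c\<^sup>2 - 1"
      by (simp add: Re_power2 c_def)
    have pw: "Re ((of_real a * z) ^ n) = a ^ n * Re (z ^ n)" for z :: complex
      by (simp add: power_mult_distrib flip: of_real_power)
    have "Re (of_real a ^ n :: complex) = a ^ n" by (simp flip: of_real_power)
    then have "3 * (- Re (of_real a ^ n) / real n) + 4 * (- Re ((of_real a * w) ^ n) / real n)
      + (- Re ((of_real a * w\<^sup>2) ^ n) / real n) = - (a ^ n * (2 * (1 + c)\<^sup>2)) / real n"
      unfolding pw c2 c_def[symmetric] by (simp add: power2_eq_square add_divide_distrib diff_divide_distrib algebra_simps)
    also have "\<dots> \<le> 0" using a by (simp add: divide_nonpos_nonneg)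
    finally show "3 * (- Re (of_real a ^ n) / real n) + 4 * (- Re ((of_real a * w) ^ n) / real n)
      + (- Re ((of_real a * w\<^sup>2) ^ n) / real n) \<le> 0" .
  qed
  moreover have pos: "norm (1 - z) > 0" if "norm z < 1" for z :: complex
    using that by auto
  moreover have "ln (norm (1 - of_real a :: complex) ^ 3 * norm (1 - of_real a * w) ^ 4 * norm (1 - of_real a * w\<^sup>2))
     = 3 * ln (norm (1 - of_real a :: complex)) + 4 * ln (norm (1 - of_real a * w)) + ln (norm (1 - of_real a * w\<^sup>2))"
    using pos[OF n1] pos[OF n2] pos[OF n3] by (simp add: ln_mult ln_realpow)
  ultimately have "ln (norm (1 - of_real a :: complex) ^ 3 * norm (1 - of_real a * w) ^ 4 * norm (1 - of_real a * w\<^sup>2)) \<le> 0"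
    by simp
  then show ?thesis
    using pos[OF n1] pos[OF n2] pos[OF n3] by (subst (asm) ln_le_zero_iff) auto
qed

section \<open>The zeta function near the line of absolute convergence\<close>

text \<open>\<open>szeta s\<close> is the entire continuation of \<open>s \<zeta>(1 + s)\<close>, needed here for \<open>Re s > -1/2\<close>. The term
  with \<open>n = 0\<close> equals 1 because \<open>0 powr z = 0\<close>.\<close>

definition szeta_term :: "nat \<Rightarrow> complex \<Rightarrow> complex" where
  "szeta_term n s = s * of_nat n powr (-1 - s) - of_nat n powr (- s) + of_nat (Suc n) powr (- s)"

definition szeta :: "complex \<Rightarrow> complex" where
  "szeta s = (\<Sum>n. szeta_term n s)"

lemma szeta_term_0: "szeta_term 0 s = 1"
  by (simp add: szeta_term_def)

lemma norm_nat_powr: "n > 0 \<Longrightarrow> norm (of_nat n powr s :: complex) = real n powr Re s"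
  by (subst norm_powr_real_powr) auto

text \<open>The term is f(n+1) - f(n) - f'(n) for f(x) = x^(-s). The first estimate uses f'' on the
  segment from n to n + 1; the second treats f(n+1) - f(n) and f'(n) separately, each bounded
  through f'.\<close>

lemma szeta_term_bounds:
  assumes n: "n > 0" and s: "Re s \<ge> -1"
  shows "norm (szeta_term n s) \<le> norm s * norm (1 + s) * real n powr (-2 - Re s)"
    and "norm (szeta_term n s) \<le> 2 * norm s * real n powr (-1 - Re s)"
proof -
  define S where "S = closed_segment (of_nat n :: complex) (of_nat (Suc n))"
  have S: "Im z = 0" "Re z \<ge> real n" if "z \<in> S" for z
  proof -
    have "\<exists>u. z = (1 - u) *\<^sub>R of_nat n + u *\<^sub>R of_nat (Suc n) \<and> 0 \<le> u \<and> u \<le> 1"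
      using that unfolding S_def closed_segment_def mem_Collect_eq .
    then obtain u where u: "0 \<le> u" "z = (1 - u) *\<^sub>R of_nat n + u *\<^sub>R of_nat (Suc n)"
      by metis
    show "Im z = 0" unfolding u(2) by simp
    have "Re z = real n + u" unfolding u(2) by (simp add: algebra_simps)
    then show "Re z \<ge> real n" using u(1) by simp
  qed
  define f where "f i z = (if i = 0 then z powr (- s) else if i = 1 then - s * z powr (- s - 1)
      else s * (s + 1) * z powr (- s - 2))" for i :: nat and z :: complex
  have nonneg: "z \<notin> \<real>\<^sub>\<le>\<^sub>0" if "z \<in> S" for z
    using S[OF that] n by (auto simp: complex_nonpos_Reals_iff)
  have d0: "(f 0 has_field_derivative f 1 z) (at z within S)" if "z \<in> S" for z
  proof -
    have "((\<lambda>z. z powr (- s)) has_field_derivative - s * z powr (- s - 1)) (at z)"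
      using nonneg[OF that] by (intro has_field_derivative_powr)
    then show ?thesis
      unfolding f_def by (auto intro: has_field_derivative_at_within)
  qed
  have d1: "(f 1 has_field_derivative f 2 z) (at z within S)" if "z \<in> S" for z
  proof -
    have "((\<lambda>z. - s * z powr (- s - 1)) has_field_derivative - s * ((- s - 1) * z powr (- s - 1 - 1))) (at z)"
      using nonneg[OF that] by (intro DERIV_cmult has_field_derivative_powr)
    moreover have "- s * ((- s - 1) * z powr (- s - 1 - 1)) = f 2 z"
      by (simp add: f_def algebra_simps)
    ultimately show ?thesis
      unfolding f_def by (auto intro: has_field_derivative_at_within)
  qed
  have ends: "of_nat n \<in> S" "of_nat (Suc n) \<in> S" by (auto simp: S_def)
  have nm: "norm (z powr w) = Re z powr Re w" if "z \<in> S" for z w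
    using S[OF that] n by (intro norm_powr_real_powr) (auto simp: complex_is_Real_iff)
  have mono: "norm (z powr w) \<le> real n powr Re w" if "z \<in> S" "Re w \<le> 0" for z w
    unfolding nm[OF that(1)] using S[OF that(1)] n that(2) by (intro powr_mono2') auto
  have ztf: "szeta_term n s = f 0 (of_nat (Suc n)) - f 0 (of_nat n) - f 1 (of_nat n)"
  proof -
    have eq: "-1 - s = - s - 1" by simp
    show ?thesis unfolding szeta_term_def eq f_def by simp
  qed
  have "norm (f 0 (of_nat (Suc n)) - (\<Sum>i\<le>1. f i (of_nat n) * (of_nat (Suc n) - of_nat n) ^ i / fact i))
    \<le> (norm s * norm (1 + s) * real n powr (-2 - Re s)) * norm (of_nat (Suc n) - of_nat n :: complex) ^ Suc 1 / fact 1"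
  proof (rule complex_Taylor[of S])
    show "convex S" by (simp add: S_def)
    show "(f i has_field_derivative f (Suc i) z) (at z within S)" if "z \<in> S" "i \<le> 1" for i z
      using d0[OF that(1)] d1[OF that(1)] that(2) by (cases i) (auto simp: numeral_2_eq_2)
    show "cmod (f (Suc 1) z) \<le> norm s * norm (1 + s) * real n powr (-2 - Re s)" if "z \<in> S" for z
    proof -
      have "norm (z powr (- s - 2)) \<le> real n powr Re (- s - 2)"
        using that s by (intro mono) auto
      also have "Re (- s - 2) = -2 - Re s" by simp
      finally have "norm (s * (s + 1)) * norm (z powr (- s - 2)) \<le> norm (s * (s + 1)) * real n powr (-2 - Re s)"
        by (intro mult_left_mono) auto
      then show ?thesis by (simp add: f_def norm_mult add.commute)
    qed
  qed (use ends in auto)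
  then show "norm (szeta_term n s) \<le> norm s * norm (1 + s) * real n powr (-2 - Re s)"
    by (simp add: ztf diff_diff_eq)
  have f1: "cmod (f 1 z) \<le> norm s * real n powr (-1 - Re s)" if "z \<in> S" for z
  proof -
    have "norm (z powr (- s - 1)) \<le> real n powr Re (- s - 1)"
      using that s by (intro mono) auto
    also have "Re (- s - 1) = -1 - Re s" by simp
    finally have "norm s * norm (z powr (- s - 1)) \<le> norm s * real n powr (-1 - Re s)"
      by (intro mult_left_mono) auto
    then show ?thesis by (simp add: f_def norm_mult)
  qed
  have "norm (f 0 (of_nat (Suc n)) - (\<Sum>i\<le>0. f i (of_nat n) * (of_nat (Suc n) - of_nat n) ^ i / fact i))
    \<le> (norm s * real n powr (-1 - Re s)) * norm (of_nat (Suc n) - of_nat n :: complex) ^ Suc 0 / fact 0"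
  proof (rule complex_Taylor[of S])
    show "convex S" by (simp add: S_def)
    show "(f i has_field_derivative f (Suc i) z) (at z within S)" if "z \<in> S" "i \<le> 0" for i z
      using d0[OF that(1)] that(2) by simp
    show "cmod (f (Suc 0) z) \<le> norm s * real n powr (-1 - Re s)" if "z \<in> S" for z
      using f1[OF that] by simp
  qed (use ends in auto)
  then have "norm (f 0 (of_nat (Suc n)) - f 0 (of_nat n)) \<le> norm s * real n powr (-1 - Re s)"
    by simp
  then show "norm (szeta_term n s) \<le> 2 * norm s * real n powr (-1 - Re s)"
    using f1[OF ends(1)] norm_triangle_ineq4[of "f 0 (of_nat (Suc n)) - f 0 (of_nat n)" "f 1 (of_nat n)"]
    unfolding ztf by linarith
qed

text \<open>The two bounds of \<open>szeta_term_bounds\<close> are \<open>B * q\<close> and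
  \<open>B\<close>, so \<open>B * q powr \<theta>\<close> holds as well. A small
  \<open>\<theta>\<close> gives slow growth in the height, at the price of a narrower strip;
  \<open>Re s \<ge> - \<theta> / 2\<close> keeps the exponent of \<open>n\<close> below -1.\<close>

lemma szeta_term_interpolated_bound:
  assumes n: "n > 0" and \<theta>: "0 \<le> \<theta>" "\<theta> \<le> 1" and s: "Re s \<ge> - \<theta> / 2"
  shows "norm (szeta_term n s) \<le> 2 * norm s * norm (1 + s) powr \<theta> * real n powr (-1 - \<theta> / 2)"
proof -
  have s1: "Re s \<ge> -1" using s \<theta> by simp
  define B where "B = 2 * norm s * real n powr (-1 - Re s)"
  define q where "q = norm (1 + s) / real n"
  have B: "B \<ge> 0" by (simp add: B_def)
  have q: "q \<ge> 0" by (simp add: q_def)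
  have "norm (szeta_term n s) \<le> norm s * norm (1 + s) * real n powr (-2 - Re s)"
    by (rule szeta_term_bounds[OF n s1])
  also have "real n powr (-2 - Re s) = real n powr (-1 - Re s) / real n"
  proof -
    have "real n powr (-2 - Re s) = real n powr ((-1 - Re s) - 1)" by simp
    also have "\<dots> = real n powr (-1 - Re s) / real n powr 1" by (rule powr_diff)
    finally show ?thesis using n by simp
  qed
  also have "norm s * norm (1 + s) * (real n powr (-1 - Re s) / real n) \<le> B * q"
  proof -
    have "0 \<le> norm s * norm (1 + s) * (real n powr (-1 - Re s) / real n)" by simp
    moreover have "B * q = 2 * (norm s * norm (1 + s) * (real n powr (-1 - Re s) / real n))"
      unfolding B_def q_def by simp
    ultimately show ?thesis by linarith
  qed
  finally have 1: "norm (szeta_term n s) \<le> B * q" .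
  have 2: "norm (szeta_term n s) \<le> B" unfolding B_def by (rule szeta_term_bounds[OF n s1])
  have "norm (szeta_term n s) \<le> B * q powr \<theta>"
  proof (cases "q \<le> 1")
    case True
    have "q \<le> q powr \<theta>"
    proof (cases "q = 0")
      case False
      then show ?thesis using powr_mono'[of \<theta> 1 q] True q \<theta> by simp
    qed simp
    then show ?thesis using 1 B by (meson mult_left_mono order_trans)
  next
    case False
    then have "1 \<le> q powr \<theta>" using \<theta> by (intro ge_one_powr_ge_zero) auto
    then have "B * 1 \<le> B * q powr \<theta>" using B by (intro mult_left_mono)
    then show ?thesis using 2 by simp
  qed
  also have "B * q powr \<theta> = 2 * norm s * norm (1 + s) powr \<theta> * real n powr (-1 - Re s - \<theta>)"
    using n unfolding B_def q_def by (simp add: powr_divide powr_diff)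
  also have "\<dots> \<le> 2 * norm s * norm (1 + s) powr \<theta> * real n powr (-1 - \<theta> / 2)"
    using n s by (intro mult_left_mono powr_mono) auto
  finally show ?thesis .
qed

lemma szeta_term_holomorphic: "szeta_term n holomorphic_on A"
proof (cases "n = 0")
  case True
  then have "szeta_term n = (\<lambda>_. 1)" by (auto simp: szeta_term_0)
  then show ?thesis by simp
next
  case False
  then have "szeta_term n = (\<lambda>s. s * exp ((-1 - s) * Ln (of_nat n)) - exp (- s * Ln (of_nat n)) + exp (- s * Ln (of_nat (Suc n))))"
    by (intro ext) (simp add: szeta_term_def powr_def del: of_nat_Suc)
  then show ?thesis by (auto intro!: holomorphic_intros)
qed

lemma summable_nat_powr: "a < -1 \<Longrightarrow> summable (\<lambda>n. real n powr a)"
  by (simp add: summable_real_powr_iff)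

lemma szeta_summable:
  assumes "Re s > -1/2"
  shows "summable (\<lambda>n. norm (szeta_term n s))"
proof (rule summable_comparison_test'[where N = 1])
  show "summable (\<lambda>n. 2 * norm s * norm (1 + s) powr 1 * real n powr (-1 - 1 / 2))"
    by (intro summable_mult summable_nat_powr) simp
  show "norm (norm (szeta_term n s)) \<le> 2 * norm s * norm (1 + s) powr 1 * real n powr (-1 - 1 / 2)" if "n \<ge> 1" for n
    using szeta_term_interpolated_bound[of n 1 s] assms that by simp
qed

lemma open_Re_gt_half: "open {s. Re s > -1/2}"
  by (intro open_halfspace_Re_gt)

lemma szeta_holomorphic: "szeta holomorphic_on {s. Re s > -1/2}"
proof (rule holomorphic_uniform_sequence[OF open_Re_gt_half, where f = "\<lambda>N s. \<Sum>n<N. szeta_term n s"])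
  show "(\<lambda>s. \<Sum>n<N. szeta_term n s) holomorphic_on {s. Re s > -1/2}" for N
    by (intro holomorphic_intros szeta_term_holomorphic)
  fix x :: complex assume "x \<in> {s. Re s > -1/2}"
  then obtain d where d: "d > 0" "cball x d \<subseteq> {s. Re s > -1/2}"
    using open_Re_gt_half unfolding open_contains_cball by blast
  define R where "R = norm x + d"
  have R: "norm s \<le> R" if "s \<in> cball x d" for s
    using that norm_triangle_sub[of s x] by (auto simp: R_def dist_norm norm_minus_commute)
  have R0: "R \<ge> 0" using d(1) by (simp add: R_def)
  define Mn where "Mn n = (if n = 0 then 1 else 0) + 2 * R * (1 + R) * real n powr (-1 - 1/2)" for n :: nat
  have "uniform_limit (cball x d) (\<lambda>N s. \<Sum>n<N. szeta_term n s) (\<lambda>s. suminf (\<lambda>n. szeta_term n s)) sequentially"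
  proof (rule Weierstrass_m_test)
    show "summable Mn"
      unfolding Mn_def by (intro summable_add summable_mult summable_nat_powr summable_single) simp
    fix n s assume s: "s \<in> cball x d"
    show "norm (szeta_term n s) \<le> Mn n"
    proof (cases "n = 0")
      case False
      have "Re s > -1/2" using s d(2) by auto
      then have "norm (szeta_term n s) \<le> 2 * norm s * norm (1 + s) powr 1 * real n powr (-1 - 1 / 2)"
        using False by (intro szeta_term_interpolated_bound) auto
      also have "\<dots> \<le> 2 * R * (1 + R) * real n powr (-1 - 1 / 2)"
      proof (intro mult_right_mono mult_mono)
        have "norm (1 + s) \<le> 1 + norm s" using norm_triangle_ineq[of 1 s] by simp
        then show "norm (1 + s) powr 1 \<le> 1 + R" using R[OF s] by simp
      qed (use R[OF s] R0 in auto)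
      finally show ?thesis using False by (simp add: Mn_def)
    qed (simp add: szeta_term_0 Mn_def)
  qed
  then show "\<exists>d>0. cball x d \<subseteq> {s. Re s > -1/2} \<and> uniform_limit (cball x d) (\<lambda>N s. \<Sum>n<N. szeta_term n s) szeta sequentially"
    using d unfolding szeta_def[abs_def] by blast
qed

lemma szeta_bound:
  assumes "0 < \<theta>" "\<theta> < 1"
  obtains K where "K \<ge> 0" "\<And>s. Re s \<ge> - \<theta> / 2 \<Longrightarrow> norm (szeta s) \<le> 1 + K * norm s * norm (1 + s) powr \<theta>"
proof (rule that)
  define k where "k = (\<Sum>n. real n powr (-1 - \<theta> / 2))"
  have sk: "summable (\<lambda>n. real n powr (-1 - \<theta> / 2))" using assms by (intro summable_nat_powr) simp
  have "k \<ge> 0" unfolding k_def by (intro suminf_nonneg sk) simp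
  then show "2 * k \<ge> 0" by simp
  fix s :: complex assume s: "Re s \<ge> - \<theta> / 2"
  then have s': "Re s > -1/2" using assms by simp
  let ?c = "2 * norm s * norm (1 + s) powr \<theta>"
  let ?b = "\<lambda>n. (if n = 0 then 1 else 0) + ?c * real n powr (-1 - \<theta> / 2)"
  have bs: "?b sums (1 + ?c * k)"
    unfolding k_def by (intro sums_add sums_mult summable_sums sk sums_single)
  have "norm (szeta s) \<le> (\<Sum>n. norm (szeta_term n s))"
    unfolding szeta_def by (rule summable_norm) (rule szeta_summable[OF s'])
  also have "\<dots> \<le> (\<Sum>n. ?b n)"
  proof (rule suminf_le[OF _ szeta_summable[OF s']])
    show "norm (szeta_term n s) \<le> ?b n" for n
      using szeta_term_interpolated_bound[of n \<theta> s] assms s by (cases "n = 0") (auto simp: szeta_term_0)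
    show "summable ?b" using bs by (rule sums_summable)
  qed
  also have "\<dots> = 1 + ?c * k" using bs by (simp add: sums_iff)
  finally show "norm (szeta s) \<le> 1 + 2 * k * norm s * norm (1 + s) powr \<theta>" by (simp add: mult_ac)
qed

section \<open>Dirichlet series on the half-plane of absolute convergence\<close>

definition dirichlet_term :: "complex \<Rightarrow> nat \<Rightarrow> complex" where
  "dirichlet_term s n = of_nat n powr (-1 - s)"

text \<open>This is zeta(1 + s); the shift puts the boundary of absolute convergence on the
  imaginary axis.\<close>

definition zeta_shift :: "complex \<Rightarrow> complex" where
  "zeta_shift s = infsum (dirichlet_term s) UNIV"

definition moebius_series :: "complex \<Rightarrow> complex" where
  "moebius_series s = infsum (\<lambda>n. of_int (mu n) * dirichlet_term s n) UNIV"

lemma dirichlet_term_facts: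
  shows "dirichlet_term s 0 = 0" "dirichlet_term s 1 = 1" "dirichlet_term s (Suc 0) = 1" "dirichlet_term s (a * b) = dirichlet_term s a * dirichlet_term s b"
  by (auto simp: dirichlet_term_def powr_times_real)

lemma norm_dz: "norm (dirichlet_term s n) = real n powr (-1 - Re s)"
  by (cases "n = 0") (auto simp: dirichlet_term_def norm_nat_powr)

lemma dirichlet_term_summable: "Re s > 0 \<Longrightarrow> summable (\<lambda>n. norm (dirichlet_term s n))"
  unfolding norm_dz by (intro summable_nat_powr) simp

lemma zeta_shift_Mob: "Re s > 0 \<Longrightarrow> zeta_shift s * moebius_series s = 1"
  unfolding zeta_shift_def moebius_series_def by (rule infsum_mult_infsum_mu) (auto simp: dirichlet_term_facts dirichlet_term_summable)

lemma zeta_shift_euler: "Re s > 0 \<Longrightarrow> (\<lambda>N. (\<Prod>p | prime p \<and> p \<le> N. 1 - dirichlet_term s p) * zeta_shift s) \<longlonglongrightarrow> 1"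
  unfolding zeta_shift_def by (rule euler_product_tendsto) (auto simp: dirichlet_term_facts dirichlet_term_summable)

text \<open>The differences of \<open>n powr (- s)\<close> telescope to
  \<open>0 - 0 powr (- s)\<close>, which is 0, leaving only s times the Dirichlet series.\<close>

lemma szeta_eq_zeta1:
  assumes s: "Re s > 0"
  shows "szeta s = s * zeta_shift s"
proof -
  have "dirichlet_term s summable_on UNIV" using norm_summable_imp_summable_on[OF dirichlet_term_summable[OF s]] .
  then have "dirichlet_term s sums zeta_shift s"
    unfolding zeta_shift_def by (intro has_sum_imp_sums has_sum_infsum)
  moreover have "(\<lambda>n. of_nat (Suc n) powr (- s) - of_nat n powr (- s)) sums (0 - of_nat 0 powr (- s))"
  proof (rule telescope_sums, rule tendsto_norm_zero_cancel)
    have "(\<lambda>n. real n powr (- Re s)) \<longlonglongrightarrow> 0"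
      using s by (intro tendsto_neg_powr filterlim_real_sequentially) auto
    then show "(\<lambda>n. norm (of_nat n powr (- s) :: complex)) \<longlonglongrightarrow> 0"
      by (rule Lim_transform_eventually) (auto intro!: eventually_sequentiallyI[of 1] simp: norm_nat_powr)
  qed
  ultimately have "(\<lambda>n. s * dirichlet_term s n + (of_nat (Suc n) powr (- s) - of_nat n powr (- s))) sums (s * zeta_shift s + 0)"
    by (intro sums_add sums_mult) auto
  then have "(\<lambda>n. szeta_term n s) sums (s * zeta_shift s)"
    by (simp add: szeta_term_def dirichlet_term_def algebra_simps)
  then show ?thesis by (simp add: szeta_def sums_iff)
qed

text \<open>\<open>three_four_one\<close> applied to every Euler factor gives
  \<open>?Q N \<le> 1\<close> for the partial products, while \<open>?Q N * ?X\<close> tends to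
  1.\<close>

lemma zeta_shift_three_four_one:
  assumes c: "c > 0"
  shows "1 \<le> norm (zeta_shift (of_real c)) ^ 3 * norm (zeta_shift (Complex c t)) ^ 4 * norm (zeta_shift (Complex c (2 * t)))"
proof -
  let ?P = "\<lambda>N s. (\<Prod>p | prime p \<and> p \<le> N. 1 - dirichlet_term s p)"
  let ?X = "norm (zeta_shift (of_real c)) ^ 3 * norm (zeta_shift (Complex c t)) ^ 4 * norm (zeta_shift (Complex c (2 * t)))"
  let ?Q = "\<lambda>N. norm (?P N (of_real c)) ^ 3 * norm (?P N (Complex c t)) ^ 4 * norm (?P N (Complex c (2 * t)))"
  have "(\<lambda>N. norm (?P N (of_real c) * zeta_shift (of_real c)) ^ 3 * norm (?P N (Complex c t) * zeta_shift (Complex c t)) ^ 4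
      * norm (?P N (Complex c (2 * t)) * zeta_shift (Complex c (2 * t)))) \<longlonglongrightarrow> norm (1::complex) ^ 3 * norm (1::complex) ^ 4 * norm (1::complex)"
    using c by (intro tendsto_mult tendsto_power tendsto_norm zeta_shift_euler) auto
  then have "(\<lambda>N. ?Q N * ?X) \<longlonglongrightarrow> 1"
    by (simp add: norm_mult power_mult_distrib mult_ac)
  then show ?thesis
  proof (rule LIMSEQ_le_const2, intro exI allI impI)
    fix N :: nat
    have "?Q N = (\<Prod>p | prime p \<and> p \<le> N. norm (1 - dirichlet_term (of_real c) p) ^ 3 * norm (1 - dirichlet_term (Complex c t) p) ^ 4
        * norm (1 - dirichlet_term (Complex c (2 * t)) p))"
      by (simp only: prod_norm[symmetric] prod_power_distrib prod.distrib)
    also have "\<dots> \<le> 1"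
    proof (intro prod_le_1 conjI)
      fix p assume "p \<in> {p. prime p \<and> p \<le> N}"
      then have p: "real p > 1" using prime_gt_1_nat by auto
      define a where "a = real p powr (-1 - c)"
      define w where "w = (of_nat p powr (- (\<i> * of_real t)) :: complex)"
      have a: "0 < a" "a < 1"
        using p c powr_less_mono[of "-1 - c" 0 "real p"] by (auto simp: a_def)
      have w: "norm w = 1" unfolding w_def using p by (subst norm_nat_powr) auto
      have pc: "of_nat p powr (z + z') = (of_nat p powr z * of_nat p powr z' :: complex)" for z z'
        by (rule powr_add)
      have d1: "dirichlet_term (of_real c) p = of_real a"
        unfolding dirichlet_term_def a_def using p powr_of_real[of "real p" "-1 - c"] by simp
      have "dirichlet_term (Complex c t) p = of_nat p powr ((-1 - of_real c) + (- (\<i> * of_real t)))"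
        unfolding dirichlet_term_def by (simp add: Complex_eq algebra_simps)
      then have d2: "dirichlet_term (Complex c t) p = of_real a * w"
        unfolding pc using d1 by (simp add: w_def dirichlet_term_def)
      have "dirichlet_term (Complex c (2 * t)) p = of_nat p powr (((-1 - of_real c) + (- (\<i> * of_real t))) + (- (\<i> * of_real t)))"
        unfolding dirichlet_term_def by (simp add: Complex_eq algebra_simps)
      then have d3: "dirichlet_term (Complex c (2 * t)) p = of_real a * w\<^sup>2"
        unfolding pc using d1 by (simp add: w_def dirichlet_term_def power2_eq_square)
      show "norm (1 - dirichlet_term (of_real c) p) ^ 3 * norm (1 - dirichlet_term (Complex c t) p) ^ 4 * norm (1 - dirichlet_term (Complex c (2 * t)) p) \<le> 1"
        unfolding d1 d2 d3 by (rule three_four_one[OF a w])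
    qed simp
    finally have "?Q N * ?X \<le> 1 * ?X" by (intro mult_right_mono) auto
    then show "?Q N * ?X \<le> ?X" by simp
  qed
qed

section \<open>Upper, Lipschitz and lower bounds for zeta(1 + s) near the imaginary axis\<close>

definition zeta_cont :: "complex \<Rightarrow> complex" where
  "zeta_cont s = szeta s / s"

abbreviation height :: "complex \<Rightarrow> real" where
  "height s \<equiv> 2 + \<bar>Im s\<bar>"

lemma powr_double_le: "x \<ge> 0 \<Longrightarrow> 0 \<le> e \<Longrightarrow> e \<le> 1 \<Longrightarrow> (2 * x) powr e \<le> 2 * x powr (e::real)"
proof -
  assume "x \<ge> 0" "0 \<le> e" "e \<le> 1"
  moreover have "2 powr e \<le> (2::real) powr 1" using \<open>e \<le> 1\<close> by (intro powr_mono) auto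
  ultimately show ?thesis by (simp add: powr_mult mult_right_mono)
qed

lemma zeta_cont_eq_zeta1: "Re s > 0 \<Longrightarrow> zeta_cont s = zeta_shift s"
  by (auto simp: zeta_cont_def szeta_eq_zeta1)

lemma zeta_cont_holomorphic: "zeta_cont holomorphic_on ({s. Re s > -1/2} - {0})"
  unfolding zeta_cont_def[abs_def]
  by (intro holomorphic_on_divide holomorphic_on_subset[OF szeta_holomorphic] holomorphic_on_ident) auto

text \<open>All losses in the height \<open>T\<close> are powers of \<open>T\<^bsup>1/28\<^esup>\<close>; the second derivative of \<open>1/(s\<^sup>2 \<zeta>(1+s))\<close>
  loses 14 of them, which leaves the integrable bound \<open>T\<^bsup>-3/2\<^esup>\<close>.\<close>

lemma zeta_cont_upper:
  assumes \<delta>: "0 < \<delta>"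
  obtains K where "K > 0" "\<And>s. Re s \<ge> -1/56 \<Longrightarrow> Re s \<le> 2 \<Longrightarrow> norm s \<ge> \<delta> \<Longrightarrow> norm (zeta_cont s) \<le> K * height s powr (1/28)"
proof -
  obtain K where K: "K \<ge> 0" "\<And>s. Re s \<ge> - (1/28) / 2 \<Longrightarrow> norm (szeta s) \<le> 1 + K * norm s * norm (1 + s) powr (1/28)"
    by (rule szeta_bound[of "1/28"]) auto
  show thesis
  proof (rule that)
    show "1 / \<delta> + 2 * K > 0" using \<delta> K(1) by (simp add: add_pos_nonneg)
    fix s :: complex assume s: "Re s \<ge> -1/56" "Re s \<le> 2" "norm s \<ge> \<delta>"
    let ?T = "height s"
    have s0: "norm s > 0" using s(3) \<delta> by linarith
    have T1: "1 \<le> ?T powr (1/28)" by (intro ge_one_powr_ge_zero) auto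
    have "norm (1 + s) \<le> \<bar>Re (1 + s)\<bar> + \<bar>Im (1 + s)\<bar>" by (rule cmod_le)
    also have "\<dots> \<le> 2 * ?T" using s by auto
    finally have "norm (1 + s) powr (1/28) \<le> (2 * ?T) powr (1/28)" by (intro powr_mono2) auto
    also have "\<dots> \<le> 2 * ?T powr (1/28)" by (intro powr_double_le) auto
    finally have 1: "norm (1 + s) powr (1/28) \<le> 2 * ?T powr (1/28)" .
    have "norm (szeta s) \<le> 1 + K * norm s * norm (1 + s) powr (1/28)"
      using s by (intro K) auto
    also have "\<dots> \<le> 1 + K * norm s * (2 * ?T powr (1/28))"
      using 1 K(1) by (intro add_left_mono mult_left_mono) auto
    finally have 2: "norm (szeta s) \<le> 1 + K * norm s * (2 * ?T powr (1/28))" .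
    have 3: "1 * 1 \<le> (1 / \<delta> * norm s) * ?T powr (1/28)"
      using s(3) \<delta> T1 by (intro mult_mono) (auto simp: field_simps)
    have "(1 / \<delta> + 2 * K) * ?T powr (1/28) * norm s
        = (1 / \<delta> * norm s) * ?T powr (1/28) + K * norm s * (2 * ?T powr (1/28))"
      by (simp add: ring_distribs mult_ac)
    with 2 3 have "norm (szeta s) \<le> (1 / \<delta> + 2 * K) * ?T powr (1/28) * norm s"
      by linarith
    then show "norm (zeta_cont s) \<le> (1 / \<delta> + 2 * K) * ?T powr (1/28)"
      using s0 by (simp add: zeta_cont_def norm_divide divide_le_eq)
  qed
qed

text \<open>Cauchy's inequality for the derivative on discs of fixed radius. A radius of at most
  1/112 keeps them in \<open>Re s \<ge> -1/56\<close>, where \<open>zeta_cont_upper\<close> applies,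
  and one of at most \<open>\<delta> / 2\<close> keeps them away from the pole at 0.\<close>

lemma zeta_cont_lipschitz:
  assumes \<delta>: "0 < \<delta>"
  obtains K where "K > 0" "\<And>x y t. -1/112 \<le> x \<Longrightarrow> x \<le> 1 \<Longrightarrow> -1/112 \<le> y \<Longrightarrow> y \<le> 1 \<Longrightarrow> \<bar>t\<bar> \<ge> \<delta> \<Longrightarrow>
    norm (zeta_cont (Complex x t) - zeta_cont (Complex y t)) \<le> K * (2 + \<bar>t\<bar>) powr (1/28) * \<bar>x - y\<bar>"
proof -
  obtain K where K: "K > 0" "\<And>s. Re s \<ge> -1/56 \<Longrightarrow> Re s \<le> 2 \<Longrightarrow> norm s \<ge> \<delta> / 2 \<Longrightarrow> norm (zeta_cont s) \<le> K * height s powr (1/28)"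
    using zeta_cont_upper[of "\<delta> / 2"] \<delta> by auto
  define r where "r = min (1/112) (\<delta> / 2)"
  have r: "r > 0" "r \<le> 1/112" "r \<le> \<delta> / 2" using \<delta> by (auto simp: r_def)
  show thesis
  proof (rule that)
    show "2 * K / r > 0" using K r by simp
    fix x y t :: real assume xy: "-1/112 \<le> x" "x \<le> 1" "-1/112 \<le> y" "y \<le> 1" and t: "\<bar>t\<bar> \<ge> \<delta>"
    define S where "S = closed_segment (Complex x t) (Complex y t)"
    have S: "-1/112 \<le> Re z \<and> Re z \<le> 1 \<and> Im z = t" if "z \<in> S" for z
    proof -
      have "S \<subseteq> {z. -1/112 \<le> Re z} \<inter> {z. Re z \<le> 1} \<inter> {z. Im z = t}"
        unfolding S_def using xy
        by (intro closed_segment_subset convex_Int convex_halfspace_Re_ge convex_halfspace_Re_le)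
          (auto simp: convex_alt algebra_simps)
      then show ?thesis using that by auto
    qed
    have disc: "Re w \<ge> -1/56 \<and> Re w \<le> 2 \<and> norm w \<ge> \<delta> / 2 \<and> height w \<le> 2 * (2 + \<bar>t\<bar>)"
      if "z \<in> S" "w \<in> cball z r" for z w
    proof -
      have "\<bar>Re (z - w)\<bar> \<le> r" "\<bar>Im (z - w)\<bar> \<le> r"
        using that(2) abs_Re_le_cmod[of "z - w"] abs_Im_le_cmod[of "z - w"] by (auto simp: dist_norm)
      moreover have "\<bar>Im w\<bar> \<le> norm w" by (rule abs_Im_le_cmod)
      ultimately show ?thesis using S[OF that(1)] r t by auto
    qed
    have sub: "cball z r \<subseteq> {s. Re s > -1/2} - {0}" if "z \<in> S" for z
      using disc[OF that] \<delta> by fastforce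
    have der: "norm (deriv zeta_cont z) \<le> 2 * K / r * (2 + \<bar>t\<bar>) powr (1/28)" if z: "z \<in> S" for z
    proof -
      have "norm ((deriv ^^ 1) zeta_cont z) \<le> fact 1 * (2 * K * (2 + \<bar>t\<bar>) powr (1/28)) / r ^ 1"
      proof (rule Cauchy_inequality)
        have "zeta_cont holomorphic_on cball z r"
          using zeta_cont_holomorphic sub[OF z] by (rule holomorphic_on_subset)
        then show "zeta_cont holomorphic_on ball z r" "continuous_on (cball z r) zeta_cont"
          by (auto intro: holomorphic_on_imp_continuous_on holomorphic_on_subset[OF _ ball_subset_cball])
        show "r > 0" by (rule r)
        fix w assume "norm (z - w) = r"
        then have w: "w \<in> cball z r" by (simp add: dist_norm)
        note d = disc[OF z w]
        have "norm (zeta_cont w) \<le> K * height w powr (1/28)" using d by (intro K) auto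
        also have "\<dots> \<le> K * (2 * (2 + \<bar>t\<bar>)) powr (1/28)"
          using d K(1) by (intro mult_left_mono powr_mono2) auto
        also have "\<dots> \<le> K * (2 * (2 + \<bar>t\<bar>) powr (1/28))"
          using K(1) by (intro mult_left_mono powr_double_le) auto
        finally show "norm (zeta_cont w) \<le> 2 * K * (2 + \<bar>t\<bar>) powr (1/28)" by simp
      qed
      then show ?thesis by simp
    qed
    have "norm (zeta_cont (Complex x t) - zeta_cont (Complex y t)) \<le> 2 * K / r * (2 + \<bar>t\<bar>) powr (1/28) * norm (Complex x t - Complex y t)"
    proof (rule field_differentiable_bound[of S])
      show "convex S" by (simp add: S_def)
      show "(zeta_cont has_field_derivative deriv zeta_cont z) (at z within S)" if "z \<in> S" for z
      proof -
        have mem: "z \<in> {s. Re s > -1/2} - {0}"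
          by (rule subsetD[OF sub[OF that]]) (use r(1) in simp)
        have op: "open ({s. Re s > -1/2} - {0})" by (intro open_Diff open_Re_gt_half) auto
        show ?thesis
          by (rule has_field_derivative_at_within, rule holomorphic_derivI[OF zeta_cont_holomorphic op mem])
      qed
    qed (use der in \<open>auto simp: S_def\<close>)
    also have "norm (Complex x t - Complex y t) = \<bar>x - y\<bar>"
      by (simp add: cmod_def)
    finally show "norm (zeta_cont (Complex x t) - zeta_cont (Complex y t)) \<le> 2 * K / r * (2 + \<bar>t\<bar>) powr (1/28) * \<bar>x - y\<bar>" .
  qed
qed

text \<open>In the 3-4-1 inequality zeta(1 + c) is at most K0/c and the value at height 2t at most a
  multiple of T^(1/28), with T = 2 + |t|. Solving for the fourth power and taking roots gives
  c^(3/4) and T^(-1/112).\<close>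

lemma zeta_cont_lower_right:
  assumes \<delta>: "0 < \<delta>"
  obtains k where "k > 0" "\<And>c t. 0 < c \<Longrightarrow> c \<le> 1 \<Longrightarrow> \<bar>t\<bar> \<ge> \<delta> \<Longrightarrow>
    k * c powr (3/4) * (2 + \<bar>t\<bar>) powr (-1/112) \<le> norm (zeta_cont (Complex c t))"
proof -
  obtain K1 where K1: "K1 > 0" "\<And>s. Re s \<ge> -1/56 \<Longrightarrow> Re s \<le> 2 \<Longrightarrow> norm s \<ge> \<delta> \<Longrightarrow> norm (zeta_cont s) \<le> K1 * height s powr (1/28)"
    using zeta_cont_upper[OF \<delta>] by auto
  obtain K where K: "K \<ge> 0" "\<And>s. Re s \<ge> - (1/28) / 2 \<Longrightarrow> norm (szeta s) \<le> 1 + K * norm s * norm (1 + s) powr (1/28)"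
    by (rule szeta_bound[of "1/28"]) auto
  define K0 where "K0 = 1 + 2 * K"
  have K0: "K0 > 0" using K(1) by (simp add: K0_def)
  define k where "k = (1 / (2 * K0 ^ 3 * K1)) powr (1/4)"
  show thesis
  proof (rule that)
    show "k > 0" using K0 K1(1) by (simp add: k_def)
    fix c t :: real assume c: "0 < c" "c \<le> 1" and t: "\<bar>t\<bar> \<ge> \<delta>"
    let ?T = "2 + \<bar>t\<bar>"
    define x where "x = norm (zeta_cont (Complex c t))"
    have "norm (szeta (of_real c)) \<le> 1 + K * norm (of_real c :: complex) * norm (1 + of_real c :: complex) powr (1/28)"
      using c by (intro K) auto
    also have "norm (1 + of_real c :: complex) = 1 + c"
      using c by (metis abs_of_nonneg add_nonneg_nonneg norm_of_real of_real_1 of_real_add less_imp_le zero_le_one)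
    also have "(1 + c) powr (1/28) \<le> (2 * 1) powr (1/28)" using c by (intro powr_mono2) auto
    also have "(2 * 1) powr (1/28) \<le> 2 * 1 powr (1/28 :: real)" by (rule powr_double_le) auto
    also have "1 + K * norm (of_real c :: complex) * (2 * 1 powr (1/28 :: real)) \<le> K0"
      using c K(1) mult_left_mono[of c 1 K] by (auto simp: K0_def)
    finally have "norm (szeta (of_real c)) \<le> K0"
      using K(1) by (auto simp: mult_left_mono)
    then have z1: "norm (zeta_cont (of_real c)) \<le> K0 / c"
      using c by (simp add: zeta_cont_def norm_divide divide_right_mono)
    have "norm (zeta_cont (Complex c (2 * t))) \<le> K1 * height (Complex c (2 * t)) powr (1/28)"
    proof (rule K1(2))
      show "norm (Complex c (2 * t)) \<ge> \<delta>" using abs_Im_le_cmod[of "Complex c (2 * t)"] t by simp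
    qed (use c in auto)
    also have "\<dots> \<le> K1 * (2 * ?T) powr (1/28)"
      using K1(1) by (intro mult_left_mono powr_mono2) auto
    also have "\<dots> \<le> K1 * (2 * ?T powr (1/28))"
      using K1(1) by (intro mult_left_mono powr_double_le) auto
    finally have z2: "norm (zeta_cont (Complex c (2 * t))) \<le> 2 * K1 * ?T powr (1/28)" by simp
    have "1 \<le> norm (zeta_cont (of_real c)) ^ 3 * x ^ 4 * norm (zeta_cont (Complex c (2 * t)))"
      using zeta_shift_three_four_one[OF c(1), of t] c by (simp add: zeta_cont_eq_zeta1 x_def)
    also have "\<dots> \<le> (K0 / c) ^ 3 * x ^ 4 * (2 * K1 * ?T powr (1/28))"
      using z1 z2 K0 c by (intro mult_mono power_mono) (auto simp: x_def)
    finally have main: "1 \<le> (K0 / c) ^ 3 * x ^ 4 * (2 * K1 * ?T powr (1/28))" .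
    have Tp: "?T powr (1/28) > 0" by simp
    have "1 / (2 * K0 ^ 3 * K1) * c ^ 3 / ?T powr (1/28) \<le> x ^ 4"
      using main c K0 K1(1) Tp by (simp add: field_simps)
    moreover have "(k * c powr (3/4) * ?T powr (-1/112)) ^ 4 = 1 / (2 * K0 ^ 3 * K1) * c ^ 3 / ?T powr (1/28)"
    proof -
      have p4: "(y powr e) ^ 4 = y powr (e * 4)" if "y > 0" for y e :: real
        using that by (simp add: powr_power mult.commute)
      have "k ^ 4 = 1 / (2 * K0 ^ 3 * K1)"
        unfolding k_def using K0 K1(1) by (subst p4) auto
      moreover have "(c powr (3/4)) ^ 4 = c ^ 3"
        using c by (subst p4) (auto simp: powr_numeral)
      moreover have "(?T powr (-1/112)) ^ 4 = 1 / ?T powr (1/28)"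
        by (subst p4) (auto simp: powr_minus_divide)
      ultimately show ?thesis by (simp add: power_mult_distrib)
    qed
    ultimately have "(k * c powr (3/4) * ?T powr (-1/112)) ^ Suc 3 \<le> x ^ Suc 3" by simp
    then show "k * c powr (3/4) * ?T powr (-1/112) \<le> norm (zeta_cont (Complex c t))"
      unfolding x_def by (rule power_le_imp_le_base) simp
  qed
qed

text \<open>At abscissa \<eta> = a T^(-5/28) the bound from the right has size a^(3/4) T^(-15/112 -
  1/112), and moving from there to \<open>c\<close> costs at most a multiple of a T^(1/28 - 5/28).
  The exponent 5/28 makes both powers of T equal to -1/7; then a small \<open>a\<close> wins because
  a is smaller than a^(3/4). Taking \<open>a = b ^ 4\<close> makes that root explicit, and
  \<open>b \<le> 1/4\<close> gives \<open>a \<le> 1/112\<close>.\<close>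

lemma zeta_cont_lower:
  assumes \<delta>: "0 < \<delta>"
  obtains a k where "0 < a" "a \<le> 1/112" "k > 0" "\<And>c t. \<bar>t\<bar> \<ge> \<delta> \<Longrightarrow> - a * (2 + \<bar>t\<bar>) powr (-5/28) \<le> c \<Longrightarrow> c \<le> 1 \<Longrightarrow>
    k * (2 + \<bar>t\<bar>) powr (-1/7) \<le> norm (zeta_cont (Complex c t))"
proof -
  obtain k1 where k1: "k1 > 0" "\<And>c t. 0 < c \<Longrightarrow> c \<le> 1 \<Longrightarrow> \<bar>t\<bar> \<ge> \<delta> \<Longrightarrow>
    k1 * c powr (3/4) * (2 + \<bar>t\<bar>) powr (-1/112) \<le> norm (zeta_cont (Complex c t))"
    using zeta_cont_lower_right[OF \<delta>] by auto
  obtain K where K: "K > 0" "\<And>x y t. -1/112 \<le> x \<Longrightarrow> x \<le> 1 \<Longrightarrow> -1/112 \<le> y \<Longrightarrow> y \<le> 1 \<Longrightarrow> \<bar>t\<bar> \<ge> \<delta> \<Longrightarrow>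
    norm (zeta_cont (Complex x t) - zeta_cont (Complex y t)) \<le> K * (2 + \<bar>t\<bar>) powr (1/28) * \<bar>x - y\<bar>"
    using zeta_cont_lipschitz[OF \<delta>] by auto
  define b where "b = min (1/4) (k1 / (4 * K))"
  have b: "b > 0" "b \<le> 1/4" "b \<le> k1 / (4 * K)" using k1(1) K(1) by (auto simp: b_def)
  define a where "a = b ^ 4"
  have a: "a > 0" using b by (simp add: a_def)
  have "b ^ 4 \<le> (1/4) ^ 4" using b by (intro power_mono) auto
  then have a': "a \<le> 1/112" by (simp add: a_def power_numeral_reduce)
  have a34: "a powr (3/4) = b ^ 3"
  proof -
    have "a = b powr 4" unfolding a_def using b by (simp add: powr_numeral)
    then have "a powr (3/4) = b powr 3" by (simp add: powr_powr)
    then show ?thesis using b by (simp add: powr_numeral)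
  qed
  have "b * (4 * K) \<le> k1" using b(3) K(1) by (simp add: field_simps)
  then have "b ^ 3 * (b * (4 * K)) \<le> b ^ 3 * k1" using b by (intro mult_left_mono) auto
  then have small: "2 * K * a \<le> k1 * b ^ 3 / 2"
    by (simp add: a_def power_numeral_reduce mult_ac)
  show thesis
  proof (rule that[OF a a'])
    show "k1 * b ^ 3 / 2 > 0" using k1 b by simp
    fix c t :: real assume t: "\<bar>t\<bar> \<ge> \<delta>" and c: "- a * (2 + \<bar>t\<bar>) powr (-5/28) \<le> c" "c \<le> 1"
    define T where "T = 2 + \<bar>t\<bar>"
    have T: "T > 1" by (simp add: T_def)
    define \<eta> where "\<eta> = a * T powr (-5/28)"
    have "T powr (-5/28) \<le> T powr 0" using T by (intro powr_mono) auto
    then have "\<eta> \<le> a * 1" unfolding \<eta>_def using a T by (intro mult_left_mono) auto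
    then have \<eta>: "\<eta> > 0" "\<eta> \<le> 1/112" using a a' T by (simp add: \<eta>_def, linarith)
    have "\<eta> powr (3/4) = a powr (3/4) * T powr (-5/28 * (3/4))"
      unfolding \<eta>_def using a T by (simp add: powr_mult powr_powr)
    then have low: "k1 * \<eta> powr (3/4) * T powr (-1/112) = k1 * b ^ 3 * T powr (-1/7)"
      using T by (simp add: a34 powr_add[symmetric])
    show "k1 * b ^ 3 / 2 * (2 + \<bar>t\<bar>) powr (-1/7) \<le> norm (zeta_cont (Complex c t))"
    proof (cases "c \<ge> \<eta>")
      case True
      have "k1 * b ^ 3 / 2 * T powr (-1/7) \<le> k1 * b ^ 3 * T powr (-1/7)"
        using k1(1) b by simp
      also have "\<dots> \<le> k1 * c powr (3/4) * T powr (-1/112)"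
        unfolding low[symmetric] using True \<eta> k1(1)
        by (intro mult_right_mono mult_left_mono powr_mono2) auto
      also have "\<dots> \<le> norm (zeta_cont (Complex c t))"
        unfolding T_def using True \<eta> c t by (intro k1(2)) auto
      finally show ?thesis by (simp add: T_def)
    next
      case False
      have ce: "\<bar>\<eta> - c\<bar> \<le> 2 * \<eta>" using False c(1) by (simp add: \<eta>_def T_def)
      have "norm (zeta_cont (Complex \<eta> t) - zeta_cont (Complex c t)) \<le> K * T powr (1/28) * \<bar>\<eta> - c\<bar>"
        unfolding T_def
      proof (rule K(2))
        show "-1/112 \<le> c" using c(1) \<eta> by (simp add: \<eta>_def T_def)
      qed (use \<eta> c t in auto)
      also have "\<dots> \<le> K * T powr (1/28) * (2 * \<eta>)"
        using ce K(1) by (intro mult_left_mono) auto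
      also have "\<dots> = 2 * K * a * T powr (1/28 + -5/28)"
        unfolding \<eta>_def by (subst powr_add) simp
      also have "1/28 + -5/28 = (-1/7 :: real)" by simp
      also have "2 * K * a * T powr (-1/7) \<le> k1 * b ^ 3 / 2 * T powr (-1/7)"
        by (rule mult_right_mono[OF small]) simp
      finally have "norm (zeta_cont (Complex \<eta> t) - zeta_cont (Complex c t)) \<le> k1 * b ^ 3 / 2 * T powr (-1/7)" .
      moreover have "k1 * b ^ 3 * T powr (-1/7) \<le> norm (zeta_cont (Complex \<eta> t))"
        unfolding low[symmetric] unfolding T_def using \<eta> t by (intro k1(2)) auto
      moreover have "norm (zeta_cont (Complex \<eta> t)) \<le> norm (zeta_cont (Complex \<eta> t) - zeta_cont (Complex c t)) + norm (zeta_cont (Complex c t))"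
        using norm_triangle_sub[of "zeta_cont (Complex \<eta> t)" "zeta_cont (Complex c t)"] by simp
      ultimately show ?thesis unfolding T_def[symmetric] by (simp add: field_simps)
    qed
  qed
qed

section \<open>Non-vanishing on the closed half-plane and second differences of the
  transform\<close>

lemma szeta_0: "szeta 0 = 1"
proof -
  have "(\<lambda>n. szeta_term n 0) = (\<lambda>n. if n = 0 then 1 else 0)"
    by (auto simp: szeta_term_def simp del: of_nat_Suc)
  then have "(\<lambda>n. szeta_term n 0) sums 1"
    using sums_single[of 0 "\<lambda>_. 1 :: complex"] by simp
  then show ?thesis by (simp add: szeta_def sums_iff)
qed

text \<open>Right of the axis the Moebius series inverts zeta. On the axis away from 0,
  \<open>zeta_cont_lower\<close> with \<open>\<delta>\<close> equal to the absolute value of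
  \<open>Im s\<close> applies at \<open>c = 0\<close>. At 0 itself the value is 1.\<close>

lemma szeta_nonzero:
  assumes "Re s \<ge> 0"
  shows "szeta s \<noteq> 0"
proof (cases "Re s > 0")
  case True
  then have "zeta_shift s \<noteq> 0" using zeta_shift_Mob[OF True] by auto
  then show ?thesis using True by (auto simp: szeta_eq_zeta1)
next
  case False
  then have r: "Re s = 0" using assms by simp
  show ?thesis
  proof (cases "s = 0")
    case False
    then have "\<bar>Im s\<bar> > 0" using r by (auto simp: complex_eq_iff)
    then obtain a k where ak: "0 < a" "k > 0" "\<And>c t. \<bar>t\<bar> \<ge> \<bar>Im s\<bar> \<Longrightarrow> - a * (2 + \<bar>t\<bar>) powr (-5/28) \<le> c \<Longrightarrow> c \<le> 1 \<Longrightarrow>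
      k * (2 + \<bar>t\<bar>) powr (-1/7) \<le> norm (zeta_cont (Complex c t))"
      using zeta_cont_lower[of "\<bar>Im s\<bar>"] by metis
    have "k * height s powr (-1/7) \<le> norm (zeta_cont (Complex 0 (Im s)))"
      using ak(1) by (intro ak(3)) auto
    moreover have "Complex 0 (Im s) = s" using r by (simp add: complex_eq_iff)
    moreover have "k * height s powr (-1/7) > 0" using ak(2) by simp
    ultimately have "zeta_cont s \<noteq> 0" by auto
    then show ?thesis by (auto simp: zeta_cont_def)
  qed (simp add: szeta_0)
qed

text \<open>The linear Taylor terms at \<open>s + w\<close> and \<open>s - w\<close> cancel.
  \<open>complex_Taylor\<close> bounds each remainder with \<open>fact 1\<close> instead of
  \<open>fact 2\<close>, hence the constant 2.\<close>

lemma second_difference_bound: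
  assumes f: "f holomorphic_on S" "open S" and sub: "closed_segment (s - w) (s + w) \<subseteq> S"
    and B: "\<And>z. z \<in> closed_segment (s - w) (s + w) \<Longrightarrow> norm ((deriv ^^ 2) f z) \<le> B"
  shows "norm (f (s + w) + f (s - w) - 2 * f s) \<le> 2 * B * norm w ^ 2"
proof -
  let ?G = "closed_segment (s - w) (s + w)"
  have mid: "s \<in> ?G"
    using midpoint_in_closed_segment[of "s - w" "s + w"] by (simp add: midpoint_def scaleR_2[symmetric])
  have der: "((deriv ^^ i) f has_field_derivative (deriv ^^ Suc i) f z) (at z within ?G)" if "z \<in> ?G" for i z
  proof -
    have hol: "(deriv ^^ i) f holomorphic_on S" using f by (rule holomorphic_higher_deriv)
    have "z \<in> S" using that sub by blast
    then have "((deriv ^^ i) f has_field_derivative (deriv ^^ Suc i) f z) (at z)"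
      using holomorphic_derivI[OF hol f(2)] by simp
    then show ?thesis by (rule has_field_derivative_at_within)
  qed
  have taylor: "norm (f z - (f s + deriv f s * (z - s))) \<le> B * norm (z - s) ^ 2" if "z \<in> ?G" for z
  proof -
    have "norm ((deriv ^^ 0) f z - (\<Sum>i\<le>1. (deriv ^^ i) f s * (z - s) ^ i / fact i)) \<le> B * norm (z - s) ^ Suc 1 / fact 1"
    proof (rule complex_Taylor[of ?G])
      show "norm ((deriv ^^ Suc 1) f x) \<le> B" if "x \<in> ?G" for x
        using B[OF that] by (simp only: Suc_1)
    qed (use der mid that in auto)
    then show ?thesis by (simp add: numeral_2_eq_2)
  qed
  have 1: "norm (f (s + w) - (f s + deriv f s * w)) \<le> B * norm w ^ 2"
    using taylor[of "s + w"] by simp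
  have 2: "norm (f (s - w) - (f s - deriv f s * w)) \<le> B * norm w ^ 2"
    using taylor[of "s - w"] by simp
  have eq: "f (s + w) + f (s - w) - 2 * f s
      = (f (s + w) - (f s + deriv f s * w)) + (f (s - w) - (f s - deriv f s * w))"
    by simp
  show ?thesis
    unfolding eq using 1 2
      norm_triangle_ineq[of "f (s + w) - (f s + deriv f s * w)" "f (s - w) - (f s - deriv f s * w)"]
    by linarith
qed

text \<open>An open neighbourhood of the closed right half-plane, so that derivatives can be bounded
  up to and on the imaginary axis.\<close>

definition szeta_domain :: "complex set" where
  "szeta_domain = {s. Re s > -1/2 \<and> szeta s \<noteq> 0}"

lemma open_Om: "open szeta_domain"
proof -
  have "continuous_on {s. Re s > -1/2} szeta"
    using szeta_holomorphic by (rule holomorphic_on_imp_continuous_on)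
  then have "open ({s. Re s > -1/2} \<inter> szeta -` (- {0}))"
    by (intro continuous_open_preimage open_Re_gt_half) auto
  moreover have "{s. Re s > -1/2} \<inter> szeta -` (- {0}) = szeta_domain" by (auto simp: szeta_domain_def)
  ultimately show ?thesis by simp
qed

lemma szeta_domain_Re_nonneg: "Re s \<ge> 0 \<Longrightarrow> s \<in> szeta_domain"
  using szeta_nonzero by (auto simp: szeta_domain_def)

text \<open>Away from 0 this is 1/(s^2 zeta(1 + s)) - 1/s, the Laplace transform of e_1(exp u). The
  two poles at 0 cancel because \<open>szeta 0 = 1\<close>; the value there is the limit.\<close>

definition excess_transform :: "complex \<Rightarrow> complex" where
  "excess_transform s = (if s = 0 then - deriv (\<lambda>s. szeta s - 1) 0 else (1 - szeta s) / (s * szeta s))"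

lemma excess_transform_holomorphic: "excess_transform holomorphic_on szeta_domain"
proof -
  have "(\<lambda>z. if z = 0 then deriv (\<lambda>s. szeta s - 1) 0 else (szeta z - 1) / z - (szeta 0 - 1) / (z - 0)) holomorphic_on {s. Re s > -1/2}"
  proof (rule pole_theorem_open[OF _ open_Re_gt_half])
    show "(\<lambda>s. szeta s - 1) holomorphic_on {s. Re s > -1/2}"
      by (intro holomorphic_intros szeta_holomorphic)
  qed auto
  then have "(\<lambda>z. - (if z = 0 then deriv (\<lambda>s. szeta s - 1) 0 else (szeta z - 1) / z - (szeta 0 - 1) / (z - 0)) / szeta z) holomorphic_on szeta_domain"
    by (intro holomorphic_intros holomorphic_on_subset[OF szeta_holomorphic])
      (auto simp: szeta_domain_def elim: holomorphic_on_subset)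
  then show ?thesis
    by (rule holomorphic_transform) (auto simp: excess_transform_def szeta_0 szeta_domain_def field_simps)
qed

text \<open>This is 1/(s^2 zeta(1 + s)). At large height it is estimated apart from the elementary
  1/s.\<close>

definition inverse_szeta :: "complex \<Rightarrow> complex" where
  "inverse_szeta s = 1 / (s * szeta s)"

lemma inverse_szeta_holomorphic: "inverse_szeta holomorphic_on (szeta_domain - {0})"
  unfolding inverse_szeta_def[abs_def]
  by (intro holomorphic_intros holomorphic_on_subset[OF szeta_holomorphic]) (auto simp: szeta_domain_def)

lemma excess_transform_eq_Hs: "s \<in> szeta_domain \<Longrightarrow> s \<noteq> 0 \<Longrightarrow> excess_transform s = inverse_szeta s - 1 / s"
  by (auto simp: excess_transform_def inverse_szeta_def szeta_domain_def field_simps)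

text \<open>Cauchy's inequality on the discs that fit into the shrinking region of
  \<open>zeta_cont_lower\<close>. The factor 1/w^2 gives T^(-2), the inverse of zeta T^(4/28) and
  the squared inverse radius T^(10/28), in total T^(-3/2). The constant is 144 = 2! * 6^2 * 2, with
  6 from |w| \<ge> T/6 and the last 2 from replacing 2T by T.\<close>

lemma inverse_szeta_second_derivative_bound:
  obtains K where "K > 0" "\<And>c t. 0 \<le> c \<Longrightarrow> c \<le> 1/2 \<Longrightarrow> \<bar>t\<bar> \<ge> 1 \<Longrightarrow>
    norm ((deriv ^^ 2) inverse_szeta (Complex c t)) \<le> K * (2 + \<bar>t\<bar>) powr (-3/2)"
proof -
  obtain a k where a: "0 < a" "a \<le> 1/112" and k: "k > 0" "\<And>c t. \<bar>t\<bar> \<ge> 1/2 \<Longrightarrow> - a * (2 + \<bar>t\<bar>) powr (-5/28) \<le> c \<Longrightarrow> c \<le> 1 \<Longrightarrow>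
    k * (2 + \<bar>t\<bar>) powr (-1/7) \<le> norm (zeta_cont (Complex c t))"
    by (rule zeta_cont_lower[of "1/2"]) auto
  show thesis
  proof (rule that)
    show "144 / (k * a\<^sup>2) > 0" using a k by simp
    fix c t :: real assume c: "0 \<le> c" "c \<le> 1/2" and t: "\<bar>t\<bar> \<ge> 1"
    define T where "T = 2 + \<bar>t\<bar>"
    have T: "T \<ge> 3" using t by (simp add: T_def)
    define r where "r = a * (2 * T) powr (-5/28)"
    have "(2 * T) powr (-5/28) \<le> (2 * T) powr 0" using T by (intro powr_mono) auto
    then have "r \<le> a * 1" unfolding r_def using a T by (intro mult_left_mono) auto
    then have r: "r > 0" "r \<le> 1/112" using a T by (simp add: r_def, linarith)
    let ?B = "36 / k * (2 * T) powr (1/7) / T\<^sup>2"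
    have disc: "w \<in> szeta_domain - {0} \<and> norm (inverse_szeta w) \<le> ?B" if "w \<in> cball (Complex c t) r" for w
    proof -
      have d: "\<bar>c - Re w\<bar> \<le> r" "\<bar>t - Im w\<bar> \<le> r"
        using that abs_Re_le_cmod[of "Complex c t - w"] abs_Im_le_cmod[of "Complex c t - w"] by (auto simp: dist_norm)
      have Tw: "height w \<le> 2 * T" "height w \<ge> 2" using d(2) r T by (auto simp: T_def)
      have "(2 * T) powr (-5/28) \<le> height w powr (-5/28)" using Tw by (intro powr_mono2') auto
      then have "r \<le> a * height w powr (-5/28)" unfolding r_def using a by (intro mult_left_mono) auto
      then have "- a * height w powr (-5/28) \<le> Re w" using d(1) c by simp
      then have low: "k * height w powr (-1/7) \<le> norm (zeta_cont (Complex (Re w) (Im w)))"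
        using d r c t by (intro k(2)) auto
      have "(2 * T) powr (-1/7) \<le> height w powr (-1/7)" using Tw by (intro powr_mono2') auto
      then have "k * (2 * T) powr (-1/7) \<le> k * height w powr (-1/7)"
        using k(1) by (intro mult_left_mono) auto
      then have "k * (2 * T) powr (-1/7) \<le> norm (zeta_cont w)"
        using low unfolding complex_surj by (rule order_trans)
      moreover have kp: "k * (2 * T) powr (-1/7) > 0" using k(1) T by simp
      ultimately have zw: "zeta_cont w \<noteq> 0" "k * (2 * T) powr (-1/7) \<le> norm (zeta_cont w)" by auto
      then have w0: "w \<noteq> 0" "szeta w \<noteq> 0" by (auto simp: zeta_cont_def)
      have "\<bar>Im w\<bar> \<ge> T / 6" using d(2) r t by (simp add: T_def)
      then have nw: "norm w \<ge> T / 6" using abs_Im_le_cmod[of w] by linarith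
      have "inverse_szeta w = 1 / (w\<^sup>2 * zeta_cont w)"
        using w0 by (simp add: inverse_szeta_def zeta_cont_def power2_eq_square)
      then have "norm (inverse_szeta w) = 1 / (norm w ^ 2 * norm (zeta_cont w))"
        by (simp add: norm_divide norm_mult norm_power)
      also have "\<dots> \<le> 1 / ((T / 6) ^ 2 * (k * (2 * T) powr (-1/7)))"
        using nw zw kp k(1) T by (intro divide_left_mono mult_mono power_mono mult_pos_pos) auto
      also have "\<dots> = ?B"
        using T k(1) by (simp add: powr_minus field_simps power2_eq_square)
      finally show ?thesis using w0 d(1) r c by (auto simp: szeta_domain_def)
    qed
    have "norm ((deriv ^^ 2) inverse_szeta (Complex c t)) \<le> fact 2 * ?B / r ^ 2"
    proof (rule Cauchy_inequality)
      have "inverse_szeta holomorphic_on cball (Complex c t) r"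
        using inverse_szeta_holomorphic by (rule holomorphic_on_subset) (use disc in blast)
      then show "inverse_szeta holomorphic_on ball (Complex c t) r" "continuous_on (cball (Complex c t) r) inverse_szeta"
        by (auto intro: holomorphic_on_imp_continuous_on holomorphic_on_subset[OF _ ball_subset_cball])
      show "norm (inverse_szeta w) \<le> ?B" if "norm (Complex c t - w) = r" for w
        using disc[of w] that by (simp add: dist_norm)
    qed (use r in auto)
    also have "fact 2 * ?B / r ^ 2 = 72 / (k * a\<^sup>2) * ((2 * T) powr (1/7) / (2 * T) powr (-5/14)) / T\<^sup>2"
    proof -
      have "r ^ 2 = a\<^sup>2 * (2 * T) powr (-5/14)"
        unfolding r_def power_mult_distrib using T by (simp add: powr_power)
      then show ?thesis by simp
    qed
    also have "(2 * T) powr (1/7) / (2 * T) powr (-5/14) = (2 * T) powr (1/2)"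
      by (subst powr_diff[symmetric]) simp
    also have "72 / (k * a\<^sup>2) * (2 * T) powr (1/2) / T\<^sup>2 \<le> 72 / (k * a\<^sup>2) * (2 * T powr (1/2)) / T\<^sup>2"
      using k(1) T by (intro divide_right_mono mult_left_mono powr_double_le) auto
    also have "\<dots> = 144 / (k * a\<^sup>2) * (T powr (1/2) / T powr 2)"
      using T by (simp add: powr_numeral)
    also have "T powr (1/2) / T powr 2 = T powr (-3/2)"
      by (subst powr_diff[symmetric]) simp
    finally show "norm ((deriv ^^ 2) inverse_szeta (Complex c t)) \<le> 144 / (k * a\<^sup>2) * (2 + \<bar>t\<bar>) powr (-3/2)"
      by (simp add: T_def)
  qed
qed

lemma vertical_segment:
  assumes "z \<in> closed_segment (Complex c t - \<i> * of_real h) (Complex c t + \<i> * of_real h)" "h > 0"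
  shows "Re z = c" "\<bar>Im z - t\<bar> \<le> h"
proof -
  have "closed_segment (Complex c t - \<i> * of_real h) (Complex c t + \<i> * of_real h) \<subseteq> {z. Re z = c} \<inter> cball (Complex c t) h"
  proof (rule closed_segment_subset)
    show "convex ({z. Re z = c} \<inter> cball (Complex c t) h)"
      by (intro convex_Int convex_cball) (auto simp: convex_alt algebra_simps)
  qed (use assms(2) in \<open>auto simp: dist_norm norm_mult\<close>)
  then have "z \<in> {z. Re z = c} \<inter> cball (Complex c t) h" using assms(1) by blast
  then show "Re z = c" "\<bar>Im z - t\<bar> \<le> h"
    using abs_Im_le_cmod[of "Complex c t - z"] by (auto simp: dist_norm)
qed

text \<open>For |t| \<le> 2 the second derivative is bounded by compactness, on a rectangle that
  includes part of the imaginary axis and the removed pole. For larger |t| the second difference of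
  1/s is the explicit 2w^2/(s(s + w)(s - w)). Nothing deteriorates as \<open>c\<close> tends to 0,
  which later permits c = 1/u.\<close>

lemma excess_transform_second_difference:
  obtains K where "K > 0" "\<And>c t h. 0 < c \<Longrightarrow> c \<le> 1/2 \<Longrightarrow> 0 < h \<Longrightarrow> h \<le> 1 \<Longrightarrow>
    norm (excess_transform (Complex c t + \<i> * of_real h) + excess_transform (Complex c t - \<i> * of_real h) - 2 * excess_transform (Complex c t))
      \<le> K * h\<^sup>2 * (2 + \<bar>t\<bar>) powr (-3/2)"
proof -
  obtain K1 where K1: "K1 > 0" "\<And>c t. 0 \<le> c \<Longrightarrow> c \<le> 1/2 \<Longrightarrow> \<bar>t\<bar> \<ge> 1 \<Longrightarrow>
    norm ((deriv ^^ 2) inverse_szeta (Complex c t)) \<le> K1 * (2 + \<bar>t\<bar>) powr (-3/2)"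
    using inverse_szeta_second_derivative_bound by blast
  define Q where "Q = cbox (Complex 0 (-3)) (Complex 1 3)"
  have Q: "z \<in> Q \<longleftrightarrow> 0 \<le> Re z \<and> Re z \<le> 1 \<and> -3 \<le> Im z \<and> Im z \<le> 3" for z
    unfolding Q_def by (auto simp: in_cbox_complex_iff)
  have "Q \<subseteq> szeta_domain" using Q szeta_domain_Re_nonneg by blast
  moreover have "(deriv ^^ 2) excess_transform holomorphic_on szeta_domain"
    using excess_transform_holomorphic open_Om by (rule holomorphic_higher_deriv)
  ultimately have "continuous_on Q ((deriv ^^ 2) excess_transform)"
    using holomorphic_on_imp_continuous_on continuous_on_subset by blast
  then have "bounded ((deriv ^^ 2) excess_transform ` Q)"
    by (intro compact_imp_bounded compact_continuous_image) (auto simp: Q_def)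
  then obtain B where B: "B > 0" "\<And>z. z \<in> Q \<Longrightarrow> norm ((deriv ^^ 2) excess_transform z) \<le> B"
    unfolding bounded_pos by auto
  \<comment> \<open>16 B = 2 B * 8, as T \<le> 4 gives T^(-3/2) \<ge> 1/8. In 8 K1 = 2 * 4 K1 the 4
    pays for heights down to T/2 on the segment. 128 = 2 * 4^3 comes from three factors of size at
    least T/4.\<close>
  define K where "K = 16 * B + (8 * K1 + 128)"
  show thesis
  proof (rule that)
    show "K > 0" using B K1 by (simp add: K_def)
    fix c t h :: real assume c: "0 < c" "c \<le> 1/2" and h: "0 < h" "h \<le> 1"
    define s where "s = Complex c t"
    define w where "w = \<i> * of_real h"
    define T where "T = 2 + \<bar>t\<bar>"
    have nw: "norm w = h" using h by (simp add: w_def norm_mult)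
    have T2: "T \<ge> 2" by (simp add: T_def)
    have Tp: "T powr (-3/2) > 0" using T2 by simp
    have seg: "Re z = c" "\<bar>Im z - t\<bar> \<le> h" if "z \<in> closed_segment (s - w) (s + w)" for z
      using vertical_segment[of z c t h] that h by (auto simp: s_def w_def)
    have segOm: "closed_segment (s - w) (s + w) \<subseteq> szeta_domain"
      using seg c by (auto intro!: szeta_domain_Re_nonneg)
    have p4: "4 powr (3/2 :: real) = 8"
    proof -
      have "4 powr (3/2 :: real) = (2 powr 2) powr (3/2)" by (simp add: powr_numeral)
      also have "\<dots> = 2 powr 3" by (subst powr_powr) simp
      finally show ?thesis by (simp add: powr_numeral)
    qed
    have "norm (excess_transform (s + w) + excess_transform (s - w) - 2 * excess_transform s) \<le> K * h\<^sup>2 * T powr (-3/2)"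
    proof (cases "\<bar>t\<bar> \<le> 2")
      case True
      have "norm (excess_transform (s + w) + excess_transform (s - w) - 2 * excess_transform s) \<le> 2 * B * norm w ^ 2"
      proof (rule second_difference_bound[OF excess_transform_holomorphic open_Om segOm])
        fix z assume z: "z \<in> closed_segment (s - w) (s + w)"
        show "norm ((deriv ^^ 2) excess_transform z) \<le> B"
          using seg[OF z] c h True by (intro B(2)) (auto simp: Q)
      qed
      also have "\<dots> = 16 * B * h\<^sup>2 * (1 / 8)" by (simp add: nw)
      also have "1 / 8 \<le> T powr (-3/2)"
      proof -
        have "4 powr (-3/2) \<le> T powr (-3/2)"
          using True T2 by (intro powr_mono2') (auto simp: T_def)
        then show ?thesis using p4 by (simp add: powr_minus)
      qed
      also have "16 * B * h\<^sup>2 * T powr (-3/2) \<le> K * h\<^sup>2 * T powr (-3/2)"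
        using K1(1) B(1) by (intro mult_right_mono) (auto simp: K_def)
      finally show ?thesis using B(1) by (simp add: mult_left_mono)
    next
      case False
      have s0: "s + w \<noteq> 0" "s - w \<noteq> 0" "s \<noteq> 0"
        using c by (auto simp: s_def w_def complex_eq_iff)
      have inOm: "s + w \<in> szeta_domain" "s - w \<in> szeta_domain" "s \<in> szeta_domain"
        using c by (auto intro!: szeta_domain_Re_nonneg simp: s_def w_def)
      have seg0: "closed_segment (s - w) (s + w) \<subseteq> szeta_domain - {0}"
        using segOm seg(1)[of 0] c by auto
      have "norm (inverse_szeta (s + w) + inverse_szeta (s - w) - 2 * inverse_szeta s) \<le> 2 * (4 * K1 * T powr (-3/2)) * norm w ^ 2"
      proof (rule second_difference_bound[OF inverse_szeta_holomorphic _ seg0])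
        show "open (szeta_domain - {0})" using open_Om by (intro open_Diff) auto
        fix z assume z: "z \<in> closed_segment (s - w) (s + w)"
        have "norm ((deriv ^^ 2) inverse_szeta (Complex (Re z) (Im z))) \<le> K1 * height z powr (-3/2)"
          using seg[OF z] c h False by (intro K1(2)) auto
        also have "\<dots> \<le> K1 * (T / 2) powr (-3/2)"
          using seg[OF z] h False K1(1) by (intro mult_left_mono powr_mono2') (auto simp: T_def)
        also have "(T / 2) powr (-3/2) = T powr (-3/2) * 2 powr (3/2)"
          using T2 by (simp add: powr_divide powr_minus divide_simps)
        also have "2 powr (3/2) \<le> (2 powr 2 :: real)" by (intro powr_mono) auto
        also have "2 powr 2 = (4 :: real)" by (simp add: powr_numeral)
        finally show "norm ((deriv ^^ 2) inverse_szeta z) \<le> 4 * K1 * T powr (-3/2)"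
          using K1(1) by (auto simp: mult_left_mono mult_right_mono)
      qed
      then have 1: "norm (inverse_szeta (s + w) + inverse_szeta (s - w) - 2 * inverse_szeta s) \<le> 8 * K1 * h\<^sup>2 * T powr (-3/2)"
        by (simp add: nw mult_ac)
      have big: "norm z \<ge> T / 4" if "\<bar>Im z - t\<bar> \<le> 1" for z
        using abs_Im_le_cmod[of z] that False by (simp add: T_def)
      have "norm (1 / (s + w) + 1 / (s - w) - 2 * (1 / s)) = norm (2 * w\<^sup>2 / (s * (s + w) * (s - w)))"
        using s0 by (intro arg_cong[where f = norm]) (simp add: divide_simps, simp add: algebra_simps power2_eq_square)
      also have "\<dots> = 2 * h\<^sup>2 / (norm s * norm (s + w) * norm (s - w))"
        by (simp add: norm_divide norm_mult norm_power nw)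
      also have "\<dots> \<le> 2 * h\<^sup>2 / (T / 4 * (T / 4) * (T / 4))"
        using T2 h s0 by (intro divide_left_mono mult_mono big mult_pos_pos) (auto simp: s_def w_def)
      also have "\<dots> = 128 * h\<^sup>2 * T powr (-3)"
        using T2 by (simp add: powr_minus powr_numeral power3_eq_cube divide_simps)
      also have "\<dots> \<le> 128 * h\<^sup>2 * T powr (-3/2)"
        using T2 by (intro mult_left_mono powr_mono) auto
      finally have 2: "norm (1 / (s + w) + 1 / (s - w) - 2 * (1 / s)) \<le> 128 * h\<^sup>2 * T powr (-3/2)" .
      have eq: "excess_transform (s + w) + excess_transform (s - w) - 2 * excess_transform s
          = (inverse_szeta (s + w) + inverse_szeta (s - w) - 2 * inverse_szeta s) - (1 / (s + w) + 1 / (s - w) - 2 * (1 / s))"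
        unfolding excess_transform_eq_Hs[OF inOm(1) s0(1)] excess_transform_eq_Hs[OF inOm(2) s0(2)] excess_transform_eq_Hs[OF inOm(3) s0(3)]
        by (simp add: algebra_simps)
      have "norm (excess_transform (s + w) + excess_transform (s - w) - 2 * excess_transform s) \<le> 8 * K1 * h\<^sup>2 * T powr (-3/2) + 128 * h\<^sup>2 * T powr (-3/2)"
        unfolding eq using 1 2 norm_triangle_ineq4[of "inverse_szeta (s + w) + inverse_szeta (s - w) - 2 * inverse_szeta s" "1 / (s + w) + 1 / (s - w) - 2 * (1 / s)"]
        by linarith
      also have "\<dots> = (8 * K1 + 128) * h\<^sup>2 * T powr (-3/2)"
        by (simp add: algebra_simps)
      also have "\<dots> \<le> K * h\<^sup>2 * T powr (-3/2)"
        using B(1) by (intro mult_right_mono) (auto simp: K_def)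
      finally show ?thesis .
    qed
    then show "norm (excess_transform (Complex c t + \<i> * of_real h) + excess_transform (Complex c t - \<i> * of_real h) - 2 * excess_transform (Complex c t))
      \<le> K * h\<^sup>2 * (2 + \<bar>t\<bar>) powr (-3/2)"
      by (simp add: s_def w_def T_def)
  qed
qed

section \<open>A Fourier inversion inequality\<close>

text \<open>The characteristic function of the standard normal distribution at
  \<open>x / \<delta>\<close>, rescaled. As a function of \<open>x\<close> the result concentrates
  at 0 when \<open>\<delta>\<close> tends to 0.\<close>

lemma gaussian_fourier:
  assumes "\<delta> > 0"
  shows "has_bochner_integral lborel (\<lambda>t. iexp (t * x) * of_real (std_normal_density (\<delta> * t)))
    (of_real (exp (- ((x / \<delta>)\<^sup>2) / 2) / \<delta>))"
proof -
  interpret real_distribution std_normal_distribution by (rule real_dist_normal_dist)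
  have int: "integrable lborel (\<lambda>t. std_normal_density t *\<^sub>R iexp (x / \<delta> * t))"
  proof -
    have "integrable std_normal_distribution (\<lambda>t. iexp (x / \<delta> * t))"
      by (intro integrable_const_bound[where B = 1]) auto
    then show ?thesis by (subst (asm) integrable_density) auto
  qed
  have "(LINT t|lborel. std_normal_density t *\<^sub>R iexp (x / \<delta> * t)) = char std_normal_distribution (x / \<delta>)"
    unfolding char_def by (subst integral_density) auto
  also have "\<dots> = of_real (exp (- ((x / \<delta>)\<^sup>2) / 2))"
    by (simp add: char_std_normal_distribution)
  finally have "has_bochner_integral lborel (\<lambda>t. std_normal_density t *\<^sub>R iexp (x / \<delta> * t)) (of_real (exp (- ((x / \<delta>)\<^sup>2) / 2)))"
    using int by (simp add: has_bochner_integral_iff)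
  then have h: "has_bochner_integral lborel (\<lambda>t. std_normal_density (0 + \<delta> * t) *\<^sub>R iexp (x / \<delta> * (0 + \<delta> * t)))
      (of_real (exp (- ((x / \<delta>)\<^sup>2) / 2)) /\<^sub>R \<bar>\<delta>\<bar>)"
    using assms by (subst (asm) lborel_has_bochner_integral_real_affine_iff[where c = \<delta> and t = 0]) auto
  have e1: "(\<lambda>t. std_normal_density (0 + \<delta> * t) *\<^sub>R iexp (x / \<delta> * (0 + \<delta> * t)))
      = (\<lambda>t. iexp (t * x) * of_real (std_normal_density (\<delta> * t)))"
  proof
    fix t
    have xd: "x / \<delta> * (\<delta> * t) = t * x" using assms by simp
    show "std_normal_density (0 + \<delta> * t) *\<^sub>R iexp (x / \<delta> * (0 + \<delta> * t))
      = iexp (t * x) * of_real (std_normal_density (\<delta> * t))"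
      unfolding add_0 xd scaleR_conv_of_real by (rule mult.commute)
  qed
  have e2: "of_real (exp (- ((x / \<delta>)\<^sup>2) / 2)) /\<^sub>R \<bar>\<delta>\<bar> = (of_real (exp (- ((x / \<delta>)\<^sup>2) / 2) / \<delta>) :: complex)"
  proof -
    have eq: "y / \<delta> = inverse \<bar>\<delta>\<bar> * y" for y
      using assms by (simp add: field_simps)
    show ?thesis unfolding eq by (simp only: scaleR_conv_of_real of_real_mult)
  qed
  show ?thesis using h unfolding e1 e2 .
qed

lemma std_normal_density_le_1: "std_normal_density x \<le> 1"
proof -
  have "1 \<le> sqrt (2 * pi)" using pi_gt3 by (intro real_le_rsqrt) simp
  then have "1 / sqrt (2 * pi) \<le> 1" by simp
  moreover have "exp (- x\<^sup>2 / 2) \<le> 1" by simp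
  ultimately have "1 / sqrt (2 * pi) * exp (- x\<^sup>2 / 2) \<le> 1 * 1"
    by (intro mult_mono) auto
  then show ?thesis by (simp add: std_normal_density_def)
qed

lemma sqrt_2pi_density: "exp (- x\<^sup>2 / 2) = sqrt (2 * pi) * std_normal_density x"
  by (simp add: std_normal_density_def)

text \<open>With the damping factor \<open>std_normal_density (\<delta> * t)\<close>, Fubini
  identifies the inverse transform with a Gaussian average of \<open>f\<close> around
  \<open>u\<close>. It is bounded by the integral of \<open>g\<close>, the damping being at most 1,
  and tends to \<open>f u * sqrt (2 * pi)\<close> by dominated convergence and continuity at
  \<open>u\<close>.\<close>

lemma fourier_inversion_bound:
  fixes f :: "real \<Rightarrow> complex" and g :: "real \<Rightarrow> real"
  assumes f: "integrable lborel f" and fb: "\<And>x. norm (f x) \<le> B" and fc: "isCont f u"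
    and g: "integrable lborel g" and fg: "\<And>t. norm (LINT v|lborel. f v * iexp (- (t * v))) \<le> g t"
  shows "norm (f u) \<le> (LINT t|lborel. g t)"
proof -
  have fm[measurable]: "f \<in> borel_measurable borel" using f by auto
  define G where "G = (LINT t|lborel. g t)"
  have g0: "0 \<le> g t" for t using fg[of t] norm_ge_zero order_trans by blast
  have key: "norm (LINT w|lborel. f (u + \<delta> * w) * of_real (exp (- w\<^sup>2 / 2))) \<le> G" if \<delta>: "\<delta> > 0" for \<delta>
  proof -
    define F where "F = (\<lambda>(v, t). f v * (iexp (t * (u - v)) * of_real (std_normal_density (\<delta> * t))))"
    have Fm[measurable]: "F \<in> borel_measurable (lborel \<Otimes>\<^sub>M lborel)"
      unfolding F_def by measurable
    have n0: "integrable lborel (\<lambda>t. std_normal_density (\<delta> * t))"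
      using lborel_integrable_real_affine[OF integrable_normal_density[of 1 0], of \<delta> 0] \<delta> by simp
    have nF: "norm (F (v, t)) = norm (f v) * std_normal_density (\<delta> * t)" for v t
      by (simp add: F_def norm_mult)
    have Fint: "integrable (lborel \<Otimes>\<^sub>M lborel) F"
    proof (rule lborel_pair.Fubini_integrable)
      show "integrable lborel (\<lambda>x. LINT y|lborel. norm (F (x, y)))"
        unfolding nF using f by simp
      show "AE x in lborel. integrable lborel (\<lambda>y. F (x, y))"
      proof (intro AE_I2)
        fix v
        have "integrable lborel (\<lambda>t. f v * (iexp (t * (u - v)) * of_real (std_normal_density (\<delta> * t))))"
          using gaussian_fourier[OF \<delta>, of "u - v"] by (intro integrable_mult_right) (simp add: has_bochner_integral_iff)
        then show "integrable lborel (\<lambda>y. F (v, y))" by (simp add: F_def)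
      qed
    qed measurable
    have in1: "(LINT t|lborel. F (v, t)) = f v * of_real (exp (- (((u - v) / \<delta>)\<^sup>2) / 2) / \<delta>)" for v
      using gaussian_fourier[OF \<delta>, of "u - v"] by (simp add: F_def has_bochner_integral_iff)
    have in2: "(LINT v|lborel. F (v, t)) = (LINT v|lborel. f v * iexp (- (t * v))) * (iexp (t * u) * of_real (std_normal_density (\<delta> * t)))" for t
    proof -
      have "F (v, t) = (f v * iexp (- (t * v))) * (iexp (t * u) * of_real (std_normal_density (\<delta> * t)))" for v
        by (simp add: F_def exp_add[symmetric] algebra_simps exp_diff exp_minus divide_inverse)
      then show ?thesis by simp
    qed
    have "(LINT v|lborel. f v * of_real (exp (- (((u - v) / \<delta>)\<^sup>2) / 2) / \<delta>))
        = (LINT t|lborel. (LINT v|lborel. F (v, t)))"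
      using lborel_pair.Fubini_integral[of "\<lambda>v t. F (v, t)"] Fint by (simp add: in1)
    also have "norm \<dots> \<le> (LINT t|lborel. norm (LINT v|lborel. F (v, t)))"
      by (rule integral_norm_bound)
    also have "\<dots> \<le> G"
      unfolding G_def
    proof (rule integral_mono[OF _ g])
      show "integrable lborel (\<lambda>t. norm (LINT v|lborel. F (v, t)))"
        by (intro integrable_norm lborel_pair.integrable_snd[of "\<lambda>v t. F (v, t)"]) (use Fint in simp)
      fix t
      have "norm (LINT v|lborel. F (v, t)) = norm (LINT v|lborel. f v * iexp (- (t * v))) * std_normal_density (\<delta> * t)"
        unfolding in2 by (simp add: norm_mult)
      also have "\<dots> \<le> g t * 1"
        using fg[of t] g0[of t] by (intro mult_mono std_normal_density_le_1) auto
      finally show "norm (LINT v|lborel. F (v, t)) \<le> g t" by simp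
    qed
    also have "(LINT v|lborel. f v * of_real (exp (- (((u - v) / \<delta>)\<^sup>2) / 2) / \<delta>))
        = \<bar>\<delta>\<bar> *\<^sub>R (LINT w|lborel. f (u + \<delta> * w) * of_real (exp (- (((u - (u + \<delta> * w)) / \<delta>)\<^sup>2) / 2) / \<delta>))"
      using \<delta> by (intro lborel_integral_real_affine) auto
    also have "\<dots> = (LINT w|lborel. f (u + \<delta> * w) * of_real (exp (- w\<^sup>2 / 2)))"
      unfolding integral_scaleR_right[symmetric]
    proof (intro Bochner_Integration.integral_cong refl)
      fix w
      have "((u - (u + \<delta> * w)) / \<delta>)\<^sup>2 = w\<^sup>2" using \<delta> by (simp add: power_divide power_mult_distrib)
      then show "\<bar>\<delta>\<bar> *\<^sub>R (f (u + \<delta> * w) * of_real (exp (- (((u - (u + \<delta> * w)) / \<delta>)\<^sup>2) / 2) / \<delta>))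
          = f (u + \<delta> * w) * of_real (exp (- w\<^sup>2 / 2))"
        using \<delta> by (simp add: scaleR_conv_of_real)
    qed
    finally show ?thesis .
  qed
  define d where "d n = 1 / real (Suc n)" for n
  have dn: "d n > 0" for n by (simp add: d_def)
  have dl: "d \<longlonglongrightarrow> 0" unfolding d_def by (rule LIMSEQ_Suc[OF lim_1_over_n])
  have "(\<lambda>n. LINT w|lborel. f (u + d n * w) * of_real (exp (- w\<^sup>2 / 2))) \<longlonglongrightarrow> (LINT w|lborel. f u * of_real (exp (- w\<^sup>2 / 2)))"
  proof (rule integral_dominated_convergence)
    show "integrable lborel (\<lambda>w. B * (sqrt (2 * pi) * std_normal_density w))"
      by (intro integrable_mult_right integrable_normal_density) simp
    show "AE w in lborel. (\<lambda>n. f (u + d n * w) * of_real (exp (- w\<^sup>2 / 2))) \<longlonglongrightarrow> f u * of_real (exp (- w\<^sup>2 / 2))"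
    proof (intro AE_I2 tendsto_mult tendsto_const)
      fix w
      have "(\<lambda>n. u + d n * w) \<longlonglongrightarrow> u + 0 * w" by (intro tendsto_intros dl)
      then show "(\<lambda>n. f (u + d n * w)) \<longlonglongrightarrow> f u"
        using fc by (auto intro: isCont_tendsto_compose)
    qed
    show "AE w in lborel. norm (f (u + d n * w) * of_real (exp (- w\<^sup>2 / 2))) \<le> B * (sqrt (2 * pi) * std_normal_density w)" for n
      by (intro AE_I2) (auto simp: norm_mult sqrt_2pi_density[symmetric] intro!: mult_right_mono fb)
  qed measurable
  from LIMSEQ_le_const2[OF tendsto_norm[OF this], of G] key[OF dn]
  have lim: "norm (LINT w|lborel. f u * of_real (exp (- w\<^sup>2 / 2))) \<le> G"
    by blast
  have "(LINT w|lborel. exp (- w\<^sup>2 / 2)) = sqrt (2 * pi)"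
    unfolding sqrt_2pi_density using integral_normal_density[of 1 0] by simp
  then have eq: "(LINT w|lborel. f u * of_real (exp (- w\<^sup>2 / 2))) = f u * of_real (sqrt (2 * pi))"
    by (simp add: integral_complex_of_real)
  have "norm (f u) * sqrt (2 * pi) \<le> G"
    using lim unfolding eq by (simp add: norm_mult)
  moreover have "1 \<le> sqrt (2 * pi)" using pi_gt3 by (intro real_le_rsqrt) simp
  then have "norm (f u) * 1 \<le> norm (f u) * sqrt (2 * pi)" by (intro mult_left_mono) auto
  ultimately show ?thesis by (simp add: G_def)
qed

section \<open>Laplace transforms of the logarithmic sums\<close>

lemma laplace_integrable_real:
  fixes c :: real
  assumes c: "c > 0"
  shows "integrable lborel (\<lambda>x. (max 0 x) ^ k * indicator {0..} x * exp (- (c * x)))"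
proof -
  have "integrable lborel (\<lambda>x. x ^ k * exp (- x) * indicator {0::real..} x)"
    using has_bochner_integral_I0i_power_exp_m'[of k] by (simp add: has_bochner_integral_iff)
  then have "integrable lborel (\<lambda>x. (0 + c * x) ^ k * exp (- (0 + c * x)) * indicator {0::real..} (0 + c * x))"
    using c by (intro lborel_integrable_real_affine[where f = "\<lambda>x. x ^ k * exp (- x) * indicator {0::real..} x"]) auto
  then have "integrable lborel (\<lambda>x. (1 / c ^ k) * ((0 + c * x) ^ k * exp (- (0 + c * x)) * indicator {0::real..} (0 + c * x)))"
    by (rule integrable_mult_right)
  moreover have "(1 / c ^ k) * ((0 + c * x) ^ k * exp (- (0 + c * x)) * indicator {0::real..} (0 + c * x))
      = (max 0 x) ^ k * indicator {0..} x * exp (- (c * x))" for x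
    using c by (auto simp: power_mult_distrib max_def zero_le_mult_iff split: split_indicator)
  ultimately show ?thesis by simp
qed

lemma exp_neg_tendsto:
  fixes s :: complex
  assumes s: "Re s > 0"
  shows "((\<lambda>x::real. of_real x ^ k * exp (- s * of_real x)) \<longlongrightarrow> 0) at_top"
proof (rule tendsto_norm_zero_cancel)
  have "((\<lambda>x. x ^ k / exp (Re s * x)) \<longlongrightarrow> 0) at_top"
    using s by real_asymp
  then show "((\<lambda>x::real. norm (of_real x ^ k * exp (- s * of_real x))) \<longlongrightarrow> 0) at_top"
  proof (rule Lim_transform_eventually)
    show "\<forall>\<^sub>F x in at_top. x ^ k / exp (Re s * x) = norm (of_real x ^ k * exp (- s * of_real x))"
      using eventually_ge_at_top[of 0]
    proof eventually_elim
      case (elim x)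
      have "norm (exp (- s * of_real x)) = exp (- (Re s * x))" by (simp add: norm_exp_eq_Re)
      then show ?case using elim by (simp add: norm_mult norm_power exp_minus divide_inverse)
    qed
  qed
qed

lemma laplace_aux:
  fixes s :: complex and f F :: "real \<Rightarrow> complex"
  assumes F: "\<And>x. (F has_vector_derivative f x) (at x)" and f: "\<And>x. isCont f x"
    and int: "integrable lborel (\<lambda>x. indicator {0..} x *\<^sub>R f x)" and lim: "(F \<longlongrightarrow> 0) at_top"
  shows "has_bochner_integral lborel (\<lambda>x. indicator {0..} x *\<^sub>R f x) (- F 0)"
proof -
  have isF: "isCont F x" for x
    using F[of x] by (rule has_vector_derivative_continuous)
  have si: "set_integrable lborel (einterval 0 \<infinity>) f"
  proof -
    have "set_integrable lborel {0..} f" using int by (simp add: set_integrable_def)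
    then show ?thesis by (rule set_integrable_subset) (auto simp: einterval_def)
  qed
  have "(LBINT x=0..\<infinity>. f x) = 0 - F 0"
  proof (rule interval_integral_FTC_integrable[OF _ F f si])
    have "(F \<longlongrightarrow> F 0) (at_right 0)"
      using isF[of 0] by (auto simp: isCont_def intro: tendsto_within_subset filterlim_at_split[THEN iffD1])
    then show "((F \<circ> real_of_ereal) \<longlongrightarrow> F 0) (at_right 0)"
      by (simp add: ereal_tendsto_simps1 zero_ereal_def)
    show "((F \<circ> real_of_ereal) \<longlongrightarrow> 0) (at_left \<infinity>)"
      using lim by (simp add: ereal_tendsto_simps1)
  qed simp
  also have "(LBINT x=0..\<infinity>. f x) = (LBINT x:{0<..}. f x)"
    by (simp add: interval_lebesgue_integral_def einterval_def greaterThan_def zero_ereal_def)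
  also have "\<dots> = (LINT x|lborel. indicator {0..} x *\<^sub>R f x)"
    unfolding set_lebesgue_integral_def
  proof (rule integral_cong_AE)
    have [measurable]: "f \<in> borel_measurable borel"
      using f by (intro borel_measurable_continuous_onI) (simp add: continuous_on_eq_continuous_at)
    show "(\<lambda>x. indicator {0<..} x *\<^sub>R f x) \<in> borel_measurable lborel"
      "(\<lambda>x. indicator {0..} x *\<^sub>R f x) \<in> borel_measurable lborel" by measurable
    have "AE x in lborel. x \<noteq> (0::real)" by (rule AE_lborel_singleton)
    then show "AE x in lborel. indicator {0<..} x *\<^sub>R f x = indicator {0..} x *\<^sub>R f x"
      by eventually_elim (auto split: split_indicator)
  qed
  finally show ?thesis using int by (simp add: has_bochner_integral_iff)
qed

lemma laplace_const:
  assumes s: "Re s > 0"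
  shows "has_bochner_integral lborel (\<lambda>x. indicator {0..} x *\<^sub>R exp (- s * of_real x)) (1 / s)"
proof -
  have s0: "s \<noteq> 0" using s by auto
  have "has_bochner_integral lborel (\<lambda>x. indicator {0..} x *\<^sub>R exp (- s * of_real x)) (- (- exp (- s * of_real 0) / s))"
  proof (rule laplace_aux)
    show "((\<lambda>x. - exp (- s * of_real x) / s) has_vector_derivative exp (- s * of_real x)) (at x)" for x :: real
      using s0 by (auto intro!: derivative_eq_intros has_vector_derivative_real_field)
    show "integrable lborel (\<lambda>x. indicator {0..} x *\<^sub>R exp (- s * of_real x))"
      by (rule Bochner_Integration.integrable_bound[OF laplace_integrable_real[OF s, of 0]])
        (auto intro!: AE_I2 split: split_indicator)
    show "((\<lambda>x. - exp (- s * of_real x) / s) \<longlongrightarrow> 0) at_top"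
      using tendsto_divide[OF tendsto_minus[OF exp_neg_tendsto[OF s, of 0]] tendsto_const[of s]] s0 by simp
  qed auto
  then show ?thesis by simp
qed

lemma laplace_linear:
  assumes s: "Re s > 0"
  shows "has_bochner_integral lborel (\<lambda>x. of_real (max 0 x) * exp (- s * of_real x)) (1 / s\<^sup>2)"
proof -
  have s0: "s \<noteq> 0" using s by auto
  have eq: "of_real (max 0 x) * exp (- s * of_real x) = indicator {0..} x *\<^sub>R (of_real x * exp (- s * of_real x))" for x
    by (auto simp: max_def split: split_indicator)
  let ?F = "\<lambda>x::real. - (of_real x / s + 1 / s\<^sup>2) * exp (- s * of_real x)"
  have h: "has_bochner_integral lborel (\<lambda>x. indicator {0..} x *\<^sub>R (of_real x * exp (- s * of_real x))) (- ?F 0)"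
  proof (rule laplace_aux)
    show "(?F has_vector_derivative of_real x * exp (- s * of_real x)) (at x)" for x :: real
    proof -
      have "((\<lambda>z. - (z / s + 1 / s\<^sup>2) * exp (- s * z)) has_field_derivative (of_real x * exp (- s * of_real x))) (at (of_real x))"
        using s0 by (auto intro!: derivative_eq_intros simp: field_simps power2_eq_square)
      then show ?thesis by (rule has_vector_derivative_real_field)
    qed
    show "integrable lborel (\<lambda>x. indicator {0..} x *\<^sub>R (of_real x * exp (- s * of_real x)))"
      by (rule Bochner_Integration.integrable_bound[OF laplace_integrable_real[OF s, of 1]])
        (auto intro!: AE_I2 simp: norm_mult split: split_indicator)
    have "((\<lambda>x::real. - (of_real x ^ 1 * exp (- s * of_real x) / s + of_real x ^ 0 * exp (- s * of_real x) / s\<^sup>2)) \<longlongrightarrow> - (0 / s + 0 / s\<^sup>2)) at_top"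
      using s0 by (intro tendsto_minus tendsto_add tendsto_divide exp_neg_tendsto s tendsto_const) auto
    then show "(?F \<longlongrightarrow> 0) at_top" by (simp add: algebra_simps)
  qed (auto intro!: continuous_intros)
  have v: "- ?F 0 = 1 / s\<^sup>2" by simp
  show ?thesis using h unfolding v eq .
qed

lemma laplace_shifted:
  assumes s: "Re s > 0"
  shows "has_bochner_integral lborel (\<lambda>x. of_real (max 0 (x - a)) * exp (- s * of_real x)) (exp (- s * of_real a) / s\<^sup>2)"
proof -
  have "has_bochner_integral lborel (\<lambda>x. of_real (max 0 (- a + 1 * x)) * exp (- s * of_real (- a + 1 * x))) ((1 / s\<^sup>2) /\<^sub>R \<bar>1\<bar>)"
    using laplace_linear[OF s] by (subst (asm) lborel_has_bochner_integral_real_affine_iff[where c = 1 and t = "- a"]) auto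
  then have h: "has_bochner_integral lborel (\<lambda>x. exp (- s * of_real a) * (of_real (max 0 (- a + 1 * x)) * exp (- s * of_real (- a + 1 * x)))) (exp (- s * of_real a) * ((1 / s\<^sup>2) /\<^sub>R \<bar>1\<bar>))"
    by (rule has_bochner_integral_mult_right)
  have eq: "exp (- s * of_real a) * (of_real (max 0 (- a + 1 * x)) * exp (- s * of_real (- a + 1 * x)))
      = of_real (max 0 (x - a)) * exp (- s * of_real x)" for x
  proof -
    have e: "exp (- s * of_real x) = exp (- s * of_real a) * exp (- s * of_real (- a + 1 * x))"
      by (simp add: exp_add[symmetric] algebra_simps)
    have m: "max 0 (- a + 1 * x) = max 0 (x - a)" by simp
    show ?thesis unfolding e m by (rule mult.left_commute)
  qed
  have v: "exp (- s * of_real a) * ((1 / s\<^sup>2) /\<^sub>R \<bar>1\<bar>) = exp (- s * of_real a) / s\<^sup>2" by simp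
  show ?thesis using h unfolding eq v .
qed

section \<open>The logarithmic sum in the variable u = log y: transform and decay\<close>

definition mlog_exp :: "real \<Rightarrow> real" where
  "mlog_exp u = mlog 1 (exp u)"

lemma ln_le_of_le_exp: "0 < (x::real) \<Longrightarrow> x \<le> exp u \<Longrightarrow> ln x \<le> u"
  using ln_le_cancel_iff[of x "exp u"] by simp

text \<open>Positive parts replace the cut-off, so the range of summation no longer depends on
  \<open>u\<close>: locally in \<open>u\<close> the function is one fixed finite sum of continuous
  functions.\<close>

lemma mlog_exp_eq_sum:
  assumes "exp u \<le> real N"
  shows "mlog_exp u = (\<Sum>n<Suc N. real_of_int (mu n) / real n * max 0 (u - ln (real n)))"
proof -
  have "(\<Sum>n<Suc N. real_of_int (mu n) / real n * max 0 (u - ln (real n)))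
      = (\<Sum>n | 1 \<le> n \<and> real n \<le> exp u \<and> coprime n 1. real_of_int (mu n) / real n * max 0 (u - ln (real n)))"
  proof (rule sum.mono_neutral_right)
    show "{n. 1 \<le> n \<and> real n \<le> exp u \<and> coprime n 1} \<subseteq> {..<Suc N}"
      using assms by (auto simp: less_Suc_eq_le)
    show "\<forall>n\<in>{..<Suc N} - {n. 1 \<le> n \<and> real n \<le> exp u \<and> coprime n 1}.
        real_of_int (mu n) / real n * max 0 (u - ln (real n)) = 0"
    proof
      fix n assume n: "n \<in> {..<Suc N} - {n. 1 \<le> n \<and> real n \<le> exp u \<and> coprime n 1}"
      show "real_of_int (mu n) / real n * max 0 (u - ln (real n)) = 0"
      proof (cases "n = 0")
        case False
        then have "exp u < real n" using n by auto
        then have "u < ln (real n)" by (metis exp_gt_zero ln_exp ln_less_cancel_iff less_trans)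
        then show ?thesis by simp
      qed simp
    qed
  qed simp
  also have "\<dots> = mlog_exp u"
    unfolding mlog_exp_def mlog_def
  proof (intro sum.cong refl)
    fix n assume "n \<in> {n. 1 \<le> n \<and> real n \<le> exp u \<and> coprime n (1::nat)}"
    then have n: "real n > 0" "real n \<le> exp u" by auto
    then have "ln (real n) \<le> u" by (intro ln_le_of_le_exp) auto
    moreover have "ln (exp u / real n) = u - ln (real n)" using n by (simp add: ln_div)
    ultimately show "real_of_int (mu n) / real n * max 0 (u - ln (real n)) = real_of_int (mu n) / real n * ln (exp u / real n)"
      by simp
  qed
  finally show ?thesis by simp
qed

lemma mlog_exp_continuous: "isCont mlog_exp u"
proof -
  obtain N :: nat where N: "exp (u + 1) \<le> real N" using real_arch_simple by blast
  have "isCont (\<lambda>u. \<Sum>n<Suc N. real_of_int (mu n) / real n * max 0 (u - ln (real n))) u"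
    by (intro continuous_intros)
  moreover have "\<forall>\<^sub>F x in nhds u. mlog_exp x = (\<Sum>n<Suc N. real_of_int (mu n) / real n * max 0 (x - ln (real n)))"
  proof -
    have "\<forall>\<^sub>F x in nhds u. x < u + 1"
      using eventually_nhds_in_open[of "{..<u + 1}" u] by simp
    then show ?thesis
    proof eventually_elim
      case (elim x)
      then have "exp x \<le> real N" using N by (meson exp_le_cancel_iff less_imp_le order_trans)
      then show ?case by (rule mlog_exp_eq_sum)
    qed
  qed
  ultimately show ?thesis using isCont_cong by force
qed

lemma mlog_exp_neg: "u < 0 \<Longrightarrow> mlog_exp u = 0"
  by (simp add: mlog_exp_def mlog_less_1)

text \<open>The trivial bound: a harmonic sum, at most 1 + u, times logarithms, at most u. It bounds
  the damped function in the Fourier argument and settles small \<open>u\<close>.\<close>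

lemma mlog_exp_bound:
  assumes "u \<ge> 0"
  shows "\<bar>mlog_exp u - 1\<bar> \<le> (1 + u)\<^sup>2"
proof -
  define N where "N = nat \<lfloor>exp u\<rfloor>"
  have N: "N \<ge> 1" "real N \<le> exp u" using assms by (auto simp: N_def le_nat_floor)
  have set: "{m. 1 \<le> m \<and> real m \<le> exp u \<and> coprime m 1} = {1..N}"
  proof
    show "{m. 1 \<le> m \<and> real m \<le> exp u \<and> coprime m (1::nat)} \<subseteq> {1..N}"
      by (auto simp: N_def le_nat_floor)
    show "{1..N} \<subseteq> {m. 1 \<le> m \<and> real m \<le> exp u \<and> coprime m (1::nat)}"
      using N(2) by (auto intro: order_trans[OF of_nat_mono])
  qed
  have "\<bar>mlog_exp u\<bar> \<le> (\<Sum>m\<in>{1..N}. \<bar>real_of_int (mu m) / real m * ln (exp u / real m)\<bar>)"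
    unfolding mlog_exp_def mlog_def set by (rule sum_abs)
  also have "\<dots> \<le> (\<Sum>m\<in>{1..N}. inverse (real m) * u)"
  proof (rule sum_mono)
    fix m assume m: "m \<in> {1..N}"
    have 1: "\<bar>real_of_int (mu m)\<bar> \<le> 1" using abs_mu_le[of m] by linarith
    have m1: "real m \<ge> 1" "real m \<le> exp u" using m N by auto
    have "ln (exp u / real m) = u - ln (real m)" using m1 by (simp add: ln_div)
    moreover have "ln (real m) \<ge> 0" using m1 by simp
    moreover have "ln (real m) \<le> u" using m1 by (intro ln_le_of_le_exp) auto
    ultimately have 2: "\<bar>ln (exp u / real m)\<bar> \<le> u" by simp
    have "\<bar>real_of_int (mu m)\<bar> / real m \<le> 1 / real m" using 1 m1 by (intro divide_right_mono) auto
    then have "(\<bar>real_of_int (mu m)\<bar> / real m) * \<bar>ln (exp u / real m)\<bar> \<le> (1 / real m) * u"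
      using 2 m1 by (intro mult_mono) auto
    then show "\<bar>real_of_int (mu m) / real m * ln (exp u / real m)\<bar> \<le> inverse (real m) * u"
      by (simp add: abs_mult divide_inverse)
  qed
  also have "\<dots> = harm N * u"
    by (simp add: harm_def sum_distrib_right)
  also have "\<dots> \<le> (1 + u) * u"
  proof (rule mult_right_mono[OF _ assms])
    have "harm N - ln (of_nat N) \<le> harm 1 - ln (of_nat 1 :: real)"
      using N by (intro euler_mascheroni_sequence_decreasing) auto
    then have "harm N \<le> 1 + ln (real N)" by (simp add: harm_def[of "Suc 0"])
    also have "ln (real N) \<le> u" using N by (intro ln_le_of_le_exp) auto
    finally show "harm N \<le> 1 + u" by simp
  qed
  finally have "\<bar>mlog_exp u\<bar> \<le> (1 + u) * u" .
  moreover have "(1 + u) * u + 1 \<le> (1 + u)\<^sup>2" using assms by (simp add: power2_eq_square algebra_simps)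
  ultimately show ?thesis by linarith
qed

lemma laplace_shifted_norm:
  fixes a c :: real
  assumes c: "c > 0"
  shows "has_bochner_integral lborel (\<lambda>x. max 0 (x - a) * exp (- c * x)) (exp (- c * a) / c\<^sup>2)"
proof -
  have h: "has_bochner_integral lborel (\<lambda>x. Re (of_real (max 0 (x - a)) * exp (- of_real c * of_real x)))
      (Re (exp (- of_real c * of_real a) / (of_real c)\<^sup>2))"
    using c by (intro has_bochner_integral_bounded_linear[OF bounded_linear_Re] laplace_shifted) simp
  have e: "exp (- of_real c * of_real x) = (of_real (exp (- c * x)) :: complex)" for x
    by (simp add: exp_of_real[symmetric])
  have v: "Re (of_real (exp (- c * a)) / (of_real c)\<^sup>2) = exp (- c * a) / c\<^sup>2"
    by (metis Re_complex_of_real of_real_divide of_real_power)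
  show ?thesis using h unfolding e v by simp
qed

text \<open>Termwise integration: the n-th summand transforms to mu(n) n^(-1-s)/s^2. The interchange
  is justified because the integrals of the norms are at most n^(-1 - Re s)/(Re s)^2, which is
  summable.\<close>

lemma laplace_Lm:
  assumes s: "Re s > 0"
  shows "has_bochner_integral lborel (\<lambda>u. of_real (mlog_exp u) * exp (- s * of_real u)) (moebius_series s / s\<^sup>2)"
proof -
  define f where "f n u = of_real (real_of_int (mu n) / real n) * (of_real (max 0 (u - ln (real n))) * exp (- s * of_real u))"
    for n :: nat and u :: real
  have fi: "has_bochner_integral lborel (f n) (of_real (real_of_int (mu n) / real n) * (exp (- s * of_real (ln (real n))) / s\<^sup>2))" for n
    unfolding f_def by (intro has_bochner_integral_mult_right laplace_shifted s)
  have fval: "of_real (real_of_int (mu n) / real n) * (exp (- s * of_real (ln (real n))) / s\<^sup>2) = of_int (mu n) * dirichlet_term s n / s\<^sup>2" for n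
  proof (cases "n = 0")
    case False
    then have "of_nat n powr (- 1 - s) = exp (- s * of_real (ln (real n))) / (of_nat n :: complex)"
      by (simp add: powr_def algebra_simps exp_diff exp_minus exp_of_real divide_inverse exp_add)
    then show ?thesis by (simp add: dirichlet_term_def)
  qed simp
  have fs: "(\<lambda>n. f n u) sums (of_real (mlog_exp u) * exp (- s * of_real u))" and fns: "summable (\<lambda>n. norm (f n u))" for u
  proof -
    obtain N :: nat where N: "exp u \<le> real N" using real_arch_simple by blast
    have z: "f n u = 0" if "n \<notin> {..<Suc N}" for n
    proof -
      have "real n \<ge> exp u" using that N by (simp add: not_less_eq order_trans)
      moreover have "exp u > 0" by simp
      ultimately have "ln (exp u) \<le> ln (real n)" by (intro ln_mono)
      then have "ln (real n) \<ge> u" by simp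
      then show ?thesis by (simp add: f_def)
    qed
    have "(\<lambda>n. f n u) sums (\<Sum>n<Suc N. f n u)" by (rule sums_finite) (use z in auto)
    also have "(\<Sum>n<Suc N. f n u) = of_real (\<Sum>n<Suc N. real_of_int (mu n) / real n * max 0 (u - ln (real n))) * exp (- s * of_real u)"
      unfolding f_def of_real_sum sum_distrib_right by (intro sum.cong refl) simp
    also have "(\<Sum>n<Suc N. real_of_int (mu n) / real n * max 0 (u - ln (real n))) = mlog_exp u"
      using mlog_exp_eq_sum[OF N] by simp
    finally show "(\<lambda>n. f n u) sums (of_real (mlog_exp u) * exp (- s * of_real u))" .
    show "summable (\<lambda>n. norm (f n u))" by (rule summable_finite[of "{..<Suc N}"]) (use z in auto)
  qed
  have nint: "(LINT u|lborel. norm (f n u)) \<le> real n powr (-1 - Re s) / (Re s)\<^sup>2" for n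
  proof (cases "n = 0")
    case False
    have "norm (f n u) = \<bar>real_of_int (mu n)\<bar> / real n * (max 0 (u - ln (real n)) * exp (- Re s * u))" for u
      by (simp add: f_def norm_mult norm_divide norm_exp_eq_Re)
    then have "(LINT u|lborel. norm (f n u)) = \<bar>real_of_int (mu n)\<bar> / real n * (exp (- Re s * ln (real n)) / (Re s)\<^sup>2)"
      using laplace_shifted_norm[OF s, of "ln (real n)"] by (simp add: has_bochner_integral_iff)
    also have "\<dots> \<le> 1 / real n * (exp (- Re s * ln (real n)) / (Re s)\<^sup>2)"
      using abs_mu_le[of n] by (intro mult_right_mono divide_right_mono) auto
    also have "\<dots> = real n powr (-1 - Re s) / (Re s)\<^sup>2"
      using False by (simp add: powr_def algebra_simps exp_diff exp_minus divide_inverse exp_add)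
    finally show ?thesis .
  qed (simp add: f_def)
  have sum_n: "summable (\<lambda>n. LINT u|lborel. norm (f n u))"
  proof (rule summable_comparison_test')
    show "summable (\<lambda>n. real n powr (-1 - Re s) / (Re s)\<^sup>2)"
      using s by (intro summable_divide summable_nat_powr) simp
    show "norm (LINT u|lborel. norm (f n u)) \<le> real n powr (-1 - Re s) / (Re s)\<^sup>2" if "n \<ge> 0" for n
      using nint[of n] by simp
  qed
  have int: "integrable lborel (f n)" for n
    using fi[of n] by (simp add: has_bochner_integral_iff)
  have AE: "AE u in lborel. summable (\<lambda>n. norm (f n u))" using fns by simp
  have sm: "(\<Sum>n. f n u) = of_real (mlog_exp u) * exp (- s * of_real u)" for u
    using fs[of u] by (simp add: sums_iff)
  have 1: "integrable lborel (\<lambda>u. of_real (mlog_exp u) * exp (- s * of_real u))"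
    using integrable_suminf[OF int AE sum_n] unfolding sm .
  have fint: "integral\<^sup>L lborel (f n) = of_int (mu n) * dirichlet_term s n / s\<^sup>2" for n
    using has_bochner_integral_integral_eq[OF fi[of n]] unfolding fval .
  have 2: "(\<lambda>n. of_int (mu n) * dirichlet_term s n / s\<^sup>2) sums (LINT u|lborel. of_real (mlog_exp u) * exp (- s * of_real u))"
    using sums_integral[OF int AE sum_n] unfolding sm fint .
  have "(\<lambda>n. of_int (mu n) * dirichlet_term s n) summable_on UNIV"
    using s by (intro muf_sum_on) (auto simp: dirichlet_term_facts dirichlet_term_summable)
  then have "(\<lambda>n. of_int (mu n) * dirichlet_term s n) sums moebius_series s"
    unfolding moebius_series_def by (intro has_sum_imp_sums has_sum_infsum)
  then have "(\<lambda>n. of_int (mu n) * dirichlet_term s n / s\<^sup>2) sums (moebius_series s / s\<^sup>2)" by (rule sums_divide)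
  then show ?thesis using 1 2 sums_unique2 by (auto simp: has_bochner_integral_iff)
qed

definition excess_integrand :: "complex \<Rightarrow> real \<Rightarrow> complex" where
  "excess_integrand s u = indicator {0..} u *\<^sub>R (of_real (mlog_exp u - 1) * exp (- s * of_real u))"

lemma excess_integrand_laplace:
  assumes s: "Re s > 0"
  shows "has_bochner_integral lborel (excess_integrand s) (excess_transform s)"
proof -
  have h: "has_bochner_integral lborel (\<lambda>u. of_real (mlog_exp u) * exp (- s * of_real u) - indicator {0..} u *\<^sub>R exp (- s * of_real u))
      (moebius_series s / s\<^sup>2 - 1 / s)"
    by (intro has_bochner_integral_diff laplace_Lm laplace_const s)
  have e: "(\<lambda>u. of_real (mlog_exp u) * exp (- s * of_real u) - indicator {0..} u *\<^sub>R exp (- s * of_real u)) = excess_integrand s"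
    by (auto simp: excess_integrand_def mlog_exp_neg algebra_simps fun_eq_iff split: split_indicator)
  have s0: "s \<noteq> 0" using s by auto
  have z1: "zeta_shift s \<noteq> 0" using zeta_shift_Mob[OF s] by auto
  then have z: "zeta_shift s \<noteq> 0" "moebius_series s = 1 / zeta_shift s"
    using zeta_shift_Mob[OF s] by (simp_all add: nonzero_eq_divide_eq mult.commute)
  have "moebius_series s / s\<^sup>2 - 1 / s = excess_transform s"
    using s0 z by (simp add: excess_transform_def szeta_eq_zeta1[OF s] field_simps power2_eq_square)
  then show ?thesis using h unfolding e by simp
qed

lemma integrable_inverse_abs_powr: "integrable lborel (\<lambda>t::real. (2 + \<bar>t\<bar>) powr (-3/2))"
proof -
  define P where "P x = indicator {2..} x * x powr (-3/2)" for x :: real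
  have "((\<lambda>x::real. x powr (-3/2)) has_integral - (2 powr (-3/2 + 1)) / (-3/2 + 1)) {2..}"
    by (intro has_integral_powr_to_inf) auto
  then have "(\<lambda>x::real. x powr (-3/2)) absolutely_integrable_on {2..}"
    by (intro nonnegative_absolutely_integrable_1) auto
  then have "integrable lebesgue P"
    unfolding set_integrable_def P_def by simp
  moreover have [measurable]: "P \<in> borel_measurable lborel"
    unfolding P_def by measurable
  ultimately have P: "integrable lborel P" by (simp add: integrable_completion)
  have i1: "integrable lborel (\<lambda>t. P (2 + 1 * t))" "integrable lborel (\<lambda>t. P (2 + (-1) * t))"
    by (intro lborel_integrable_real_affine[OF P], simp)+
  show ?thesis
  proof (rule Bochner_Integration.integrable_bound[OF Bochner_Integration.integrable_add[OF i1]])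
    show "AE t in lborel. norm ((2 + \<bar>t\<bar>) powr (-3/2)) \<le> norm (P (2 + 1 * t) + P (2 + (-1) * t))"
      by (intro AE_I2) (auto simp: P_def abs_if split: split_indicator)
  qed measurable
qed

text \<open>For given \<open>u\<close> put c = 1/u, both as abscissa and as step. Multiplication by
  2 - 2 cos(cv) turns the transform into minus its second difference, of size c^2, so the Fourier
  inequality gives K W/u^2. At v = u the multiplier times the damping is the fixed positive number
  \<open>q\<close>. The restriction \<open>u \<ge> 2\<close> is \<open>c \<le> 1/2\<close>.\<close>

lemma mlog_exp_decay:
  obtains C where "C > 0" "\<And>u. u \<ge> 2 \<Longrightarrow> \<bar>mlog_exp u - 1\<bar> \<le> C / u\<^sup>2"
proof -
  obtain K where K: "K > 0" "\<And>c t h. 0 < c \<Longrightarrow> c \<le> 1/2 \<Longrightarrow> 0 < h \<Longrightarrow> h \<le> 1 \<Longrightarrow>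
    norm (excess_transform (Complex c t + \<i> * of_real h) + excess_transform (Complex c t - \<i> * of_real h) - 2 * excess_transform (Complex c t))
      \<le> K * h\<^sup>2 * (2 + \<bar>t\<bar>) powr (-3/2)"
    using excess_transform_second_difference by blast
  define W where "W = (LINT t|lborel. (2 + \<bar>t\<bar>) powr (-3/2 :: real))"
  have W: "W \<ge> 0" unfolding W_def by (intro Bochner_Integration.integral_nonneg) simp
  define q where "q = (2 - 2 * cos (1::real)) * exp (-1)"
  have "cos (1::real) < cos 0" using pi_gt3 by (intro cos_monotone_0_pi) auto
  then have q: "q > 0" by (simp add: q_def)
  show thesis
  proof (rule that)
    show "(K * W + 1) / q > 0" using K W q by (simp add: add_nonneg_pos)
    fix u :: real assume u: "u \<ge> 2"
    define c where "c = 1 / u"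
    have c: "0 < c" "c \<le> 1/2" "c \<le> 1" using u by (auto simp: c_def)
    have cu: "c * u = 1" using u by (simp add: c_def)
    define f where "f v = excess_integrand (of_real c) v * of_real (2 - 2 * cos (c * v))" for v
    define g where "g t = K * c\<^sup>2 * (2 + \<bar>t\<bar>) powr (-3/2)" for t
    have fexp: "f v * iexp (- (t * v)) = 2 * excess_integrand (Complex c t) v - excess_integrand (Complex c t + \<i> * of_real c) v - excess_integrand (Complex c t - \<i> * of_real c) v" for t v
    proof -
      define X where "X = exp (- of_real c * of_real v) * iexp (- (t * v))"
      have X: "exp (- Complex c t * of_real v) = X"
        unfolding X_def by (simp add: exp_add[symmetric] Complex_eq algebra_simps)
      have X1: "exp (- (Complex c t + \<i> * of_real c) * of_real v) = X * exp (- (\<i> * of_real (c * v)))"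
        unfolding X[symmetric] by (simp add: exp_add[symmetric] algebra_simps)
      have X2: "exp (- (Complex c t - \<i> * of_real c) * of_real v) = X * exp (\<i> * of_real (c * v))"
        unfolding X[symmetric] by (simp add: exp_add[symmetric] algebra_simps)
      have cs: "of_real (2 - 2 * cos (c * v)) = 2 - (exp (\<i> * of_real (c * v)) + exp (- (\<i> * of_real (c * v))))"
      proof -
        have cc: "complex_of_real (cos (c * v)) = (exp (\<i> * of_real (c * v)) + exp (- (\<i> * of_real (c * v)))) / 2"
          unfolding cos_of_real[symmetric] by (rule cos_exp_eq)
        have "complex_of_real (2 - 2 * cos (c * v)) = 2 - 2 * complex_of_real (cos (c * v))" by simp
        also have "\<dots> = 2 - (exp (\<i> * of_real (c * v)) + exp (- (\<i> * of_real (c * v))))"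
        proof -
          have half: "2 * ((a + b) / 2) = a + b" for a b :: complex by simp
          show ?thesis unfolding cc half ..
        qed
        finally show ?thesis .
      qed
      have "f v * iexp (- (t * v)) = indicator {0..} v *\<^sub>R (of_real (mlog_exp v - 1) * X) * of_real (2 - 2 * cos (c * v))"
        unfolding f_def excess_integrand_def X_def by (simp add: mult_ac)
      then show ?thesis
        unfolding cs excess_integrand_def X X1 X2 by (auto simp: algebra_simps split: split_indicator)
    qed
    have fint: "has_bochner_integral lborel (\<lambda>v. f v * iexp (- (t * v)))
        (2 * excess_transform (Complex c t) - excess_transform (Complex c t + \<i> * of_real c) - excess_transform (Complex c t - \<i> * of_real c))" for t
      unfolding fexp using c
      by (intro has_bochner_integral_diff has_bochner_integral_mult_right excess_integrand_laplace) auto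
    have "norm (f u) \<le> (LINT t|lborel. g t)"
    proof (rule fourier_inversion_bound)
      have "f = (\<lambda>v. f v * iexp (- (0 * v)))" by simp
      then show "integrable lborel f" using fint[of 0] by (simp add: has_bochner_integral_iff)
      show "integrable lborel g" unfolding g_def by (intro integrable_mult_right integrable_inverse_abs_powr)
      show "norm (LINT v|lborel. f v * iexp (- (t * v))) \<le> g t" for t
      proof -
        have "norm (LINT v|lborel. f v * iexp (- (t * v)))
            = norm (- (excess_transform (Complex c t + \<i> * of_real c) + excess_transform (Complex c t - \<i> * of_real c) - 2 * excess_transform (Complex c t)))"
          unfolding has_bochner_integral_integral_eq[OF fint[of t]] by (rule arg_cong[where f = norm]) simp
        also have "\<dots> \<le> g t"
          unfolding norm_minus_cancel g_def using c by (intro K(2)) auto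
        finally show ?thesis .
      qed
      \<comment> \<open>Quadratic growth is absorbed by the damping: 1 + v \<le> (1 + 2/c)(1 + cv/2)
        \<le> (1 + 2/c) exp(cv/2), then square. The 4 bounds 2 - 2 cos.\<close>
      show "norm (f v) \<le> 4 * (1 + 2 / c)\<^sup>2" for v
      proof (cases "v \<ge> 0")
        case True
        have "1 + v \<le> (1 + 2 / c) * (1 + c * v / 2)"
          using c True by (simp add: field_simps)
        also have "\<dots> \<le> (1 + 2 / c) * exp (c * v / 2)"
          using c by (intro mult_left_mono exp_ge_add_one_self) auto
        finally have "(1 + v)\<^sup>2 \<le> ((1 + 2 / c) * exp (c * v / 2))\<^sup>2"
          using True by (intro power_mono) auto
        also have "\<dots> = (1 + 2 / c)\<^sup>2 * exp (c * v)"
          by (simp add: power_mult_distrib exp_double[symmetric])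
        finally have "\<bar>mlog_exp v - 1\<bar> \<le> (1 + 2 / c)\<^sup>2 * exp (c * v)"
          using mlog_exp_bound[OF True] by linarith
        then have 1: "\<bar>mlog_exp v - 1\<bar> * exp (- (c * v)) \<le> (1 + 2 / c)\<^sup>2"
          by (simp add: exp_minus field_simps)
        have 2: "\<bar>2 - 2 * cos (c * v)\<bar> \<le> 4" using cos_ge_minus_one[of "c * v"] cos_le_one[of "c * v"] by linarith
        have "norm (f v) = \<bar>mlog_exp v - 1\<bar> * exp (- (c * v)) * \<bar>2 - 2 * cos (c * v)\<bar>"
          using True unfolding f_def excess_integrand_def norm_mult norm_scaleR norm_of_real by (simp add: norm_exp_eq_Re)
        also have "\<dots> \<le> (1 + 2 / c)\<^sup>2 * 4"
          using 1 2 by (intro mult_mono) auto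
        finally show ?thesis by simp
      qed (simp add: f_def excess_integrand_def)
      have cont: "isCont (\<lambda>v. of_real (mlog_exp v - 1) * exp (- of_real c * of_real v) * of_real (2 - 2 * cos (c * v)) :: complex) u"
        using mlog_exp_continuous[of u] by (intro continuous_intros) auto
      have ev: "\<forall>\<^sub>F v in nhds u. f v = of_real (mlog_exp v - 1) * exp (- of_real c * of_real v) * of_real (2 - 2 * cos (c * v))"
      proof -
        have "\<forall>\<^sub>F v in nhds u. v \<in> {0<..}" using u by (intro eventually_nhds_in_open) auto
        then show ?thesis by eventually_elim (simp add: f_def excess_integrand_def)
      qed
      show "isCont f u" using cont isCont_cong[OF ev] by (simp only:)
    qed
    also have "\<dots> = K * c\<^sup>2 * W" unfolding g_def W_def by simp
    also have "norm (f u) = \<bar>mlog_exp u - 1\<bar> * q"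
    proof -
      have "2 - 2 * cos (1::real) \<ge> 0" using cos_le_one[of "1::real"] by linarith
      then show ?thesis
        using u unfolding f_def excess_integrand_def norm_mult norm_scaleR norm_of_real q_def by (simp add: norm_exp_eq_Re cu)
    qed
    finally have "\<bar>mlog_exp u - 1\<bar> * q \<le> K * c\<^sup>2 * W" .
    then have "\<bar>mlog_exp u - 1\<bar> \<le> K * c\<^sup>2 * W / q" using q by (simp add: pos_le_divide_eq)
    also have "\<dots> = (K * W) / q / u\<^sup>2" by (simp add: c_def power_divide)
    also have "\<dots> \<le> (K * W + 1) / q / u\<^sup>2" using q by (intro divide_right_mono) auto
    finally show "\<bar>mlog_exp u - 1\<bar> \<le> (K * W + 1) / q / u\<^sup>2" .
  qed
qed

lemma mlog_decay:
  obtains C where "\<And>y. y \<ge> 1 \<Longrightarrow> \<bar>mlog 1 y - 1\<bar> \<le> C * log_weight y"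
proof -
  obtain C where C: "C > 0" "\<And>u. u \<ge> 2 \<Longrightarrow> \<bar>mlog_exp u - 1\<bar> \<le> C / u\<^sup>2"
    using mlog_exp_decay by blast
  show thesis
  proof (rule that)
    fix y :: real assume y: "y \<ge> 1"
    define u where "u = ln y"
    have u: "u \<ge> 0" "y = exp u" using y by (auto simp: u_def)
    have w: "log_weight y = 1 / (8 + u)\<^sup>2" using y by (simp add: log_weight_def shifted_log_def u_def max_def)
    have L: "mlog 1 y = mlog_exp u" by (simp add: mlog_exp_def u(2))
    \<comment> \<open>25 = 5^2 since 8 + u \<le> 5u for u \<ge> 2; 900 = 9 * 10^2 from the trivial
      bound 9 and 8 + u \<le> 10 for u < 2.\<close>
    show "\<bar>mlog 1 y - 1\<bar> \<le> (25 * C + 900) * log_weight y"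
    proof (cases "u \<ge> 2")
      case True
      have "(8 + u)\<^sup>2 \<le> (5 * u)\<^sup>2" using True by (intro power_mono) auto
      then have "C * (8 + u)\<^sup>2 \<le> C * (25 * u\<^sup>2)" using C(1) by (intro mult_left_mono) (auto simp: power_mult_distrib)
      then have "C / u\<^sup>2 \<le> 25 * C / (8 + u)\<^sup>2"
        using True by (simp add: divide_le_eq le_divide_eq mult_ac)
      also have "\<dots> \<le> (25 * C + 900) / (8 + u)\<^sup>2" by (intro divide_right_mono) auto
      finally show ?thesis using C(2)[OF True] unfolding L w by simp
    next
      case False
      have "(1 + u)\<^sup>2 \<le> 3\<^sup>2" using False u by (intro power_mono) auto
      then have 1: "\<bar>mlog_exp u - 1\<bar> \<le> 9" using mlog_exp_bound[OF u(1)] by simp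
      have "(8 + u)\<^sup>2 \<le> 10\<^sup>2" using False u by (intro power_mono) auto
      then have "9 \<le> 900 / (8 + u)\<^sup>2" using u by (simp add: le_divide_eq)
      also have "\<dots> \<le> (25 * C + 900) / (8 + u)\<^sup>2" using C(1) by (intro divide_right_mono) auto
      finally show ?thesis using 1 unfolding L w by simp
    qed
  qed
qed

section \<open>Passage to functions with derivative of bounded variation\<close>

text \<open>The set \<open>D\<close> of points of differentiability is Borel: by continuity the
  Cauchy criterion for difference quotients needs only rational increments, so countable operations
  suffice. On \<open>D\<close> the derivative is a limit of measurable quotients, off
  \<open>D\<close> it is one constant.\<close>

lemma deriv_borel_measurable:
  fixes h :: "real \<Rightarrow> real"
  assumes h: "continuous_on UNIV h"
  shows "deriv h \<in> borel_measurable borel"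
proof -
  define q where "q r x = (h (x + r) - h x) / r" for r x
  have hm[measurable]: "h \<in> borel_measurable borel" using h by (rule borel_measurable_continuous_onI)
  have qm[measurable]: "q r \<in> borel_measurable borel" for r unfolding q_def by measurable
  define R where "R n = {r \<in> \<rat>. 0 < \<bar>r\<bar> \<and> \<bar>r\<bar> < inverse (real (Suc n))}" for n
  have R: "countable (R n)" for n
    by (rule countable_subset[OF _ countable_rat]) (auto simp: R_def)
  define D where "D = (\<Inter>k::nat. \<Union>n::nat. \<Inter>r\<in>R n. \<Inter>s\<in>R n. {x. \<bar>q r x - q s x\<bar> \<le> inverse (real (Suc k))})"
  have "{x. \<bar>q r x - q s x\<bar> \<le> e} \<in> sets borel" for r s e
    by measurable
  then have inner: "(\<Inter>r\<in>R n. \<Inter>s\<in>R n. {x. \<bar>q r x - q s x\<bar> \<le> e}) \<in> sets borel" for n e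
    by (intro sets.countable_INT'' R) auto
  have "(\<Union>n::nat. \<Inter>r\<in>R n. \<Inter>s\<in>R n. {x. \<bar>q r x - q s x\<bar> \<le> e}) \<in> sets borel" for e
    by (intro sets.countable_UN'' inner) auto
  then have Dm[measurable]: "D \<in> sets borel"
    unfolding D_def by (intro sets.countable_INT'') auto
  have Rne: "R n \<noteq> {}" for n
  proof -
    obtain r where "r \<in> \<rat>" "0 < r" "r < inverse (real (Suc n))"
      using Rats_dense_in_real[of 0 "inverse (real (Suc n))"] by auto
    then show ?thesis by (auto simp: R_def)
  qed
  have Dmem: "x \<in> D \<longleftrightarrow> (\<forall>k. \<exists>n. \<forall>r\<in>R n. \<forall>s\<in>R n. \<bar>q r x - q s x\<bar> \<le> inverse (real (Suc k)))" for x
    unfolding D_def by (simp only: INT_iff UN_iff mem_Collect_eq UNIV_I ball_UNIV bex_UNIV)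
  have diffD: "x \<in> D \<longleftrightarrow> (\<exists>l. (h has_real_derivative l) (at x))" for x
  proof
    assume "\<exists>l. (h has_real_derivative l) (at x)"
    then obtain l where "((\<lambda>r. q r x) \<longlongrightarrow> l) (at 0)"
      unfolding q_def DERIV_def by blast
    note lim = this
    have "\<exists>n. \<forall>r\<in>R n. \<forall>s\<in>R n. \<bar>q r x - q s x\<bar> \<le> inverse (real (Suc k))" for k
    proof -
      let ?e = "inverse (real (Suc k)) / 2"
      have "\<forall>\<^sub>F r in at 0. dist (q r x) l < ?e" using lim by (rule tendstoD) simp
      then obtain d where d: "d > 0" "\<And>r. r \<noteq> 0 \<Longrightarrow> \<bar>r\<bar> < d \<Longrightarrow> \<bar>q r x - l\<bar> < ?e"
        unfolding eventually_at by (auto simp: dist_real_def)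
      obtain n where n: "inverse (real (Suc n)) < d" using reals_Archimedean[OF d(1)] by blast
      have near: "\<bar>q r x - l\<bar> < ?e" if "r \<in> R n" for r
        using that n by (intro d(2)) (auto simp: R_def)
      show ?thesis
      proof (intro exI[of _ n] ballI)
        fix r s assume "r \<in> R n" "s \<in> R n"
        then show "\<bar>q r x - q s x\<bar> \<le> inverse (real (Suc k))"
          using near[of r] near[of s] by linarith
      qed
    qed
    then show "x \<in> D" unfolding Dmem by (rule allI)
  next
    assume "x \<in> D"
    then have "\<forall>k. \<exists>n. \<forall>r\<in>R n. \<forall>s\<in>R n. \<bar>q r x - q s x\<bar> \<le> inverse (real (Suc k))"
      unfolding Dmem .
    then obtain n where n': "\<forall>k. \<forall>r\<in>R (n k). \<forall>s\<in>R (n k). \<bar>q r x - q s x\<bar> \<le> inverse (real (Suc k))"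
      unfolding choice_iff by (rule exE)
    have n: "\<bar>q r x - q s x\<bar> \<le> inverse (real (Suc k))" if "r \<in> R (n k)" "s \<in> R (n k)" for k r s
      using n'[rule_format, OF that] .
    \<comment> \<open>A strict violation at a real increment \<open>r\<close> would, by continuity
      in \<open>r\<close>, persist at a nearby rational one.\<close>
    have ext: "\<bar>q r x - q s x\<bar> \<le> inverse (real (Suc k))"
      if rs: "0 < \<bar>r\<bar>" "\<bar>r\<bar> < inverse (real (Suc (n k)))" and s: "s \<in> R (n k)" for r s k
    proof (rule ccontr)
      assume neg: "\<not> ?thesis"
      have "isCont (\<lambda>r. \<bar>q r x - q s x\<bar>) r"
      proof -
        have "isCont (\<lambda>r. h (x + r)) r"
        proof (rule isCont_o2[where g = h])
          show "isCont (\<lambda>r. x + r) r" by (intro continuous_intros)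
          show "isCont h (x + r)" using h by (simp add: continuous_on_eq_continuous_at)
        qed
        then show ?thesis unfolding q_def using rs by (intro continuous_intros) auto
      qed
      then have lim: "((\<lambda>y. \<bar>q y x - q s x\<bar>) \<longlongrightarrow> \<bar>q r x - q s x\<bar>) (nhds r)"
        unfolding isCont_def
        using tendsto_at_iff_tendsto_nhds[of "\<lambda>y. \<bar>q y x - q s x\<bar>" r] by simp
      have "\<forall>\<^sub>F y in nhds r. \<bar>q y x - q s x\<bar> > inverse (real (Suc k))"
        by (rule order_tendstoD(1)[OF lim]) (use neg in simp)
      moreover have "\<forall>\<^sub>F y in nhds r. y \<in> {y. 0 < \<bar>y\<bar>} \<inter> {y. \<bar>y\<bar> < inverse (real (Suc (n k)))}"
        using rs by (intro eventually_nhds_in_open open_Int open_Collect_less continuous_intros) auto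
      ultimately have "\<forall>\<^sub>F y in nhds r. \<bar>q y x - q s x\<bar> > inverse (real (Suc k)) \<and> 0 < \<bar>y\<bar> \<and> \<bar>y\<bar> < inverse (real (Suc (n k)))"
        by eventually_elim auto
      then obtain e where e: "e > 0" "\<And>y. dist y r < e \<Longrightarrow> \<bar>q y x - q s x\<bar> > inverse (real (Suc k)) \<and> 0 < \<bar>y\<bar> \<and> \<bar>y\<bar> < inverse (real (Suc (n k)))"
        unfolding eventually_nhds_metric by blast
      obtain y where y: "y \<in> \<rat>" "r < y" "y < r + e" using Rats_dense_in_real[of r "r + e"] e(1) by auto
      then have "dist y r < e" by (simp add: dist_real_def)
      from e(2)[OF this] y(1) n[of y k s] s show False by (auto simp: R_def)
    qed
    have "Cauchy (\<lambda>i. q (inverse (real (Suc i))) x)"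
    proof (rule metric_CauchyI)
      fix e :: real assume "e > 0"
      then obtain k where k: "inverse (real (Suc k)) < e / 2" using reals_Archimedean[of "e / 2"] by auto
      obtain s where s: "s \<in> R (n k)" using Rne by blast
      have near: "\<bar>q (inverse (real (Suc i))) x - q s x\<bar> < e / 2" if "i \<ge> Suc (n k)" for i
      proof -
        have "inverse (real (Suc i)) < inverse (real (Suc (n k)))" using that by simp
        then show ?thesis using ext[of "inverse (real (Suc i))" k s] s k by simp
      qed
      show "\<exists>M. \<forall>i\<ge>M. \<forall>j\<ge>M. dist (q (inverse (real (Suc i))) x) (q (inverse (real (Suc j))) x) < e"
      proof (intro exI[of _ "Suc (n k)"] allI impI)
        fix i j assume "i \<ge> Suc (n k)" "j \<ge> Suc (n k)"
        then show "dist (q (inverse (real (Suc i))) x) (q (inverse (real (Suc j))) x) < e"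
          using near[of i] near[of j] unfolding dist_real_def by linarith
      qed
    qed
    then obtain l where l: "(\<lambda>i. q (inverse (real (Suc i))) x) \<longlonglongrightarrow> l"
      using Cauchy_convergent convergent_def by blast
    have "((\<lambda>r. q r x) \<longlongrightarrow> l) (at 0)"
    proof (rule tendstoI)
      fix e :: real assume "e > 0"
      then obtain k where k: "inverse (real (Suc k)) < e / 3" using reals_Archimedean[of "e / 3"] by auto
      obtain s where s: "s \<in> R (n k)" using Rne by blast
      have "(\<lambda>i. \<bar>q (inverse (real (Suc i))) x - q s x\<bar>) \<longlonglongrightarrow> \<bar>l - q s x\<bar>"
        by (intro tendsto_intros l)
      moreover have "\<bar>q (inverse (real (Suc i))) x - q s x\<bar> \<le> inverse (real (Suc k))" if "i \<ge> Suc (n k)" for i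
        using ext[of "inverse (real (Suc i))" k s] s that by simp
      ultimately have ls: "\<bar>l - q s x\<bar> \<le> inverse (real (Suc k))"
        by (intro LIMSEQ_le_const2) blast+
      have "dist (q r x) l < e" if "r \<noteq> 0" "dist r 0 < inverse (real (Suc (n k)))" for r
        using ext[of r k s] s that ls k unfolding dist_real_def by auto
      then show "\<forall>\<^sub>F r in at 0. dist (q r x) l < e"
        unfolding eventually_at by (intro exI[of _ "inverse (real (Suc (n k)))"]) auto
    qed
    then show "\<exists>l. (h has_real_derivative l) (at x)" unfolding q_def DERIV_def by blast
  qed
  \<comment> \<open>Where no derivative exists \<open>deriv\<close> chooses from the empty
    predicate, so its value is the same at all such points.\<close>
  define c where "c = (SOME l::real. False)"
  have eq: "deriv h x = (if x \<in> D then lim (\<lambda>i. q (inverse (real (Suc i))) x) else c)" for x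
  proof (cases "x \<in> D")
    case True
    then obtain l where l: "(h has_real_derivative l) (at x)" using diffD by blast
    then have "((\<lambda>r. q r x) \<longlongrightarrow> l) (at 0)" unfolding q_def DERIV_def .
    moreover have "filterlim (\<lambda>i. inverse (real (Suc i))) (at 0) sequentially"
      unfolding filterlim_at using LIMSEQ_inverse_real_of_nat by simp
    ultimately have "(\<lambda>i. q (inverse (real (Suc i))) x) \<longlonglongrightarrow> l" by (rule filterlim_compose)
    then show ?thesis using l True by (simp add: limI DERIV_imp_deriv)
  next
    case False
    then have "\<not> (h has_real_derivative l) (at x)" for l using diffD by blast
    then show ?thesis using False by (simp add: deriv_def c_def)
  qed
  have "(\<lambda>x. if x \<in> D then lim (\<lambda>i. q (inverse (real (Suc i))) x) else c) \<in> borel_measurable borel"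
    by measurable
  then show ?thesis by (simp add: eq[abs_def] fun_eq_iff cong: measurable_cong)
qed

text \<open>The positive part of min(x, y). As a function of \<open>x\<close> it is the test
  function whose derivative is the indicator of [0, y]; as a function of \<open>y \<ge> 0\<close> it
  is the primitive of the step function that is 1 for v < x.\<close>

definition clamp_min :: "real \<Rightarrow> real \<Rightarrow> real" where
  "clamp_min x y = max 0 (min x y)"

lemma has_integral_step_mult:
  fixes g h :: "real \<Rightarrow> real"
  assumes g: "\<And>a b. a \<le> b \<Longrightarrow> (g has_integral h b - h a) {a..b}" and y: "0 \<le> y"
  shows "((\<lambda>v. g v * (if v < x then 1 else 0)) has_integral h (clamp_min x y) - h 0) {0..y}"
proof -
  have m: "0 \<le> clamp_min x y" "clamp_min x y \<le> y" using y by (auto simp: clamp_min_def)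
  have "((\<lambda>v. if v \<in> {0..clamp_min x y} then g v else 0) has_integral h (clamp_min x y) - h 0) {0..y}"
    using m by (subst has_integral_restrict) (auto intro!: g)
  then show ?thesis
  proof (rule has_integral_spike_finite[of "{clamp_min x y}", rotated 2])
    fix v assume "v \<in> {0..y} - {clamp_min x y}"
    then show "g v * (if v < x then 1 else 0) = (if v \<in> {0..clamp_min x y} then g v else 0)"
      by (auto simp: clamp_min_def max_def min_def split: if_splits)
  qed simp
qed

lemma has_integral_step: "0 \<le> y \<Longrightarrow> ((\<lambda>v. if v < x then 1 else 0) has_integral clamp_min x y) {0..y}"
proof -
  assume y: "0 \<le> y"
  have "((\<lambda>_. 1) has_integral b - a) {a..b}" if "a \<le> b" for a b :: real
    using has_integral_const_real[of "1::real" a b] that by simp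
  from has_integral_step_mult[where g = "\<lambda>_. 1" and h = "\<lambda>x. x", OF this y, of x]
  show ?thesis by simp
qed

text \<open>Since \<open>h1 x\<close> is the integral of \<open>g1\<close> against a step function,
  and likewise for \<open>h2\<close>, the error is \<open>g1\<close> and \<open>g2\<close>
  integrated against kernels whose primitives are the errors for test functions
  \<open>clamp_min\<close>. \<open>bounded_variation_integral_bound\<close> first replaces one test
  function by \<open>h2\<close>, then the other by \<open>h1\<close>, each time with a factor
  9.\<close>

lemma bilinear_bounded_variation:
  fixes \<alpha> \<xi> \<eta> :: "'i \<Rightarrow> real" and g1 g2 h1 h2 :: "real \<Rightarrow> real"
  assumes A: "finite A"
    and b1: "\<And>xs. sorted xs \<Longrightarrow> lvar g1 xs \<le> B1" and z1: "g1 z1 = 0"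
    and b2: "\<And>xs. sorted xs \<Longrightarrow> lvar g2 xs \<le> B2" and z2: "g2 z2 = 0"
    and i1: "\<And>a b. a \<le> b \<Longrightarrow> (g1 has_integral h1 b - h1 a) {a..b}"
    and i2: "\<And>a b. a \<le> b \<Longrightarrow> (g2 has_integral h2 b - h2 a) {a..b}"
    and h1: "\<And>x. x \<le> 0 \<Longrightarrow> h1 x = 0" "\<And>x. x \<ge> 1 \<Longrightarrow> h1 x = h1 1"
    and h2: "\<And>x. x \<le> 0 \<Longrightarrow> h2 x = 0" "\<And>x. x \<ge> 1 \<Longrightarrow> h2 x = h2 1"
    and M: "\<And>y1 y2. y1 \<in> {0..1} \<Longrightarrow> y2 \<in> {0..1} \<Longrightarrow>
      \<bar>(\<Sum>p\<in>A. \<alpha> p * clamp_min (\<xi> p) y1 * clamp_min (\<eta> p) y2) - clamp_min y1 y2 / L\<bar> \<le> M"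
    and L: "L \<noteq> 0"
  shows "\<bar>(\<Sum>p\<in>A. \<alpha> p * h1 (\<xi> p) * h2 (\<eta> p)) - integral {0..1} (\<lambda>x. g1 x * g2 x) / L\<bar> \<le> 81 * B1 * B2 * M"
proof -
  have hmn1: "h1 (clamp_min x 1) = h1 x" for x
    using h1(1)[of x] h1(1)[of 0] h1(2)[of x] by (cases "x \<le> 0"; cases "x \<ge> 1") (auto simp: clamp_min_def max_def min_def)
  have hmn2: "h2 (clamp_min x 1) = h2 x" for x
    using h2(1)[of x] h2(1)[of 0] h2(2)[of x] by (cases "x \<le> 0"; cases "x \<ge> 1") (auto simp: clamp_min_def max_def min_def)
  have s1: "((\<lambda>v. g1 v * (if v < x then 1 else 0)) has_integral h1 x) {0..1}" for x
    using has_integral_step_mult[where g = g1 and h = h1 and y = 1 and x = x, OF i1] h1(1)[of 0] by (simp add: hmn1)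
  have s2: "((\<lambda>v. g2 v * (if v < x then 1 else 0)) has_integral h2 x) {0..1}" for x
    using has_integral_step_mult[where g = g2 and h = h2 and y = 1 and x = x, OF i2] h2(1)[of 0] by (simp add: hmn2)
  have step2: "\<bar>(\<Sum>p\<in>A. \<alpha> p * clamp_min (\<xi> p) y1 * h2 (\<eta> p)) - h2 y1 / L\<bar> \<le> 9 * B2 * M" if y1: "y1 \<in> {0..1}" for y1
  proof -
    define \<Phi> where "\<Phi> v = (\<Sum>p\<in>A. \<alpha> p * clamp_min (\<xi> p) y1 * (if v < \<eta> p then 1 else 0)) - (if v < y1 then 1 else 0) / L" for v
    have \<Phi>i: "(\<Phi> has_integral (\<Sum>p\<in>A. \<alpha> p * clamp_min (\<xi> p) y1 * clamp_min (\<eta> p) y2) - clamp_min y1 y2 / L) {0..y2}" if "y2 \<ge> 0" for y2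
      unfolding \<Phi>_def
      by (intro has_integral_diff has_integral_sum A has_integral_mult_right has_integral_divide has_integral_step that)
    have \<Phi>b: "\<bar>integral {0..y2} \<Phi>\<bar> \<le> M" if "y2 \<in> {0..1}" for y2
      using M[OF y1 that] \<Phi>i[of y2] that by (simp add: integral_unique)
    have "\<Phi> integrable_on {0..1}" using \<Phi>i[of 1] by auto
    note bound = bounded_variation_integral_bound(2)[of g2 B2, OF b2 z2 this \<Phi>b]
    have "((\<lambda>v. (\<Sum>p\<in>A. \<alpha> p * clamp_min (\<xi> p) y1 * (g2 v * (if v < \<eta> p then 1 else 0))) - g2 v * (if v < y1 then 1 else 0) / L)
        has_integral (\<Sum>p\<in>A. \<alpha> p * clamp_min (\<xi> p) y1 * h2 (\<eta> p)) - h2 y1 / L) {0..1}"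
      by (intro has_integral_diff has_integral_sum A has_integral_mult_right has_integral_divide s2)
    moreover have "(\<Sum>p\<in>A. \<alpha> p * clamp_min (\<xi> p) y1 * (g2 v * (if v < \<eta> p then 1 else 0))) - g2 v * (if v < y1 then 1 else 0) / L
        = g2 v * \<Phi> v" for v
      unfolding \<Phi>_def right_diff_distrib sum_distrib_left by (simp add: mult_ac)
    ultimately have "integral {0..1} (\<lambda>v. g2 v * \<Phi> v) = (\<Sum>p\<in>A. \<alpha> p * clamp_min (\<xi> p) y1 * h2 (\<eta> p)) - h2 y1 / L"
      by (simp add: integral_unique)
    then show ?thesis using bound by simp
  qed
  define \<Phi> where "\<Phi> v = (\<Sum>p\<in>A. \<alpha> p * h2 (\<eta> p) * (if v < \<xi> p then 1 else 0)) - g2 v / L" for v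
  have \<Phi>i: "(\<Phi> has_integral (\<Sum>p\<in>A. \<alpha> p * h2 (\<eta> p) * clamp_min (\<xi> p) y) - h2 y / L) {0..y}" if "y \<ge> 0" for y
  proof -
    have "(g2 has_integral h2 y) {0..y}" using i2[OF that] h2(1)[of 0] by simp
    then show ?thesis
      unfolding \<Phi>_def
      by (intro has_integral_diff has_integral_sum A has_integral_mult_right has_integral_divide has_integral_step that)
  qed
  have \<Phi>b: "\<bar>integral {0..y} \<Phi>\<bar> \<le> 9 * B2 * M" if "y \<in> {0..1}" for y
    using step2[OF that] \<Phi>i[of y] that by (simp add: integral_unique mult_ac)
  have "\<Phi> integrable_on {0..1}" using \<Phi>i[of 1] by auto
  note bound = bounded_variation_integral_bound[of g1 B1, OF b1 z1 this \<Phi>b]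
  have "((\<lambda>v. (\<Sum>p\<in>A. \<alpha> p * h2 (\<eta> p) * (g1 v * (if v < \<xi> p then 1 else 0))) - g1 v * \<Phi> v)
      has_integral (\<Sum>p\<in>A. \<alpha> p * h2 (\<eta> p) * h1 (\<xi> p)) - integral {0..1} (\<lambda>v. g1 v * \<Phi> v)) {0..1}"
    using integrable_integral[OF bound(1)]
    by (intro has_integral_diff has_integral_sum A has_integral_mult_right s1)
  moreover have "(\<Sum>p\<in>A. \<alpha> p * h2 (\<eta> p) * (g1 v * (if v < \<xi> p then 1 else 0))) - g1 v * \<Phi> v = g1 v * g2 v / L" for v
    unfolding \<Phi>_def right_diff_distrib sum_distrib_left by (simp add: mult_ac)
  ultimately have "((\<lambda>v. g1 v * g2 v / L) has_integral (\<Sum>p\<in>A. \<alpha> p * h2 (\<eta> p) * h1 (\<xi> p)) - integral {0..1} (\<lambda>v. g1 v * \<Phi> v)) {0..1}"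
    by simp
  then have "integral {0..1} (\<lambda>v. g1 v * g2 v / L) = (\<Sum>p\<in>A. \<alpha> p * h2 (\<eta> p) * h1 (\<xi> p)) - integral {0..1} (\<lambda>v. g1 v * \<Phi> v)"
    by (rule integral_unique)
  also have "(\<Sum>p\<in>A. \<alpha> p * h2 (\<eta> p) * h1 (\<xi> p)) = (\<Sum>p\<in>A. \<alpha> p * h1 (\<xi> p) * h2 (\<eta> p))"
    by (intro sum.cong refl) simp
  finally have "integral {0..1} (\<lambda>v. g1 v * g2 v / L) = (\<Sum>p\<in>A. \<alpha> p * h1 (\<xi> p) * h2 (\<eta> p)) - integral {0..1} (\<lambda>v. g1 v * \<Phi> v)" .
  moreover have "integral {0..1} (\<lambda>v. g1 v * g2 v / L) = integral {0..1} (\<lambda>v. g1 v * g2 v) / L"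
    by simp
  ultimately show ?thesis using bound(2) by simp
qed

section \<open>Versions of the derivative, test functions and conclusion\<close>

lemma lvar_le_total_variation: "sorted xs \<Longrightarrow> ereal (lvar g xs) \<le> total_variation g"
  unfolding total_variation_def lvar_def by (rule SUP_upper) simp

lemma V_nonneg: "0 \<le> V f"
  unfolding V_def
proof (rule INF_greatest)
  fix g :: "real \<Rightarrow> real"
  show "0 \<le> total_variation g"
    using lvar_le_total_variation[of "[]" g] by (simp add: zero_ereal_def)
qed

lemma V_approx:
  assumes "V f < \<infinity>" "e > 0"
  obtains g where "AE x in lborel. g x = f x" "\<And>xs. sorted xs \<Longrightarrow> lvar g xs \<le> real_of_ereal (V f) + e"
proof -
  obtain v where v: "V f = ereal v" using assms(1) V_nonneg[of f] by (cases "V f") auto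
  have "V f < ereal (v + e)" using v assms(2) by simp
  then have "(INF g \<in> {g :: real \<Rightarrow> real. AE x in lborel. g x = f x}. total_variation g) < ereal (v + e)"
    unfolding V_def .
  then obtain g where g: "AE x in lborel. g x = f x" "total_variation g < ereal (v + e)"
    unfolding INF_less_iff by auto
  show thesis
  proof (rule that[OF g(1)])
    fix xs :: "real list" assume "sorted xs"
    then have "ereal (lvar g xs) < ereal (v + e)"
      by (rule le_less_trans[OF lvar_le_total_variation g(2)])
    then show "lvar g xs \<le> real_of_ereal (V f) + e" by (simp add: v)
  qed
qed

lemma deriv_eq_0_open:
  fixes h :: "real \<Rightarrow> real"
  assumes "open S" "x \<in> S" "\<And>y. y \<in> S \<Longrightarrow> h y = c"
  shows "deriv h x = 0"
proof (rule DERIV_imp_deriv)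
  have "((\<lambda>_. c) has_real_derivative 0) (at x)" by simp
  then show "(h has_real_derivative 0) (at x)"
    by (rule has_field_derivative_transform_within_open[OF _ assms(1,2)]) (simp add: assms(3))
qed

text \<open>The derivative of \<open>h\<close> vanishes on the negative axis, so a version of it has
  a zero in (-1, 0), an interval of positive measure. From that zero, bounded variation gives the
  uniform bound.\<close>

lemma derivative_version_facts:
  assumes ac: "abs_continuous_real h" and h: "\<forall>x\<le>0. h x = 0" "\<forall>x\<ge>1. h x = h 1"
    and g: "AE x in lborel. g x = deriv h x" and bnd: "\<And>xs. sorted xs \<Longrightarrow> lvar g xs \<le> B"
  shows "\<exists>z. g z = 0" "\<And>a b. a \<le> b \<Longrightarrow> (g has_integral h b - h a) {a..b}"
    "g \<in> borel_measurable borel" "\<And>x. \<bar>g x\<bar> \<le> B"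
proof -
  have d0: "deriv h x = 0" if "x < 0" for x
    using that h(1) by (intro deriv_eq_0_open[of "{..<0}" _ _ 0]) auto
  show ex: "\<exists>z. g z = 0"
  proof (rule ccontr)
    assume "\<nexists>z. g z = 0"
    then have nz: "g x \<noteq> 0" for x by blast
    have "AE x in lborel. x \<notin> {-1<..<(0::real)}"
      using g
    proof eventually_elim
      case (elim x)
      then show ?case using d0[of x] nz[of x] by auto
    qed
    then have "{-1<..<(0::real)} \<in> null_sets lborel"
      by (subst AE_iff_null_sets) auto
    then show False by auto
  qed
  then obtain z where z: "g z = 0" by blast
  show gm: "g \<in> borel_measurable borel" using bnd by (rule bounded_variation_borel)
  show gb: "\<bar>g x\<bar> \<le> B" for x
    using bounded_variation_diff_le[of g B x z] bnd z by simp
  show "(g has_integral h b - h a) {a..b}" if "a \<le> b" for a b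
    using abs_continuous_real_FTC[OF ac h g gm gb that] .
qed

text \<open>The derivative of \<open>h1\<close> is 0 off [0,1], because \<open>h1\<close> is
  constant on both open outer half-lines; on [0,1] both derivatives are replaced almost everywhere
  by their versions.\<close>

lemma integral_deriv_mult:
  assumes ac: "abs_continuous_real h1" "abs_continuous_real h2"
    and h: "\<forall>x\<le>0. h1 x = 0" "\<forall>x\<ge>1. h1 x = h1 1"
    and g: "AE x in lborel. g1 x = deriv h1 x" "AE x in lborel. g2 x = deriv h2 x"
    and gm[measurable]: "g1 \<in> borel_measurable borel" "g2 \<in> borel_measurable borel"
    and gb: "\<And>x. \<bar>g1 x\<bar> \<le> B1" "\<And>x. \<bar>g2 x\<bar> \<le> B2"
  shows "(\<integral>x. deriv h1 x * deriv h2 x \<partial>lborel) = integral {0..1} (\<lambda>x. g1 x * g2 x)"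
proof -
  have [measurable]: "deriv h1 \<in> borel_measurable borel" "deriv h2 \<in> borel_measurable borel"
    using ac by (auto intro: deriv_borel_measurable abs_continuous_real_continuous)
  have out: "deriv h1 x = 0" if "x \<notin> {0..1}" for x
  proof (cases "x < 0")
    case True
    then show ?thesis using h(1) by (intro deriv_eq_0_open[of "{..<0}" _ _ 0]) auto
  next
    case False
    have c: "h1 y = h1 1" if "y \<in> {1<..}" for y
      using h(2)[rule_format, of y] that by simp
    show ?thesis by (rule deriv_eq_0_open[of "{1<..}" _ _ "h1 1"]) (use False that c in \<open>auto\<close>)
  qed
  have "(\<integral>x. deriv h1 x * deriv h2 x \<partial>lborel) = (\<integral>x. indicator {0..1} x *\<^sub>R (g1 x * g2 x) \<partial>lborel)"
  proof (rule integral_cong_AE)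
    show "AE x in lborel. deriv h1 x * deriv h2 x = indicator {0..1} x *\<^sub>R (g1 x * g2 x)"
      using g
    proof eventually_elim
      case (elim x)
      then show ?case using out[of x] by (cases "x \<in> {0..1}") auto
    qed
  qed measurable
  also have "\<dots> = integral {0..1} (\<lambda>x. g1 x * g2 x)"
  proof -
    have "set_integrable lborel {0..1} (\<lambda>x. g1 x * g2 x)"
      unfolding set_integrable_def
    proof (rule Bochner_Integration.integrable_bound)
      show "integrable lborel (\<lambda>x. (B1 * B2) * indicator {0..1::real} x)" by simp
      show "AE x in lborel. norm (indicator {0..1} x *\<^sub>R (g1 x * g2 x)) \<le> norm ((B1 * B2) * indicator {0..1::real} x)"
      proof (intro AE_I2)
        fix x
        have "\<bar>g1 x * g2 x\<bar> \<le> B1 * B2" unfolding abs_mult using gb[of x] by (intro mult_mono) (auto intro: order_trans[OF abs_ge_zero])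
        then show "norm (indicator {0..1} x *\<^sub>R (g1 x * g2 x)) \<le> norm ((B1 * B2) * indicator {0..1::real} x)"
          by (auto split: split_indicator)
      qed
    qed measurable
    from set_borel_integral_eq_integral(2)[OF this] show ?thesis
      by (simp add: set_lebesgue_integral_def)
  qed
  finally show ?thesis .
qed

text \<open>The points \<open>X y = D2 * exp (- L * y)\<close> run from \<open>D2\<close> down to
  \<open>D1\<close>, so \<open>D1 \<ge> 1\<close> keeps them at least 1. A test function is
  (\<open>log_plus (X 0) d - log_plus (X y) d\<close>)/L, so the sum is a mixed difference of the
  quadratic form over four corners, each with error \<open>K\<close>. The main terms combine to L
  times y1 + y2 - max(y1, y2), the minimum.\<close>

lemma quadratic_sum_test_functions:
  assumes K: "\<And>X1 X2 N. 1 \<le> X1 \<Longrightarrow> 1 \<le> X2 \<Longrightarrow> X1 \<le> real N \<Longrightarrow> X2 \<le> real N \<Longrightarrow>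
    \<bar>(\<Sum>d1\<in>{1..N}. \<Sum>d2\<in>{1..N}. real_of_int (mu d1 * mu d2) / real (lcm d1 d2) * log_plus X1 d1 * log_plus X2 d2)
      - ln (min X1 X2)\<bar> \<le> K"
    and D: "1 \<le> D1" "D1 < D2" "D2 \<le> real N" and L: "L = ln (D2 / D1)"
    and y: "y1 \<in> {0..1}" "y2 \<in> {0..1}"
  shows "\<bar>(\<Sum>p\<in>{1..N} \<times> {1..N}. (real_of_int (mu (fst p) * mu (snd p)) / real (lcm (fst p) (snd p)))
      * clamp_min (ln (D2 / real (fst p)) / L) y1 * clamp_min (ln (D2 / real (snd p)) / L) y2) - clamp_min y1 y2 / L\<bar> \<le> 4 * K / L\<^sup>2"
proof -
  have L0: "L > 0" unfolding L using D by simp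
  define X where "X y = D2 * exp (- L * y)" for y
  have X: "1 \<le> X y \<and> X y \<le> real N \<and> ln (X y) = ln D2 - L * y" if "y \<in> {0..1}" for y
  proof -
    have "L * y \<le> L * 1" using that L0 by (intro mult_left_mono) auto
    then have "exp (- L) \<le> exp (- L * y)" by simp
    moreover have "exp (- L) = D1 / D2" unfolding L using D by (simp add: exp_minus)
    ultimately have "D2 * (D1 / D2) \<le> X y" unfolding X_def using D by (intro mult_left_mono) auto
    then have 1: "1 \<le> X y" using D by simp
    have "exp (- L * y) \<le> 1" using that L0 by simp
    then have "X y \<le> D2 * 1" unfolding X_def using D by (intro mult_left_mono) auto
    moreover have "ln (X y) = ln D2 - L * y" unfolding X_def using D by (simp add: ln_mult)
    ultimately show ?thesis using 1 D by simp
  qed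
  define G where "G a b = (\<Sum>d1\<in>{1..N}. \<Sum>d2\<in>{1..N}. real_of_int (mu d1 * mu d2) / real (lcm d1 d2) * log_plus (X a) d1 * log_plus (X b) d2)" for a b
  have G: "\<bar>G a b - (ln D2 - L * max a b)\<bar> \<le> K" if "a \<in> {0..1}" "b \<in> {0..1}" for a b
  proof -
    have "X a > 0" "X b > 0" using X[OF that(1)] X[OF that(2)] by auto
    then have "ln (min (X a) (X b)) = min (ln (X a)) (ln (X b))"
      by (auto simp: min_def)
    also have "\<dots> = ln D2 - L * max a b"
    proof (cases "a \<le> b")
      case True
      then have "L * a \<le> L * b" using L0 by (intro mult_left_mono) auto
      then show ?thesis using X[OF that(1)] X[OF that(2)] True by (simp add: min_def max_def)
    next
      case False
      then have "L * b \<le> L * a" using L0 by (intro mult_left_mono) auto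
      then show ?thesis using X[OF that(1)] X[OF that(2)] False by (simp add: min_def max_def)
    qed
    finally show ?thesis using K[of "X a" "X b" N] X[OF that(1)] X[OF that(2)] unfolding G_def by simp
  qed
  have mneq: "clamp_min (ln (D2 / real d) / L) y = (log_plus (X 0) d - log_plus (X y) d) / L" if y: "y \<in> {0..1}" and d: "d \<in> {1..N}" for y d
  proof -
    define x where "x = ln (D2 / real d) / L"
    have lx: "ln (D2 / real d) = L * x" using L0 by (simp add: x_def)
    have "log_plus (X 0) d = max 0 (L * x)" unfolding log_plus_def X_def using lx by simp
    moreover have "ln (X y / real d) = L * (x - y)"
    proof -
      have "X y > 0" using X[OF y] by simp
      then have "ln (X y / real d) = ln D2 - L * y - ln (real d)" using X[OF y] d by (simp add: ln_div)
      also have "\<dots> = ln (D2 / real d) - L * y" using D d by (simp add: ln_div)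
      finally show ?thesis by (simp add: lx right_diff_distrib)
    qed
    then have "log_plus (X y) d = max 0 (L * (x - y))" unfolding log_plus_def by simp
    moreover have "max 0 (L * z) = L * max 0 z" for z using L0 by (auto simp: max_def mult_le_0_iff zero_le_mult_iff)
    ultimately have "(log_plus (X 0) d - log_plus (X y) d) / L = max 0 x - max 0 (x - y)"
      using L0 by (simp add: right_diff_distrib[symmetric])
    also have "\<dots> = clamp_min x y" using y by (auto simp: clamp_min_def max_def min_def)
    finally show ?thesis by (simp add: x_def)
  qed
  let ?S = "\<Sum>p\<in>{1..N} \<times> {1..N}. (real_of_int (mu (fst p) * mu (snd p)) / real (lcm (fst p) (snd p)))
      * clamp_min (ln (D2 / real (fst p)) / L) y1 * clamp_min (ln (D2 / real (snd p)) / L) y2"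
  have "?S = (\<Sum>d1\<in>{1..N}. \<Sum>d2\<in>{1..N}. real_of_int (mu d1 * mu d2) / real (lcm d1 d2)
      * clamp_min (ln (D2 / real d1) / L) y1 * clamp_min (ln (D2 / real d2) / L) y2)"
    by (simp add: sum.cartesian_product case_prod_beta)
  also have "\<dots> = (\<Sum>d1\<in>{1..N}. \<Sum>d2\<in>{1..N}. real_of_int (mu d1 * mu d2) / real (lcm d1 d2)
      * ((log_plus (X 0) d1 - log_plus (X y1) d1) / L) * ((log_plus (X 0) d2 - log_plus (X y2) d2) / L))"
    using y by (intro sum.cong refl) (simp only: mneq)
  also have "\<dots> = (G 0 0 - G 0 y2 - G y1 0 + G y1 y2) / L\<^sup>2"
  proof -
    have alg: "c * ((a0 - a1) / L) * ((b0 - b2) / L) = (c * a0 * b0 - c * a0 * b2 - c * a1 * b0 + c * a1 * b2) / L\<^sup>2"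
      for c a0 a1 b0 b2 :: real
    proof -
      have "c * ((a0 - a1) / L) * ((b0 - b2) / L) = c * (a0 - a1) * (b0 - b2) / L\<^sup>2"
        by (simp add: power2_eq_square)
      also have "c * (a0 - a1) * (b0 - b2) = c * a0 * b0 - c * a0 * b2 - c * a1 * b0 + c * a1 * b2"
        by (simp add: algebra_simps)
      finally show ?thesis .
    qed
    show ?thesis
      by (simp only: alg G_def sum_subtractf sum.distrib sum_divide_distrib[symmetric])
  qed
  finally have S: "?S = (G 0 0 - G 0 y2 - G y1 0 + G y1 y2) / L\<^sup>2" .
  have m: "clamp_min y1 y2 = y1 + y2 - max y1 y2" using y by (auto simp: clamp_min_def max_def min_def)
  have "\<bar>G 0 0 - G 0 y2 - G y1 0 + G y1 y2 - L * clamp_min y1 y2\<bar> \<le> 4 * K"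
  proof -
    have "\<bar>G 0 0 - ln D2\<bar> \<le> K" using G[of 0 0] by simp
    moreover have "\<bar>G 0 y2 - (ln D2 - L * y2)\<bar> \<le> K" using G[of 0 y2] y by (simp add: max_def split: if_splits)
    moreover have "\<bar>G y1 0 - (ln D2 - L * y1)\<bar> \<le> K" using G[of y1 0] y by (simp add: max_def split: if_splits)
    moreover have "\<bar>G y1 y2 - (ln D2 - L * max y1 y2)\<bar> \<le> K" using G[OF y] .
    moreover have "L * clamp_min y1 y2 = L * y1 + L * y2 - L * max y1 y2" unfolding m by (simp add: algebra_simps)
    ultimately show ?thesis by linarith
  qed
  then have "\<bar>G 0 0 - G 0 y2 - G y1 0 + G y1 y2 - L * clamp_min y1 y2\<bar> / L\<^sup>2 \<le> 4 * K / L\<^sup>2"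
    by (intro divide_right_mono) auto
  moreover have "?S - clamp_min y1 y2 / L = (G 0 0 - G 0 y2 - G y1 0 + G y1 y2 - L * clamp_min y1 y2) / L\<^sup>2"
    unfolding S using L0 by (simp add: diff_divide_distrib power2_eq_square)
  ultimately show ?thesis by (simp add: abs_divide)
qed


theorem theorem2:
  "\<exists>C::real. \<forall>(D1::real) (D2::real) (h1::real \<Rightarrow> real) (h2::real \<Rightarrow> real).
     1 \<le> D1 \<and> D1 < D2 \<and>
     abs_continuous_real h1 \<and> abs_continuous_real h2 \<and>
     (\<forall>x\<le>0. h1 x = 0) \<and> (\<forall>x\<ge>1. h1 x = h1 1) \<and>
     (\<forall>x\<le>0. h2 x = 0) \<and> (\<forall>x\<ge>1. h2 x = h2 1) \<and>
     V (deriv h1) < \<infinity> \<and> V (deriv h2) < \<infinity>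
     \<longrightarrow>
     (let L = ln (D2 / D1);
          \<rho>1 = (\<lambda>t::real. h1 (ln (D2 / t) / L));
          \<rho>2 = (\<lambda>t::real. h2 (ln (D2 / t) / L))
      in \<bar>(\<Sum>\<^sub>\<infinity>(d1, d2) \<in> {1::nat..} \<times> {1::nat..}.
              real_of_int (mu d1 * mu d2) / real (lcm d1 d2) * \<rho>1 (real d1) * \<rho>2 (real d2))
           - (\<integral>x. deriv h1 x * deriv h2 x \<partial>lborel) / L\<bar>
         \<le> C * (real_of_ereal (V (deriv h1)) * real_of_ereal (V (deriv h2))) / L\<^sup>2)"
proof -
  obtain C0 where star: "\<forall>y\<ge>1. \<bar>mlog 1 y - 1\<bar> \<le> C0 * log_weight y"
    using mlog_decay by blast
  from quadratic_sum_bound[OF star]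
  obtain K where "K \<ge> 0" and K: "\<forall>X1 X2 N. 1 \<le> X1 \<longrightarrow> 1 \<le> X2 \<longrightarrow> X1 \<le> real N \<longrightarrow> X2 \<le> real N \<longrightarrow>
    \<bar>(\<Sum>d1\<in>{1..N}. \<Sum>d2\<in>{1..N}. real_of_int (mu d1 * mu d2) / real (lcm d1 d2) * log_plus X1 d1 * log_plus X2 d2)
      - ln (min X1 X2)\<bar> \<le> K"
    by (elim exE conjE)
  show ?thesis
  \<comment> \<open>324 = 81 * 4: 81 from \<open>bilinear_bounded_variation\<close>, 4 from the four
    corners in \<open>quadratic_sum_test_functions\<close>.\<close>
  proof (intro exI[of _ "324 * K"] allI impI, elim conjE)
    fix D1 D2 :: real and h1 h2 :: "real \<Rightarrow> real"
    assume D: "1 \<le> D1" "D1 < D2" and ac: "abs_continuous_real h1" "abs_continuous_real h2"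
      and h1: "\<forall>x\<le>0. h1 x = 0" "\<forall>x\<ge>1. h1 x = h1 1"
      and h2: "\<forall>x\<le>0. h2 x = 0" "\<forall>x\<ge>1. h2 x = h2 1"
      and V: "V (deriv h1) < \<infinity>" "V (deriv h2) < \<infinity>"
    define L where "L = ln (D2 / D1)"
    have L0: "L > 0" unfolding L_def using D by simp
    define N where "N = nat \<lceil>D2\<rceil>"
    have N: "D2 \<le> real N" unfolding N_def by (rule real_nat_ceiling_ge)
    define x where "x d = ln (D2 / real d) / L" for d :: nat
    define \<alpha> where "\<alpha> p = real_of_int (mu (fst p) * mu (snd p)) / real (lcm (fst p) (snd p))" for p :: "nat \<times> nat"
    define I where "I = (\<integral>x. deriv h1 x * deriv h2 x \<partial>lborel)"
    define S where "S = (\<Sum>\<^sub>\<infinity>(d1, d2) \<in> {1::nat..} \<times> {1::nat..}.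
      real_of_int (mu d1 * mu d2) / real (lcm d1 d2) * h1 (ln (D2 / real d1) / L) * h2 (ln (D2 / real d2) / L))"
    \<comment> \<open>Beyond \<open>N\<close>, which is at least \<open>D2\<close>, the argument of
      h_i is at most 0, so the double series is a finite sum.\<close>
    have x0: "x d \<le> 0" if "d > N" for d
    proof -
      have "D2 / real d \<le> 1" using that N D by (simp add: divide_le_eq)
      then have "ln (D2 / real d) \<le> 0" using that D by (subst ln_le_zero_iff) auto
      then show ?thesis unfolding x_def using L0 by (simp add: divide_nonpos_pos)
    qed
    have "S = (\<Sum>\<^sub>\<infinity>p \<in> {1..N} \<times> {1..N}. \<alpha> p * h1 (x (fst p)) * h2 (x (snd p)))"
      unfolding S_def
    proof (rule infsum_cong_neutral)
      fix p :: "nat \<times> nat" assume "p \<in> ({1..} \<times> {1..}) - ({1..N} \<times> {1..N})"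
      then have "fst p > N \<or> snd p > N" by auto
      then have "h1 (x (fst p)) = 0 \<or> h2 (x (snd p)) = 0" using x0 h1(1) h2(1) by blast
      then show "(case p of (d1, d2) \<Rightarrow> real_of_int (mu d1 * mu d2) / real (lcm d1 d2) *
          h1 (ln (D2 / real d1) / L) * h2 (ln (D2 / real d2) / L)) = 0"
        by (auto simp: x_def case_prod_beta)
    qed (auto simp: \<alpha>_def x_def)
    then have S: "S = (\<Sum>p \<in> {1..N} \<times> {1..N}. \<alpha> p * h1 (x (fst p)) * h2 (x (snd p)))"
      by simp
    define v1 where "v1 = real_of_ereal (V (deriv h1))"
    define v2 where "v2 = real_of_ereal (V (deriv h2))"
    \<comment> \<open>\<open>V\<close> is an infimum that is only approached: the chosen versions of
      the derivatives exceed it by at most \<open>e\<close>, and \<open>e\<close> tends to 0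
      afterwards.\<close>
    have main: "\<bar>S - I / L\<bar> \<le> 81 * (v1 + e) * (v2 + e) * (4 * K / L\<^sup>2)" if e: "e > 0" for e
    proof -
      obtain g1 where g1: "AE x in lborel. g1 x = deriv h1 x" "\<And>xs. sorted xs \<Longrightarrow> lvar g1 xs \<le> v1 + e"
        using V_approx[OF V(1) e] unfolding v1_def by metis
      obtain g2 where g2: "AE x in lborel. g2 x = deriv h2 x" "\<And>xs. sorted xs \<Longrightarrow> lvar g2 xs \<le> v2 + e"
        using V_approx[OF V(2) e] unfolding v2_def by metis
      note f1 = derivative_version_facts[OF ac(1) h1 g1] and f2 = derivative_version_facts[OF ac(2) h2 g2]
      obtain z1 where z1: "g1 z1 = 0" using f1(1) by blast
      obtain z2 where z2: "g2 z2 = 0" using f2(1) by blast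
      have I: "I = integral {0..1} (\<lambda>x. g1 x * g2 x)"
        unfolding I_def by (rule integral_deriv_mult[OF ac h1 g1(1) g2(1) f1(3) f2(3) f1(4) f2(4)])
      show ?thesis
        unfolding S I
      proof (rule bilinear_bounded_variation[where ?h1.0 = h1 and ?h2.0 = h2 and \<alpha> = \<alpha>
            and \<xi> = "\<lambda>p. x (fst p)" and \<eta> = "\<lambda>p. x (snd p)"])
        show "\<bar>(\<Sum>p\<in>{1..N} \<times> {1..N}. \<alpha> p * clamp_min (x (fst p)) y1 * clamp_min (x (snd p)) y2) - clamp_min y1 y2 / L\<bar> \<le> 4 * K / L\<^sup>2"
          if "y1 \<in> {0..1}" "y2 \<in> {0..1}" for y1 y2
          unfolding \<alpha>_def x_def by (rule quadratic_sum_test_functions[OF K[rule_format] D N L_def that])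
        show "h1 y = h1 1" if "y \<ge> 1" for y using h1(2) that by blast
        show "h2 y = h2 1" if "y \<ge> 1" for y using h2(2) that by blast
        show "h1 y = 0" if "y \<le> 0" for y using h1(1) that by blast
        show "h2 y = 0" if "y \<le> 0" for y using h2(1) that by blast
      qed (use z1 z2 g1(2) g2(2) f1(2) f2(2) L0 in auto)
    qed
    have "(\<lambda>n. 81 * (v1 + inverse (real (Suc n))) * (v2 + inverse (real (Suc n))) * (4 * K / L\<^sup>2))
        \<longlonglongrightarrow> 81 * (v1 + 0) * (v2 + 0) * (4 * K / L\<^sup>2)"
      by (intro tendsto_intros LIMSEQ_inverse_real_of_nat)
    then have "\<bar>S - I / L\<bar> \<le> 81 * (v1 + 0) * (v2 + 0) * (4 * K / L\<^sup>2)"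
      by (rule LIMSEQ_le_const) (intro exI allI impI main, simp)
    then have "\<bar>S - I / L\<bar> \<le> 324 * K * (v1 * v2) / L\<^sup>2"
      by (simp add: mult_ac)
    then show "let L = ln (D2 / D1);
          \<rho>1 = (\<lambda>t::real. h1 (ln (D2 / t) / L));
          \<rho>2 = (\<lambda>t::real. h2 (ln (D2 / t) / L))
      in \<bar>(\<Sum>\<^sub>\<infinity>(d1, d2) \<in> {1::nat..} \<times> {1::nat..}.
              real_of_int (mu d1 * mu d2) / real (lcm d1 d2) * \<rho>1 (real d1) * \<rho>2 (real d2))
           - (\<integral>x. deriv h1 x * deriv h2 x \<partial>lborel) / L\<bar>
         \<le> 324 * K * (real_of_ereal (V (deriv h1)) * real_of_ereal (V (deriv h2))) / L\<^sup>2"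
      unfolding Let_def L_def[symmetric] S_def[symmetric] I_def[symmetric] v1_def v2_def .
  qed
qed

end
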